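(* Let $d\in\{2,3\}$, and let $K,R\in\mathbb{N}$ be such that $K=\frac{\pi}{h}$ and $R\sim h^{-\alpha}$ with $\alpha\ge0$ for some $h\in(0,1]$. For a lattice-admissible pair $(q,r)$, i.e. $2\le q,r\le\infty$ with $\frac3q+\frac dr=\frac d2$ and $(q,r,d)\ne(2,\infty,3)$, we have $$\big\|e^{it\Delta_\Omega}w_0\big\|_{L^q_t([0,1];L^r(\Omega))}\lesssim\big\|(1-\Delta_\Omega)^{\frac s2}w_0\big\|_{L^2(\Omega)}$$ for all $w_0:\Omega\to\mathbb{C}$ with $w_0|_{\partial\Omega}=0$, where $$\begin{cases}s>\frac1q&\text{if }\alpha\ge1,\\ s=\frac{2-\alpha}{q}&\text{if }0<\alpha<1,\\ s>\frac2q&\text{if }\alpha=0.\end{cases}$$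
   Context: $R\sim h^{-\alpha}$ means $c_0^{-1}h^{-\alpha}\le R\le c_0h^{-\alpha}$ with a fixed constant $c_0\ge1$. $A\lesssim B$ means $A\le CB$ with $C$ independent of $h$ (hence of $K$, $R$ for fixed $\alpha,c_0$) and of $w_0$; $C$ may depend on $d,\alpha,c_0,q,r,s$. $\Omega=\{x\in h\mathbb{Z}^d:-\pi R\le x_j\le\pi R\text{ for all }j\}$, $\partial\Omega=\{x\in\Omega:x_j=\pm\pi R\text{ for some }j\}$. For $f:\Omega\to\mathbb{C}$ with $f|_{\partial\Omega}=0$, $\Delta_\Omega f(x)=\frac1{h^2}\sum_{j=1}^d\big(f(x+h\mathbf e_j)+f(x-h\mathbf e_j)-2f(x)\big)$ for $x\in\Omega\setminus\partial\Omega$ and $\Delta_\Omega f(x)=0$ for $x\in\partial\Omega$, with $\{\mathbf e_j\}$ the standard basis of $\mathbb{R}^d$. This operator is self-adjoint and non-positive on the space $L^2(\Omega)$ of functions vanishing on $\partial\Omega$, and $e^{it\Delta_\Omega}$, $(1-\Delta_\Omega)^{s/2}$ are defined by functional calculus. Norms: $\|f\|_{L^p(\Omega)}=\big(h^d\sum_{x\in\Omega}|f(x)|^p\big)^{1/p}$ for $1\le p<\infty$ and $\|f\|_{L^\infty(\Omega)}=\sup_{x\in\Omega}|f(x)|$. *)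

theory Defs
  imports "HOL-Analysis.Analysis" "HOL-Probability.Essential_Supremum"
begin

definition lattice_box :: "real \<Rightarrow> nat \<Rightarrow> (real ^ 'd) set" where
  "lattice_box h R =
     {x. (\<forall>j. \<exists>m::int. x $ j = h * of_int m) \<and>
         (\<forall>j. - pi * real R \<le> x $ j \<and> x $ j \<le> pi * real R)}"

definition box_boundary :: "real \<Rightarrow> nat \<Rightarrow> (real ^ 'd) set" where
  "box_boundary h R =
     {x \<in> lattice_box h R. \<exists>j. x $ j = pi * real R \<or> x $ j = - pi * real R}"

text \<open>Functions on the box vanishing on its boundary are represented by their
  extension by zero to all of \<open>real ^ 'd\<close>.\<close>

definition dirichlet_space :: "real \<Rightarrow> nat \<Rightarrow> (real ^ 'd \<Rightarrow> complex) set" where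
  "dirichlet_space h R = {f. \<forall>x. x \<notin> lattice_box h R - box_boundary h R \<longrightarrow> f x = 0}"

definition discrete_laplacian ::
  "real \<Rightarrow> nat \<Rightarrow> (real ^ 'd \<Rightarrow> complex) \<Rightarrow> real ^ 'd \<Rightarrow> complex" where
  "discrete_laplacian h R f x =
     (if x \<in> lattice_box h R - box_boundary h R
      then (1 / of_real (h\<^sup>2)) *
           (\<Sum>j\<in>UNIV. f (x + h *\<^sub>R axis j 1) + f (x - h *\<^sub>R axis j 1) - 2 * f x)
      else 0)"

definition box_Lp_norm :: "real \<Rightarrow> nat \<Rightarrow> ereal \<Rightarrow> (real ^ 'd \<Rightarrow> complex) \<Rightarrow> real" where
  "box_Lp_norm h R p f =
     (if p = \<infinity> then (SUP x\<in>lattice_box h R. cmod (f x))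
      else (h ^ CARD('d) * (\<Sum>x\<in>lattice_box h R. cmod (f x) powr real_of_ereal p))
             powr (1 / real_of_ereal p))"

definition box_inner ::
  "real \<Rightarrow> nat \<Rightarrow> (real ^ 'd \<Rightarrow> complex) \<Rightarrow> (real ^ 'd \<Rightarrow> complex) \<Rightarrow> complex" where
  "box_inner h R f g = of_real (h ^ CARD('d)) * (\<Sum>x\<in>lattice_box h R. f x * cnj (g x))"

text \<open>Functional calculus of the Laplacian as a self-adjoint operator on the
  finite-dimensional Hilbert space \<^const>\<open>dirichlet_space\<close>:
  \<open>\<phi>(\<Delta>) = \<Sum>\<^sub>\<lambda> \<phi>(\<lambda>) P\<^sub>\<lambda>\<close>, where \<open>\<lambda>\<close> ranges over the (finitely many, real) eigenvalues
  and \<open>P\<^sub>\<lambda>\<close> is the orthogonal projection onto the eigenspace of \<open>\<lambda>\<close>.\<close>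

definition laplacian_eigenspace ::
  "real \<Rightarrow> nat \<Rightarrow> real \<Rightarrow> (real ^ 'd \<Rightarrow> complex) set" where
  "laplacian_eigenspace h R l =
     {f \<in> dirichlet_space h R. \<forall>x. discrete_laplacian h R f x = of_real l * f x}"

definition laplacian_spectrum :: "'d::finite itself \<Rightarrow> real \<Rightarrow> nat \<Rightarrow> real set" where
  "laplacian_spectrum _ h R =
     {l. \<exists>f \<in> (laplacian_eigenspace h R l :: (real ^ 'd \<Rightarrow> complex) set). f \<noteq> (\<lambda>x. 0)}"

definition eigenprojection ::
  "real \<Rightarrow> nat \<Rightarrow> real \<Rightarrow> (real ^ 'd \<Rightarrow> complex) \<Rightarrow> real ^ 'd \<Rightarrow> complex" where
  "eigenprojection h R l f =
     (THE g. g \<in> laplacian_eigenspace h R l \<and>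
             (\<forall>e \<in> laplacian_eigenspace h R l. box_inner h R (\<lambda>x. f x - g x) e = 0))"

definition laplacian_calculus ::
  "real \<Rightarrow> nat \<Rightarrow> (real \<Rightarrow> complex) \<Rightarrow> (real ^ 'd \<Rightarrow> complex) \<Rightarrow> real ^ 'd \<Rightarrow> complex" where
  "laplacian_calculus h R \<phi> f x =
     (\<Sum>l\<in>laplacian_spectrum TYPE('d) h R. \<phi> l * eigenprojection h R l f x)"

definition schroedinger_flow ::
  "real \<Rightarrow> nat \<Rightarrow> real \<Rightarrow> (real ^ 'd \<Rightarrow> complex) \<Rightarrow> real ^ 'd \<Rightarrow> complex" where
  "schroedinger_flow h R t = laplacian_calculus h R (\<lambda>l. exp (\<i> * of_real (t * l)))"

text \<open>\<open>(1 - \<Delta>)\<^bsup>\<sigma>\<^esup>\<close>; the spectrum is non-positive, so \<open>powr\<close> is applied to numbers \<open>\<ge> 1\<close>.\<close>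

definition bessel_potential ::
  "real \<Rightarrow> nat \<Rightarrow> real \<Rightarrow> (real ^ 'd \<Rightarrow> complex) \<Rightarrow> real ^ 'd \<Rightarrow> complex" where
  "bessel_potential h R \<sigma> = laplacian_calculus h R (\<lambda>l. of_real ((1 - l) powr \<sigma>))"

text \<open>The \<open>L\<^sup>q\<close> norm over \<open>[0,1]\<close> of a non-negative function of time, with value \<open>\<infinity>\<close>
  when the \<open>q\<close>-th power is not integrable.\<close>

definition unit_time_norm :: "ereal \<Rightarrow> (real \<Rightarrow> real) \<Rightarrow> ennreal" where
  "unit_time_norm q N =
     (if q = \<infinity> then esssup (lebesgue_on {0..1}) (\<lambda>t. ennreal (N t))
      else let I = (\<integral>\<^sup>+ t. ennreal (N t powr real_of_ereal q) \<partial>lebesgue_on {0..1})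
           in if I = \<infinity> then \<infinity> else ennreal (enn2real I powr (1 / real_of_ereal q)))"

definition lattice_admissible :: "nat \<Rightarrow> ereal \<Rightarrow> ereal \<Rightarrow> bool" where
  "lattice_admissible d q r \<longleftrightarrow>
     2 \<le> q \<and> 2 \<le> r \<and> 3 / q + ereal (real d) / r = ereal (real d / 2) \<and>
     (q, r, d) \<noteq> (2, \<infinity>, 3)"

end

theory Submission
  imports Defs
begin

text \<open>
  In the sine basis of the box the flow is an explicit exponential sum. For frequencies at most
  \<open>N\<close> its kernel is a product of one-dimensional sums \<open>\<Sum>k\<le>M. e\<^bsup>i f(k)\<^esup>\<close>, and as long as
  \<open>\<bar>t\<bar> \<le> R / N\<close> the derivative of the phase \<open>f\<close> meets only boundedly many multiples of \<open>2\<pi>\<close> (a wave of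
  frequency \<open>N\<close> is reflected at most a few times). Van der Corput's method, with the degenerate
  point of the dispersion relation cut out, bounds the kernel by \<open>(N / \<bar>t\<bar>)\<^bsup>d/3\<^esup>\<close>. Interpolation with
  the \<open>L\<^sup>2\<close> bound, the \<open>TT\<^sup>*\<close> argument and the Hardy-Littlewood-Sobolev inequality give a Strichartz
  estimate with loss \<open>N\<^bsup>1/q\<^esup>\<close> on time intervals of length \<open>R / N\<close>; covering \<open>[0,1]\<close> by about \<open>1 + N / R\<close> of
  them costs a further \<open>(1 + N / R)\<^bsup>1/q\<^esup>\<close>. The sum over dyadic \<open>N \<lesssim> 1 / h\<close> converges
  geometrically in each of the three regimes of \<open>\<alpha>\<close>.

  All of this is carried out for equidistant time samples \<open>\<tau> + i / n\<close> with \<open>n\<close> large depending on \<open>h\<close>;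
  integrating over the offset \<open>\<tau>\<close> recovers the norm on \<open>[0,1]\<close> exactly.
\<close>

subsection \<open>A discrete Hardy-Littlewood-Sobolev inequality\<close>

text \<open>The exponent 1/3 is forced by the lattice: the second derivative of the dispersion
  relation vanishes at half of the maximal mode index, so the decay t^(-1/2) per dimension fails
  there. With p dual to r, interpolation raises the kernel bound to the power 2/p - 1, and lattice
  admissibility says exactly that the resulting time decay is \<sigma> = (d/3)(2/p - 1) = 2/q. The
  Hardy-Littlewood-Sobolev inequality needs \<sigma> < 1, which is why (2, \<infinity>, 3) is
  excluded. On a time grid the extremal functions of duality can be chosen at each sample
  independently. The price is the diagonal of the TT-star form, where there is no decay: it is
  bounded by 1 and absorbed by taking n so large that n^(-\<sigma>) is below the dispersive
  constant. The final bound does not see n. The frequency cutoffs are sharp cubes, on which the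
  kernel factors over the coordinates; a dyadic shell is simply embedded in its cube. The kernel
  also carries a factor h^d from the normalised sine basis, and the powers of h balance through 3/q
  + d/r = d/2.\<close>

lemma sum_nat_powr_le:
  fixes \<sigma> :: real
  assumes "0 < \<sigma>" "\<sigma> < 1"
  shows "(\<Sum>m=1..k. real m powr (-\<sigma>)) \<le> real k powr (1 - \<sigma>) / (1 - \<sigma>)"
proof (induction k)
  case 0
  then show ?case by simp
next
  case (Suc k)
  \<comment> \<open>Integral comparison in discrete form: the tangent inequality for the power 1 -
    \<sigma>, obtained from weighted AM-GM applied to \<open>k\<close> and
    \<open>k + 1\<close>.\<close>
  have step: "real k powr (1 - \<sigma>) + (1 - \<sigma>) * real (Suc k) powr (-\<sigma>) \<le> real (Suc k) powr (1 - \<sigma>)"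
  proof (cases "k = 0")
    case True
    then show ?thesis using assms by simp
  next
    case False
    have "real k powr (1 - \<sigma>) * real (Suc k) powr \<sigma> \<le> (1 - \<sigma>) * real k + \<sigma> * real (Suc k)"
      using assms False by (intro Youngs_inequality_0) auto
    also have "\<dots> = real k + \<sigma>" by (simp add: algebra_simps)
    finally have "real k powr (1 - \<sigma>) * real (Suc k) powr \<sigma> * real (Suc k) powr (-\<sigma>)
        \<le> (real k + \<sigma>) * real (Suc k) powr (-\<sigma>)"
      by (rule mult_right_mono) simp
    then have "real k powr (1 - \<sigma>) \<le> (real k + \<sigma>) * real (Suc k) powr (-\<sigma>)"
      by (simp add: mult.assoc flip: powr_add)
    moreover have "real (Suc k) powr (1 - \<sigma>) = real (Suc k) * real (Suc k) powr (-\<sigma>)"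
      using powr_add[of "real (Suc k)" 1 "-\<sigma>"] by simp
    ultimately show ?thesis by (simp add: algebra_simps)
  qed
  have "(\<Sum>m=1..Suc k. real m powr (-\<sigma>)) \<le> real k powr (1 - \<sigma>) / (1 - \<sigma>) + real (Suc k) powr (-\<sigma>)"
    using Suc by simp
  also have "\<dots> = (real k powr (1 - \<sigma>) + (1 - \<sigma>) * real (Suc k) powr (-\<sigma>)) / (1 - \<sigma>)"
    using assms by (simp add: add_divide_distrib)
  also have "\<dots> \<le> real (Suc k) powr (1 - \<sigma>) / (1 - \<sigma>)"
    using step assms by (intro divide_right_mono) auto
  finally show ?case .
qed

text \<open>Telescoping over half-integers: (m - 1/2)(m + 1/2) is below m^2, so 1/m^2 is below 1/(m
  - 1/2) - 1/(m + 1/2). The bound stays finite at \<open>k = 0\<close>.\<close>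

lemma sum_inverse_square_tail:
  assumes "k \<le> n"
  shows "(\<Sum>m\<in>{k<..n}. 1 / (real m)\<^sup>2) \<le> 1 / (real k + 1/2) - 1 / (real n + 1/2)"
  using assms
proof (induction n rule: dec_induct)
  case base
  then show ?case by simp
next
  case (step n)
  have eq: "{k<..Suc n} = insert (Suc n) {k<..n}" using step by auto
  have "1 / (real (Suc n))\<^sup>2 \<le> 1 / (real n + 1/2) - 1 / (real (Suc n) + 1/2)"
  proof -
    have "1 / (real n + 1/2) - 1 / (real (Suc n) + 1/2) = 1 / ((real n + 1/2) * (real (Suc n) + 1/2))"
      by (simp add: field_simps)
    moreover have "(real n + 1/2) * (real (Suc n) + 1/2) \<le> (real (Suc n))\<^sup>2"
      by (simp add: power2_eq_square algebra_simps)
    moreover have "0 < (real n + 1/2) * (real (Suc n) + 1/2)" by simp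
    ultimately show ?thesis by (metis frac_le order_refl zero_le_one)
  qed
  then show ?case unfolding eq using step.IH by simp
qed

text \<open>A distance from \<open>i\<close> is attained at most twice; each side of
  \<open>i\<close> embeds into \<open>M\<close> on its own, which gives the 2.\<close>

lemma sum_abs_diff_le:
  fixes g :: "nat \<Rightarrow> real"
  assumes "finite J" and "finite M" and g: "\<And>m. 0 \<le> g m"
    and "\<And>j. j \<in> J \<Longrightarrow> j < i \<Longrightarrow> i - j \<in> M" and "\<And>j. j \<in> J \<Longrightarrow> i < j \<Longrightarrow> j - i \<in> M"
  shows "(\<Sum>j\<in>J - {i}. g (nat \<bar>int i - int j\<bar>)) \<le> 2 * (\<Sum>m\<in>M. g m)"
proof -
  have split: "J - {i} = {j\<in>J. j < i} \<union> {j\<in>J. i < j}" by auto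
  have "(\<Sum>j\<in>J - {i}. g (nat \<bar>int i - int j\<bar>))
      = (\<Sum>j\<in>{j\<in>J. j < i}. g (nat \<bar>int i - int j\<bar>)) + (\<Sum>j\<in>{j\<in>J. i < j}. g (nat \<bar>int i - int j\<bar>))"
    unfolding split using assms by (intro sum.union_disjoint) auto
  moreover have "(\<Sum>j\<in>{j\<in>J. j < i}. g (nat \<bar>int i - int j\<bar>)) \<le> (\<Sum>m\<in>M. g m)"
  proof -
    have "(\<Sum>j\<in>{j\<in>J. j < i}. g (nat \<bar>int i - int j\<bar>)) = (\<Sum>j\<in>{j\<in>J. j < i}. g (i - j))"
      by (intro sum.cong refl arg_cong[where f=g]) auto
    also have "\<dots> = (\<Sum>m\<in>(\<lambda>j. i - j) ` {j\<in>J. j < i}. g m)"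
      by (subst sum.reindex) (auto simp: inj_on_def)
    also have "\<dots> \<le> (\<Sum>m\<in>M. g m)" using assms by (intro sum_mono2) auto
    finally show ?thesis .
  qed
  moreover have "(\<Sum>j\<in>{j\<in>J. i < j}. g (nat \<bar>int i - int j\<bar>)) \<le> (\<Sum>m\<in>M. g m)"
  proof -
    have "(\<Sum>j\<in>{j\<in>J. i < j}. g (nat \<bar>int i - int j\<bar>)) = (\<Sum>j\<in>{j\<in>J. i < j}. g (j - i))"
      by (intro sum.cong refl arg_cong[where f=g]) auto
    also have "\<dots> = (\<Sum>m\<in>(\<lambda>j. j - i) ` {j\<in>J. i < j}. g m)"
      by (subst sum.reindex) (auto simp: inj_on_def)
    also have "\<dots> \<le> (\<Sum>m\<in>M. g m)" using assms by (intro sum_mono2) auto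
    finally show ?thesis .
  qed
  ultimately show ?thesis by simp
qed

lemma sum_near_powr_le:
  fixes \<sigma> \<delta> :: real
  assumes "0 < \<sigma>" "\<sigma> < 1" "finite J" "0 \<le> \<delta>"
    and J: "\<And>j. j \<in> J \<Longrightarrow> \<bar>real i - real j\<bar> \<le> \<delta>"
  shows "(\<Sum>j\<in>J - {i}. \<bar>real i - real j\<bar> powr (-\<sigma>)) \<le> 2 * \<delta> powr (1 - \<sigma>) / (1 - \<sigma>)"
proof -
  define k where "k = nat \<lfloor>\<delta>\<rfloor>"
  have k: "real k \<le> \<delta>" using assms by (simp add: k_def)
  have mem: "m \<in> {1..k}" if "real m \<le> \<delta>" "0 < m" for m
    using that by (auto simp: k_def le_nat_floor)
  have "(\<Sum>j\<in>J - {i}. \<bar>real i - real j\<bar> powr (-\<sigma>))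
      = (\<Sum>j\<in>J - {i}. real (nat \<bar>int i - int j\<bar>) powr (-\<sigma>))"
    by (intro sum.cong refl arg_cong2[where f="(powr)"]) auto
  also have "\<dots> \<le> 2 * (\<Sum>m=1..k. real m powr (-\<sigma>))"
  proof (rule sum_abs_diff_le[where g="\<lambda>m. real m powr (-\<sigma>)"])
    show "i - j \<in> {1..k}" if "j \<in> J" "j < i" for j
      using J[OF that(1)] that by (intro mem) (auto simp: of_nat_diff)
    show "j - i \<in> {1..k}" if "j \<in> J" "i < j" for j
      using J[OF that(1)] that by (intro mem) (auto simp: of_nat_diff)
  qed (use assms in auto)
  also have "\<dots> \<le> 2 * (real k powr (1 - \<sigma>) / (1 - \<sigma>))"
    using sum_nat_powr_le[OF assms(1,2)] by (intro mult_left_mono) auto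
  also have "\<dots> \<le> 2 * (\<delta> powr (1 - \<sigma>) / (1 - \<sigma>))"
    using k assms by (intro mult_left_mono divide_right_mono powr_mono2) auto
  finally show ?thesis by simp
qed

lemma sum_far_inverse_square_le:
  fixes \<delta> :: real
  assumes "finite J" "1 \<le> \<delta>" and J: "\<And>j. j \<in> J \<Longrightarrow> \<delta> < \<bar>real i - real j\<bar>"
  shows "(\<Sum>j\<in>J - {i}. 1 / (real i - real j)\<^sup>2) \<le> 4 / \<delta>"
proof -
  define k where "k = nat \<lfloor>\<delta>\<rfloor>"
  define n where "n = k + i + (\<Sum>j\<in>J. j)"
  have k: "\<delta> < real k + 1" using assms unfolding k_def by linarith
  have lt: "k < m" if "\<delta> < real m" for m
    using that assms unfolding k_def by linarith
  have le: "j \<le> n" if "j \<in> J" for j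
    using member_le_sum[of j J "\<lambda>j. j"] that assms by (auto simp: n_def)
  have "(\<Sum>j\<in>J - {i}. 1 / (real i - real j)\<^sup>2)
      = (\<Sum>j\<in>J - {i}. 1 / (real (nat \<bar>int i - int j\<bar>))\<^sup>2)"
    by (intro sum.cong refl) (auto simp: power2_commute abs_if)
  also have "\<dots> \<le> 2 * (\<Sum>m\<in>{k<..n}. 1 / (real m)\<^sup>2)"
  proof (rule sum_abs_diff_le[where g="\<lambda>m. 1 / (real m)\<^sup>2"])
    show "i - j \<in> {k<..n}" if "j \<in> J" "j < i" for j
      using J[OF that(1)] that lt[of "i - j"] by (auto simp: of_nat_diff n_def)
    show "j - i \<in> {k<..n}" if "j \<in> J" "i < j" for j
      using J[OF that(1)] that lt[of "j - i"] le[OF that(1)] by (auto simp: of_nat_diff n_def)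
  qed (use assms in auto)
  also have "\<dots> \<le> 2 * (1 / (real k + 1/2))"
  proof -
    have "0 \<le> 1 / (real n + 1/2)" by simp
    moreover have "k \<le> n" by (simp add: n_def)
    ultimately show ?thesis using sum_inverse_square_tail[of k n] by linarith
  qed
  also have "\<dots> \<le> 2 * (2 / \<delta>)"
  proof -
    have "\<delta> \<le> 2 * (real k + 1/2)" using k by simp
    then have "1 / (real k + 1/2) \<le> 2 / \<delta>" using assms by (simp add: field_simps)
    then show ?thesis by simp
  qed
  finally show ?thesis by simp
qed

text \<open>Only the terms with \<open>a j \<le> b\<close> enter, so the near part is controlled by \<open>b\<close> alone and the
  far part by Young's inequality; no maximal function is needed.\<close>

lemma hls_pointwise:
  fixes \<sigma> p b S :: real and a :: "nat \<Rightarrow> real"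
  assumes l: "0 < \<sigma>" "\<sigma> < 1" and p: "p = 2 / (2 - \<sigma>)"
    and J: "finite J" "\<And>j. j \<in> J \<Longrightarrow> 0 \<le> a j \<and> a j \<le> b" and b: "0 < b"
    and S: "(\<Sum>j\<in>J. a j powr p) \<le> S" "b powr p \<le> S"
  shows "(\<Sum>j\<in>J - {i}. a j * \<bar>real i - real j\<bar> powr (-\<sigma>))
     \<le> (2 / (1 - \<sigma>) + 5) * b powr (p - 1) * S powr (1 - \<sigma>)"
proof -
  \<comment> \<open>The cut distance is the number of terms of size \<open>b\<close> that a total
    \<open>S\<close> of p-th powers can hold; it is at least 1 because
    \<open>b powr p \<le> S\<close>.\<close>
  define \<delta> where "\<delta> = S / b powr p"
  define p' where "p' = 2 / \<sigma>"
  have bp: "0 < b powr p" using b by simp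
  have \<delta>1: "1 \<le> \<delta>" using S(2) bp by (simp add: \<delta>_def)
  have S0: "0 < S" using S(2) bp by linarith
  have p1: "1 < p" "1 < p'" using l by (simp_all add: p p'_def field_simps)
  have pp: "1 / p + 1 / p' = 1" using l by (simp add: p p'_def field_simps)
  let ?N = "{j\<in>J. \<bar>real i - real j\<bar> \<le> \<delta>}" and ?F = "{j\<in>J. \<delta> < \<bar>real i - real j\<bar>}"
  let ?k = "\<lambda>j. \<bar>real i - real j\<bar> powr (-\<sigma>)"
  have split: "J - {i} = (?N - {i}) \<union> (?F - {i})" by auto
  have 1: "(\<Sum>j\<in>?N - {i}. a j * ?k j) \<le> b * (2 * \<delta> powr (1 - \<sigma>) / (1 - \<sigma>))"
  proof -
    have "(\<Sum>j\<in>?N - {i}. a j * ?k j) \<le> (\<Sum>j\<in>?N - {i}. b * ?k j)"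
      using J by (intro sum_mono mult_right_mono) auto
    also have "\<dots> = b * (\<Sum>j\<in>?N - {i}. ?k j)" by (simp add: sum_distrib_left)
    also have "\<dots> \<le> b * (2 * \<delta> powr (1 - \<sigma>) / (1 - \<sigma>))"
      using J b l \<delta>1 by (intro mult_left_mono sum_near_powr_le) auto
    finally show ?thesis .
  qed
  have 2: "(\<Sum>j\<in>?F - {i}. a j * ?k j) \<le> b * \<delta> powr (1 - \<sigma>) * 5"
  proof -
    have tm: "a j * ?k j \<le> b * \<delta> powr (1 - \<sigma>) *
         (a j powr p / S + \<delta> * (1 / (real i - real j)\<^sup>2))" if "j \<in> ?F - {i}" for j
    proof -
      define m where "m = \<bar>real i - real j\<bar>"
      have m: "0 < m" using that by (auto simp: m_def)
      have aj: "0 \<le> a j" using that J by auto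
      \<comment> \<open>The powers of \<delta> are chosen so that \<open>x powr p\<close> is (a j)^p
        / S and \<open>y powr p'\<close> is \<delta> / (i - j)^2. These sum to at most 1 and 4,
        hence the 5; the remaining powers of \<delta> cancel.\<close>
      define x where "x = a j / b * \<delta> powr (-1/p)"
      define y where "y = \<delta> powr (\<sigma>/2) * m powr (-\<sigma>)"
      have "x * y \<le> x powr p / p + y powr p' / p'"
        using p1 pp aj b by (intro Youngs_inequality) (auto simp: x_def y_def)
      also have "\<dots> \<le> x powr p + y powr p'"
        using p1 by (intro add_mono) (auto simp: divide_le_eq mult_le_cancel_left1)
      also have "x powr p = a j powr p / S"
      proof -
        have "x powr p = (a j / b) powr p * (\<delta> powr (-1/p)) powr p"
          unfolding x_def by (rule powr_mult)
        also have "(\<delta> powr (-1/p)) powr p = 1 / \<delta>"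
          unfolding powr_powr using p1 \<delta>1 by (simp add: powr_minus_divide)
        finally show ?thesis using aj b S0 by (simp add: powr_divide \<delta>_def)
      qed
      also have "y powr p' = \<delta> * (1 / m\<^sup>2)"
      proof -
        have "y powr p' = (\<delta> powr (\<sigma>/2)) powr p' * (m powr (-\<sigma>)) powr p'"
          unfolding y_def by (simp add: powr_mult)
        also have "\<dots> = \<delta> * m powr (-2)"
          using l \<delta>1 by (simp add: powr_powr p'_def)
        finally show ?thesis using m by (simp add: powr_minus_divide powr_numeral)
      qed
      also have "m\<^sup>2 = (real i - real j)\<^sup>2" by (simp add: m_def)
      finally have xy: "x * y \<le> a j powr p / S + \<delta> * (1 / (real i - real j)\<^sup>2)" .
      have e: "\<delta> powr (1 - \<sigma>) * (\<delta> powr (-1/p) * \<delta> powr (\<sigma>/2)) = 1"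
      proof -
        have "1 - \<sigma> + (-1/p + \<sigma>/2) = 0" using l by (simp add: p field_simps)
        then show ?thesis using \<delta>1 by (metis powr_add powr_zero_eq_one not_one_le_zero)
      qed
      have "a j * ?k j = b * \<delta> powr (1 - \<sigma>) * (x * y)"
      proof -
        have "b * \<delta> powr (1 - \<sigma>) * (x * y)
          = (b * (a j / b)) * (\<delta> powr (1 - \<sigma>) * (\<delta> powr (-1/p) * \<delta> powr (\<sigma>/2))) * m powr (-\<sigma>)"
          by (simp add: x_def y_def)
        then show ?thesis unfolding e using b by (simp add: m_def)
      qed
      then show ?thesis using xy b by (simp add: mult_left_mono)
    qed
    have "(\<Sum>j\<in>?F - {i}. a j * ?k j)
      \<le> (\<Sum>j\<in>?F - {i}. b * \<delta> powr (1 - \<sigma>) * (a j powr p / S + \<delta> * (1 / (real i - real j)\<^sup>2)))"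
      by (intro sum_mono tm)
    also have "\<dots> = b * \<delta> powr (1 - \<sigma>) * ((\<Sum>j\<in>?F - {i}. a j powr p) / S
        + \<delta> * (\<Sum>j\<in>?F - {i}. 1 / (real i - real j)\<^sup>2))"
      by (simp only: sum_distrib_left [symmetric] sum.distrib sum_divide_distrib)
    also have "\<dots> \<le> b * \<delta> powr (1 - \<sigma>) * (1 + \<delta> * (4 / \<delta>))"
    proof (intro mult_left_mono add_mono)
      have "(\<Sum>j\<in>?F - {i}. a j powr p) \<le> (\<Sum>j\<in>J. a j powr p)"
        using J by (intro sum_mono2) auto
      then show "(\<Sum>j\<in>?F - {i}. a j powr p) / S \<le> 1" using S S0 by (simp add: field_simps)
      show "(\<Sum>j\<in>?F - {i}. 1 / (real i - real j)\<^sup>2) \<le> 4 / \<delta>"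
        using J \<delta>1 by (intro sum_far_inverse_square_le) auto
    qed (use b \<delta>1 in auto)
    also have "\<dots> = b * \<delta> powr (1 - \<sigma>) * 5" using \<delta>1 by simp
    finally show ?thesis .
  qed
  have "(\<Sum>j\<in>J - {i}. a j * ?k j) = (\<Sum>j\<in>?N - {i}. a j * ?k j) + (\<Sum>j\<in>?F - {i}. a j * ?k j)"
    unfolding split using J by (intro sum.union_disjoint) auto
  also have "\<dots> \<le> (2 / (1 - \<sigma>) + 5) * (b * \<delta> powr (1 - \<sigma>))"
    using 1 2 by (simp add: algebra_simps)
  also have "b * \<delta> powr (1 - \<sigma>) = b powr (p - 1) * S powr (1 - \<sigma>)"
  proof -
    have "\<delta> powr (1 - \<sigma>) = S powr (1 - \<sigma>) * b powr (- (p * (1 - \<sigma>)))"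
      using b S0 by (simp add: \<delta>_def powr_divide powr_powr powr_minus_divide)
    moreover have "b * b powr (- (p * (1 - \<sigma>))) = b powr (1 - p * (1 - \<sigma>))"
      using b by (simp add: powr_diff powr_minus_divide)
    moreover have "1 - p * (1 - \<sigma>) = p - 1" using l by (simp add: p field_simps)
    ultimately show ?thesis by (simp add: mult.assoc mult.left_commute)
  qed
  finally show ?thesis by (simp add: mult.assoc)
qed

text \<open>Each pair is charged to the index with the larger value, so \<open>hls_pointwise\<close>
  applies with \<open>b = a i\<close>, and a_i times a_i^(p-1) sums to S. Ties are counted twice,
  which only increases a sum of nonnegative terms. Since 2 - \<sigma> = 2/p, the right side is a
  squared l^p norm.\<close>

lemma discrete_hls:
  fixes \<sigma> p :: real and a :: "nat \<Rightarrow> real"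
  assumes l: "0 < \<sigma>" "\<sigma> < 1" and p: "p = 2 / (2 - \<sigma>)"
    and I: "finite I" "\<And>i. i \<in> I \<Longrightarrow> 0 \<le> a i"
  shows "(\<Sum>i\<in>I. \<Sum>j\<in>I - {i}. a i * a j * \<bar>real i - real j\<bar> powr (-\<sigma>))
     \<le> 2 * (2 / (1 - \<sigma>) + 5) * (\<Sum>i\<in>I. a i powr p) powr (2 - \<sigma>)"
proof -
  define S where "S = (\<Sum>i\<in>I. a i powr p)"
  define C where "C = 2 / (1 - \<sigma>) + 5"
  let ?k = "\<lambda>i j. \<bar>real i - real j\<bar> powr (-\<sigma>)"
  have S0: "0 \<le> S" unfolding S_def by (simp add: sum_nonneg)
  have low: "(\<Sum>j\<in>{j\<in>I. a j \<le> a i} - {i}. a i * a j * ?k i j) \<le> C * S powr (1 - \<sigma>) * a i powr p"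
    if "i \<in> I" for i
  proof (cases "a i = 0")
    case False
    then have ai: "0 < a i" using I(2)[OF that] by linarith
    have "(\<Sum>j\<in>{j\<in>I. a j \<le> a i} - {i}. a j * ?k i j) \<le> C * a i powr (p - 1) * S powr (1 - \<sigma>)"
      unfolding C_def
    proof (rule hls_pointwise[OF l p])
      show "(\<Sum>j\<in>{j \<in> I. a j \<le> a i}. a j powr p) \<le> S"
        unfolding S_def using I by (intro sum_mono2) auto
      show "a i powr p \<le> S" unfolding S_def using I that by (intro member_le_sum) auto
    qed (use I ai in auto)
    then have "a i * (\<Sum>j\<in>{j\<in>I. a j \<le> a i} - {i}. a j * ?k i j)
       \<le> a i * (C * a i powr (p - 1) * S powr (1 - \<sigma>))"
      using ai by simp
    also have "\<dots> = C * S powr (1 - \<sigma>) * (a i powr 1 * a i powr (p - 1))"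
      using ai by (simp only: powr_one mult_ac)
    also have "\<dots> = C * S powr (1 - \<sigma>) * a i powr p"
      by (simp only: powr_add [symmetric]) simp
    finally show ?thesis by (simp add: sum_distrib_left mult.assoc)
  qed simp
  have "(\<Sum>i\<in>I. \<Sum>j\<in>I - {i}. a i * a j * ?k i j)
      \<le> (\<Sum>i\<in>I. \<Sum>j\<in>I. (if a j \<le> a i \<and> j \<noteq> i then a i * a j * ?k i j else 0)
           + (if a i \<le> a j \<and> i \<noteq> j then a j * a i * ?k j i else 0))"
  proof (rule sum_mono)
    fix i assume i: "i \<in> I"
    have "(\<Sum>j\<in>I - {i}. a i * a j * ?k i j) = (\<Sum>j\<in>I. if j \<noteq> i then a i * a j * ?k i j else 0)"
      using I by (intro sum.mono_neutral_cong_left) auto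
    also have "\<dots> \<le> (\<Sum>j\<in>I. (if a j \<le> a i \<and> j \<noteq> i then a i * a j * ?k i j else 0)
           + (if a i \<le> a j \<and> i \<noteq> j then a j * a i * ?k j i else 0))"
      using I i by (intro sum_mono) (auto simp: abs_minus_commute)
    finally show "(\<Sum>j\<in>I - {i}. a i * a j * ?k i j) \<le> \<dots>" .
  qed
  also have "\<dots> = 2 * (\<Sum>i\<in>I. \<Sum>j\<in>I. if a j \<le> a i \<and> j \<noteq> i then a i * a j * ?k i j else 0)"
    unfolding sum.distrib
    by (subst (2) sum.swap) simp
  also have "(\<Sum>i\<in>I. \<Sum>j\<in>I. if a j \<le> a i \<and> j \<noteq> i then a i * a j * ?k i j else 0)
     = (\<Sum>i\<in>I. \<Sum>j\<in>{j\<in>I. a j \<le> a i} - {i}. a i * a j * ?k i j)"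
    using I by (intro sum.cong sum.mono_neutral_cong_right) auto
  also have "\<dots> \<le> (\<Sum>i\<in>I. C * S powr (1 - \<sigma>) * a i powr p)"
    by (intro sum_mono low)
  also have "\<dots> = C * S powr (1 - \<sigma>) * S" by (simp add: S_def sum_distrib_left)
  also have "\<dots> = C * S powr (2 - \<sigma>)"
  proof -
    have "S powr (1 - \<sigma>) * S powr 1 = S powr (2 - \<sigma>)"
      by (simp only: powr_add [symmetric]) simp
    then show ?thesis using S0 by simp
  qed
  finally show ?thesis unfolding S_def C_def by (simp only: mult.assoc)
qed

subsection \<open>Van der Corput's method for the lattice phase\<close>

text \<open>A weak Jordan inequality. Up to \<open>pi / 3\<close> the cosine is at least the slope
  1/2; beyond, the sine is at least sqrt 3 / 2, which exceeds pi / 4.\<close>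

lemma half_le_sin:
  fixes x :: real
  assumes "0 \<le> x" "x \<le> pi / 2"
  shows "x / 2 \<le> sin x"
proof (cases "x \<le> pi / 3")
  case True
  have "sin 0 - 0 / 2 \<le> sin x - x / 2"
  proof (rule DERIV_nonneg_imp_nondecreasing[OF assms(1)])
    fix y assume y: "0 \<le> y" "y \<le> x"
    have "cos (pi / 3) \<le> cos y"
      using y True by (intro cos_monotone_0_pi_le) auto
    then have "0 \<le> cos y - 1 / 2" by (simp add: cos_60)
    moreover have "((\<lambda>y. sin y - y / 2) has_real_derivative cos y - 1 / 2) (at y)"
      by (auto intro!: derivative_eq_intros)
    ultimately show "\<exists>z. ((\<lambda>y. sin y - y / 2) has_real_derivative z) (at y) \<and> 0 \<le> z" by blast
  qed
  then show ?thesis by simp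
next
  case False
  have "sin (pi / 3) \<le> sin x"
    using False assms by (intro sin_monotone_2pi_le) auto
  moreover have "1.7 \<le> sqrt 3" by (rule real_le_rsqrt) (simp add: power2_eq_square)
  moreover have "pi \<le> 3.4" using pi_approx by simp
  ultimately show ?thesis using assms by (simp add: sin_60)
qed

lemma half_min_le_sin:
  fixes x \<delta> :: real
  assumes "0 \<le> \<delta>" "\<delta> \<le> x" "x \<le> pi - \<delta>"
  shows "\<delta> / 2 \<le> sin x"
proof (cases "x \<le> pi / 2")
  case True
  then show ?thesis using half_le_sin[of x] assms by simp
next
  case False
  then have "(pi - x) / 2 \<le> sin (pi - x)" using assms by (intro half_le_sin) auto
  then show ?thesis using assms by simp
qed

lemma cot_diff_eq:
  fixes a b :: real
  assumes "sin a \<noteq> 0" "sin b \<noteq> 0"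
  shows "cot a - cot b = sin (b - a) / (sin a * sin b)"
  using assms by (simp add: cot_def field_simps sin_diff)

text \<open>The number is 1 / (cis x - 1) split into real and imaginary part. Its real part is the
  constant -1/2, so the difference of two such numbers is purely imaginary and a difference of
  cotangents; this makes the variation in \<open>kusmin_landau\<close> telescope.\<close>

lemma inverse_cis_minus_one:
  fixes x :: real
  assumes "sin (x / 2) \<noteq> 0"
  shows "Complex (- 1 / 2) (- cot (x / 2) / 2) * (cis x - 1) = 1"
    and "cmod (Complex (- 1 / 2) (- cot (x / 2) / 2)) = 1 / (2 * \<bar>sin (x / 2)\<bar>)"
proof -
  define s c where "s = sin (x/2)" and "c = cos (x/2)"
  have cx: "cos x = 1 - 2 * s\<^sup>2" and sx: "sin x = 2 * s * c"
    using cos_double_sin[of "x/2"] sin_double[of "x/2"] by (simp_all add: s_def c_def)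
  have sc: "s\<^sup>2 + c\<^sup>2 = 1" by (simp add: s_def c_def)
  have cot: "cot (x/2) = c / s" by (simp add: cot_def s_def c_def)
  have s0: "s \<noteq> 0" using assms by (simp add: s_def)
  have "s * s + c * c = 1" using sc by (simp add: power2_eq_square)
  then show "Complex (- 1 / 2) (- cot (x / 2) / 2) * (cis x - 1) = 1"
    using s0 unfolding cot complex_eq_iff
    by (simp add: cx sx) (simp add: field_simps power2_eq_square)
  have "(1/2)\<^sup>2 + (c / s / 2)\<^sup>2 = (1 / (2 * s))\<^sup>2"
    using s0 sc by (simp add: field_simps power2_eq_square)
  then show "cmod (Complex (- 1 / 2) (- cot (x / 2) / 2)) = 1 / (2 * \<bar>sin (x / 2)\<bar>)"
    unfolding cot by (simp add: cmod_def real_sqrt_abs abs_mult flip: s_def)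
qed

text \<open>Summation by parts: \<open>cis (f i)\<close> is \<open>w i\<close> = 1 / (cis (d' i) -
  1) times a forward difference. The increments grow within one period, so cot (d' i / 2) decreases
  and the variation of \<open>w\<close> telescopes to at most 4/\<delta>; the two boundary terms add
  2/\<delta> each.\<close>

lemma kusmin_landau:
  fixes f :: "nat \<Rightarrow> real" and \<delta> :: real
  assumes \<delta>: "0 < \<delta>"
    and d: "\<And>i. i < n \<Longrightarrow> \<delta> \<le> f (Suc i) - f i \<and> f (Suc i) - f i \<le> 2 * pi - \<delta>"
    and mono: "\<And>i. Suc i < n \<Longrightarrow> f (Suc i) - f i \<le> f (Suc (Suc i)) - f (Suc i)"
  shows "cmod (\<Sum>i<n. cis (f i)) \<le> 8 / \<delta>"
proof (cases n)
  case 0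
  then show ?thesis using \<delta> by simp
next
  case (Suc n')
  define d' where "d' i = f (Suc i) - f i" for i
  define w where "w i = Complex (- 1 / 2) (- cot (d' i / 2) / 2)" for i
  have sin_ge: "\<delta> / 4 \<le> sin (d' i / 2)" if "i < n" for i
    using d[OF that] \<delta> half_min_le_sin[of "\<delta>/2" "d' i / 2"] by (simp add: d'_def)
  have sin_pos: "0 < sin (d' i / 2)" if "i < n" for i using sin_ge[OF that] \<delta> by linarith
  have E: "cis (f i) = w i * (cis (f (Suc i)) - cis (f i))" if "i < n" for i
  proof -
    have "w i * (cis (f (Suc i)) - cis (f i)) = w i * (cis (d' i) - 1) * cis (f i)"
      by (simp add: d'_def algebra_simps cis_mult)
    also have "\<dots> = cis (f i)"
      unfolding w_def using inverse_cis_minus_one(1)[of "d' i"] sin_pos[OF that] by simp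
    finally show ?thesis by simp
  qed
  have w_le: "cmod (w i) \<le> 2 / \<delta>" if "i < n" for i
  proof -
    have "cmod (w i) = 1 / (2 * sin (d' i / 2))"
      unfolding w_def using inverse_cis_minus_one(2)[of "d' i"] sin_pos[OF that] by simp
    also have "\<dots> \<le> 1 / (2 * (\<delta> / 4))" using sin_ge[OF that] \<delta> by (intro divide_left_mono) auto
    finally show ?thesis by simp
  qed
  have cot_le: "\<bar>cot (d' i / 2)\<bar> \<le> 4 / \<delta>" if "i < n" for i
  proof -
    have "\<bar>cot (d' i / 2)\<bar> = \<bar>cos (d' i / 2)\<bar> / sin (d' i / 2)"
      using sin_pos[OF that] by (simp add: cot_def)
    also have "\<dots> \<le> 1 / (\<delta> / 4)" using sin_ge[OF that] \<delta> by (intro frac_le) auto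
    finally show ?thesis by simp
  qed
  \<comment> \<open>The partial sum with both boundary terms removed. Passing from \<open>m\<close>
    to \<open>Suc m\<close> changes it by (w m - w (Suc m)) times a unimodular number, that is by
    half the drop of the cotangent.\<close>
  have abel: "cmod ((\<Sum>i<Suc m. cis (f i)) - w m * cis (f (Suc m)) + w 0 * cis (f 0))
      \<le> (cot (d' 0 / 2) - cot (d' m / 2)) / 2" if "m < n" for m
    using that
  proof (induction m)
    case 0
    have "cis (f 0) - w 0 * cis (f (Suc 0)) + w 0 * cis (f 0) = 0"
      using E[OF 0] by (simp add: algebra_simps)
    then show ?case by simp
  next
    case (Suc m)
    have le: "cot (d' (Suc m) / 2) \<le> cot (d' m / 2)"
    proof -
      have pos: "0 < sin (d' m / 2)" "0 < sin (d' (Suc m) / 2)" using sin_pos Suc.prems by auto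
      have "0 \<le> sin (d' (Suc m) / 2 - d' m / 2)"
      proof (rule sin_ge_zero)
        show "0 \<le> d' (Suc m) / 2 - d' m / 2" using mono[OF Suc.prems] by (simp add: d'_def)
        have "d' (Suc m) \<le> 2 * pi" "0 \<le> d' m"
          using d[of m] d[of "Suc m"] Suc.prems \<delta> by (simp_all add: d'_def)
        then show "d' (Suc m) / 2 - d' m / 2 \<le> pi" by simp
      qed
      then have "0 \<le> cot (d' m / 2) - cot (d' (Suc m) / 2)"
        using cot_diff_eq[of "d' m / 2" "d' (Suc m) / 2"] pos by simp
      then show ?thesis by simp
    qed
    have "w m - w (Suc m) = Complex 0 ((cot (d' (Suc m) / 2) - cot (d' m / 2)) / 2)"
      by (simp add: w_def complex_eq_iff field_simps)
    then have wd: "cmod (w m - w (Suc m)) = (cot (d' m / 2) - cot (d' (Suc m) / 2)) / 2"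
      using le by (simp add: cmod_def)
    have "(\<Sum>i<Suc (Suc m). cis (f i)) - w (Suc m) * cis (f (Suc (Suc m))) + w 0 * cis (f 0)
       = ((\<Sum>i<Suc m. cis (f i)) - w m * cis (f (Suc m)) + w 0 * cis (f 0))
         + (w m - w (Suc m)) * cis (f (Suc m))"
      using E[OF Suc.prems] by (simp add: algebra_simps)
    also have "cmod \<dots> \<le> cmod ((\<Sum>i<Suc m. cis (f i)) - w m * cis (f (Suc m)) + w 0 * cis (f 0))
         + cmod ((w m - w (Suc m)) * cis (f (Suc m)))" by (rule norm_triangle_ineq)
    also have "cmod ((w m - w (Suc m)) * cis (f (Suc m))) = cmod (w m - w (Suc m))"
      by (simp add: norm_mult)
    also have "cmod ((\<Sum>i<Suc m. cis (f i)) - w m * cis (f (Suc m)) + w 0 * cis (f 0)) + cmod (w m - w (Suc m))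
       \<le> (cot (d' 0 / 2) - cot (d' m / 2)) / 2 + (cot (d' m / 2) - cot (d' (Suc m) / 2)) / 2"
      unfolding wd by (rule add_right_mono[OF Suc.IH[OF Suc_lessD[OF Suc.prems]]])
    finally show ?case by (simp add: diff_divide_distrib)
  qed
  have n': "n' < n" "0 < n" using Suc by auto
  let ?D = "(\<Sum>i<n. cis (f i)) - w n' * cis (f (Suc n')) + w 0 * cis (f 0)"
  have "(\<Sum>i<n. cis (f i)) = ?D + w n' * cis (f (Suc n')) - w 0 * cis (f 0)" by simp
  then have "cmod (\<Sum>i<n. cis (f i)) \<le> cmod ?D + cmod (w n') + cmod (w 0)"
    using norm_triangle_ineq4[of "?D + w n' * cis (f (Suc n'))" "w 0 * cis (f 0)"]
      norm_triangle_ineq[of ?D "w n' * cis (f (Suc n'))"]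
    by (simp add: norm_mult)
  also have "\<dots> \<le> (cot (d' 0 / 2) - cot (d' n' / 2)) / 2 + 2 / \<delta> + 2 / \<delta>"
    using abel[OF n'(1)] w_le n' by (intro add_mono) (auto simp: Suc)
  also have "\<dots> \<le> (4 / \<delta> + 4 / \<delta>) / 2 + 2 / \<delta> + 2 / \<delta>"
    using cot_le[OF n'(1)] cot_le[OF n'(2)] \<delta> by (intro add_mono divide_right_mono) auto
  finally show ?thesis by simp
qed

text \<open>Adding 2 pi z i to the phase leaves every exponential unchanged and shifts the
  increments by 2 pi z, so any gap between two consecutive multiples of 2 pi is as good as the first
  one.\<close>

lemma kusmin_landau_interval:
  fixes f :: "nat \<Rightarrow> real" and \<delta> :: real
  assumes \<delta>: "0 < \<delta>"
    and d: "\<And>i. i \<in> {a..<b} \<Longrightarrow> \<delta> \<le> f (Suc i) - f i + 2 * pi * of_int z \<and> f (Suc i) - f i + 2 * pi * of_int z \<le> 2 * pi - \<delta>"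
    and mono: "\<And>i. i \<in> {a..<b} \<Longrightarrow> Suc i \<in> {a..<b} \<Longrightarrow> f (Suc i) - f i \<le> f (Suc (Suc i)) - f (Suc i)"
  shows "cmod (\<Sum>i\<in>{a..<b}. cis (f i)) \<le> 8 / \<delta>"
proof (cases "a \<le> b")
  case True
  define g where "g i = f (a + i) + 2 * pi * of_int z * real i" for i
  have "(\<Sum>i\<in>{a..<b}. cis (f i)) = (\<Sum>i<b - a. cis (f (a + i)))"
    using True by (intro sum.reindex_bij_witness[where i="\<lambda>i. a + i" and j="\<lambda>i. i - a"]) auto
  also have "\<dots> = (\<Sum>i<b - a. cis (g i))"
  proof (rule sum.cong[OF refl])
    fix i
    have "cis (g i) = cis (f (a + i)) * cis (2 * pi * of_int (z * int i))"
      by (simp add: g_def cis_mult mult.assoc)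
    also have "cis (2 * pi * of_int (z * int i)) = 1" by (rule cis_multiple_2pi) simp
    finally show "cis (f (a + i)) = cis (g i)" by simp
  qed
  also have "cmod \<dots> \<le> 8 / \<delta>"
  proof (rule kusmin_landau[OF \<delta>])
    show "\<delta> \<le> g (Suc i) - g i \<and> g (Suc i) - g i \<le> 2 * pi - \<delta>" if "i < b - a" for i
      using d[of "a + i"] that by (simp add: g_def algebra_simps)
    show "g (Suc i) - g i \<le> g (Suc (Suc i)) - g (Suc i)" if "Suc i < b - a" for i
      using mono[of "a + i"] that by (simp add: g_def algebra_simps)
  qed
  finally show ?thesis .
qed (use \<delta> in auto)

text \<open>Cuts an index range by the size of a monotone quantity so that both pieces are again
  ranges; \<open>c = a\<close> or \<open>c = b\<close> makes one of them empty.\<close>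

lemma monotone_cut:
  fixes g :: "nat \<Rightarrow> real"
  assumes "a \<le> b" and "\<And>i. i \<in> {a..<b} \<Longrightarrow> Suc i \<in> {a..<b} \<Longrightarrow> g i \<le> g (Suc i)"
  shows "\<exists>c\<in>{a..b}. (\<forall>i\<in>{a..<c}. g i < x) \<and> (\<forall>i\<in>{c..<b}. x \<le> g i)"
  using assms
proof (induction "b - a" arbitrary: b)
  case 0
  then show ?case by (intro bexI[of _ a]) auto
next
  case (Suc n)
  then obtain b' where b: "b = Suc b'" "a \<le> b'" "n = b' - a"
    by (cases b) (auto simp: Suc_diff_le le_Suc_eq)
  have "\<exists>c\<in>{a..b'}. (\<forall>i\<in>{a..<c}. g i < x) \<and> (\<forall>i\<in>{c..<b'}. x \<le> g i)"
    using Suc.prems b by (intro Suc.hyps(1)) auto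
  then obtain c where c: "c \<in> {a..b'}" "\<forall>i\<in>{a..<c}. g i < x" "\<forall>i\<in>{c..<b'}. x \<le> g i" by blast
  show ?case
  proof (cases "c < b'")
    case True
    then obtain b'' where b'': "b' = Suc b''" by (cases b') auto
    have "x \<le> g b''" using c True b'' by auto
    also have "g b'' \<le> g b'" using Suc.prems(2)[of b''] b b'' c True by auto
    finally show ?thesis using c b by (intro bexI[of _ c]) (auto simp: less_Suc_eq)
  next
    case False
    then have "c = b'" using c by auto
    show ?thesis
    proof (cases "g b' < x")
      case True
      then show ?thesis using c b \<open>c = b'\<close> by (intro bexI[of _ "Suc b'"]) (auto simp: less_Suc_eq)
    next
      case False
      then show ?thesis using c b \<open>c = b'\<close> by (intro bexI[of _ b']) (auto simp: less_Suc_eq)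
    qed
  qed
qed

text \<open>The increments can come near only one multiple of 2 pi, namely 0. With \<delta> = sqrt l
  they grow by at least \<delta>^2 per step, so at most 2/\<delta> + 1 \<le> 3/\<delta> of them lie
  in [-\<delta>, \<delta>); these terms are counted. Kusmin-Landau gives 8/\<delta> on either side,
  and 8 + 3 + 8 = 19.\<close>

lemma second_derivative_test:
  fixes f :: "nat \<Rightarrow> real" and l :: real
  assumes l: "0 < l" "l \<le> 1"
    and d: "\<And>i. i \<in> {a..<b} \<Longrightarrow> \<bar>f (Suc i) - f i\<bar> \<le> 2 * pi - 1"
    and incr: "\<And>i. i \<in> {a..<b} \<Longrightarrow> Suc i \<in> {a..<b} \<Longrightarrow> l \<le> f (Suc (Suc i)) - f (Suc i) - (f (Suc i) - f i)"
  shows "cmod (\<Sum>i\<in>{a..<b}. cis (f i)) \<le> 19 / sqrt l"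
proof (cases "a \<le> b")
  case True
  define g where "g i = f (Suc i) - f i" for i
  define \<delta> where "\<delta> = sqrt l"
  have \<delta>: "0 < \<delta>" "\<delta> \<le> 1" "\<delta> * \<delta> = l" using l by (auto simp: \<delta>_def)
  have mono: "g i \<le> g (Suc i)" if "i \<in> {a..<b}" "Suc i \<in> {a..<b}" for i
    using incr[OF that] l by (simp add: g_def)
  obtain c1 where c1: "c1 \<in> {a..b}" "\<forall>i\<in>{a..<c1}. g i < -\<delta>" "\<forall>i\<in>{c1..<b}. -\<delta> \<le> g i"
    using monotone_cut[of a b g "-\<delta>"] True mono by auto
  obtain c2 where c2: "c2 \<in> {c1..b}" "\<forall>i\<in>{c1..<c2}. g i < \<delta>" "\<forall>i\<in>{c2..<b}. \<delta> \<le> g i"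
    using monotone_cut[of c1 b g \<delta>] c1 mono by auto
  have A: "cmod (\<Sum>i\<in>{a..<c1}. cis (f i)) \<le> 8 / \<delta>"
  \<comment> \<open>The increments lie between 1 - 2 pi and -\<delta>; one added period moves them
    into the required range because \<delta> \<le> 1.\<close>
  proof (rule kusmin_landau_interval[OF \<delta>(1), where z=1])
    show "\<delta> \<le> f (Suc i) - f i + 2 * pi * real_of_int 1 \<and> f (Suc i) - f i + 2 * pi * real_of_int 1 \<le> 2 * pi - \<delta>"
      if "i \<in> {a..<c1}" for i
    proof -
      have "g i < - \<delta>" "\<bar>g i\<bar> \<le> 2 * pi - 1" using c1 that d[of i] by (auto simp: g_def)
      then show ?thesis using \<delta> unfolding g_def by linarith
    qed
  qed (use mono c1 in \<open>auto simp: g_def\<close>)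
  have C: "cmod (\<Sum>i\<in>{c2..<b}. cis (f i)) \<le> 8 / \<delta>"
  proof (rule kusmin_landau_interval[OF \<delta>(1), where z=0])
    show "\<delta> \<le> f (Suc i) - f i + 2 * pi * real_of_int 0 \<and> f (Suc i) - f i + 2 * pi * real_of_int 0 \<le> 2 * pi - \<delta>"
      if "i \<in> {c2..<b}" for i
      using c1 c2 that d[of i] \<delta> by (auto simp: g_def abs_le_iff)
  qed (use mono c1 c2 in \<open>auto simp: g_def\<close>)
  have B: "cmod (\<Sum>i\<in>{c1..<c2}. cis (f i)) \<le> 3 / \<delta>"
  proof (cases "c1 < c2")
    case True
    have "g c1 + real m * l \<le> g (c1 + m)" if "c1 + m < c2" for m
      using that
    proof (induction m)
      case (Suc m)
      then show ?case using incr[of "c1 + m"] c1 c2 by (simp add: g_def algebra_simps)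
    qed simp
    from this[of "c2 - c1 - 1"] have "g c1 + real (c2 - c1 - 1) * l \<le> g (c2 - 1)"
      using True by simp
    moreover have "g (c2 - 1) < \<delta>" "- \<delta> \<le> g c1" using c1 c2 True by auto
    ultimately have "real (c2 - c1 - 1) * (\<delta> * \<delta>) \<le> 2 * \<delta>" using \<delta>(3) by simp
    then have "real (c2 - c1 - 1) * \<delta> \<le> 2" using \<delta>(1) by simp
    then have "real (c2 - c1) * \<delta> \<le> 3"
      using True \<delta> by (simp add: of_nat_diff algebra_simps)
    then have "real (c2 - c1) \<le> 3 / \<delta>" using \<delta> by (simp add: field_simps)
    moreover have "cmod (\<Sum>i\<in>{c1..<c2}. cis (f i)) \<le> real (c2 - c1)"
      using norm_sum[of "\<lambda>i. cis (f i)" "{c1..<c2}"] by simp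
    ultimately show ?thesis by linarith
  qed (use \<delta> in auto)
  have "(\<Sum>i\<in>{a..<b}. cis (f i)) = (\<Sum>i\<in>{a..<c1}. cis (f i)) + (\<Sum>i\<in>{c1..<c2}. cis (f i)) + (\<Sum>i\<in>{c2..<b}. cis (f i))"
    using c1 c2 by (simp add: sum.atLeastLessThan_concat)
  also have "cmod \<dots> \<le> 8 / \<delta> + 3 / \<delta> + 8 / \<delta>"
    using A B C by (intro norm_triangle_mono)
  finally show ?thesis by (simp add: \<delta>_def)
qed (use l in auto)

lemma second_derivative_test_decreasing:
  fixes f :: "nat \<Rightarrow> real" and l :: real
  assumes l: "0 < l" "l \<le> 1"
    and d: "\<And>i. i \<in> {a..<b} \<Longrightarrow> \<bar>f (Suc i) - f i\<bar> \<le> 2 * pi - 1"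
    and decr: "\<And>i. i \<in> {a..<b} \<Longrightarrow> Suc i \<in> {a..<b} \<Longrightarrow> f (Suc (Suc i)) - f (Suc i) - (f (Suc i) - f i) \<le> - l"
  shows "cmod (\<Sum>i\<in>{a..<b}. cis (f i)) \<le> 19 / sqrt l"
proof -
  have "cmod (\<Sum>i\<in>{a..<b}. cis (f i)) = cmod (cnj (\<Sum>i\<in>{a..<b}. cis (f i)))"
    by (rule complex_mod_cnj [symmetric])
  also have "\<dots> = cmod (\<Sum>i\<in>{a..<b}. cis (- f i))" by (simp add: cis_cnj)
  also have "\<dots> \<le> 19 / sqrt l"
  proof (rule second_derivative_test[OF l])
    show "\<bar>- f (Suc i) - - f i\<bar> \<le> 2 * pi - 1" if "i \<in> {a..<b}" for i using d[OF that] by simp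
    show "l \<le> - f (Suc (Suc i)) - - f (Suc i) - (- f (Suc i) - - f i)"
      if "i \<in> {a..<b}" "Suc i \<in> {a..<b}" for i using decr[OF that] by simp
  qed
  finally show ?thesis .
qed

text \<open>\<open>y\<close> is the decay per dimension and \<open>R * y\<close> will be the
  half-width, in indices, of the window cut out at the degenerate point. The third bound makes the
  window contain an index, the fourth keeps the second differences used outside it below 1. Both
  follow by cubing from t N \<le> R.\<close>

lemma cube_root_bounds:
  fixes N t R :: real
  assumes "1 \<le> N" "1 \<le> R" "0 < t" "t \<le> R / N"
  defines "y \<equiv> (N / t) powr (1/3)"
  shows "0 < y" and "y ^ 3 = N / t" and "1 \<le> R * y" and "t * y \<le> R\<^sup>2"
proof -
  show y0: "0 < y" using assms by (simp add: y_def)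
  show y3: "y ^ 3 = N / t" using assms
    by (simp add: y_def powr_powr flip: powr_realpow)
  have tN: "t * N \<le> R" using assms by (simp add: field_simps)
  have t: "t \<le> R * N" using tN assms by (smt (verit) mult_le_cancel_left1 mult_mono)
  show "1 \<le> R * y"
  proof (rule power_le_imp_le_base[where n=2])
    have "1 \<le> R ^ 3 * (N / t)"
    proof -
      have "t \<le> R * N" by (rule t)
      also have "\<dots> \<le> R ^ 3 * N" using assms by (intro mult_right_mono) (auto simp: self_le_power)
      finally show ?thesis using assms by (simp add: field_simps)
    qed
    then have "1 ^ 3 \<le> (R * y) ^ 3" using y3 by (simp add: power_mult_distrib)
    then show "1 ^ Suc 2 \<le> (R * y) ^ Suc 2" by (simp add: numeral_3_eq_3)
  qed (use y0 assms in auto)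
  show "t * y \<le> R\<^sup>2"
  proof (rule power_le_imp_le_base[where n=2])
    have "(t * y) ^ 3 = t ^ 3 * (N / t)" by (simp only: power_mult_distrib y3)
    also have "\<dots> = t * (t * N)" using assms by (simp add: power3_eq_cube)
    also have "\<dots> \<le> R * R"
    proof (rule mult_mono[OF _ tN])
      show "t \<le> R" using tN assms by (smt (verit) mult_le_cancel_left1)
    qed (use assms in auto)
    also have "\<dots> \<le> (R\<^sup>2) ^ 3"
      using assms power_increasing[of 2 6 R] by (simp add: power_mult [symmetric]) (simp add: power2_eq_square)
    finally show "(t * y) ^ Suc 2 \<le> (R\<^sup>2) ^ Suc 2" by (simp add: numeral_3_eq_3)
  qed simp
qed

section \<open>Exponential sums with the phase of the box flow\<close>

definition lattice_phase :: "real \<Rightarrow> real \<Rightarrow> real \<Rightarrow> real \<Rightarrow> nat \<Rightarrow> real" where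
  "lattice_phase h \<theta> t z k = real k * z - t * (4 / h\<^sup>2) * (sin (real k * \<theta>))\<^sup>2"

lemma lattice_phase_diff:
  "lattice_phase h \<theta> t z (Suc k) - lattice_phase h \<theta> t z k
     = z - (4 * t / h\<^sup>2) * sin \<theta> * sin (real (2 * k + 1) * \<theta>)"
proof -
  have "(sin a)\<^sup>2 - (sin b)\<^sup>2 = sin (a - b) * sin (a + b)" for a b :: real
  proof -
    have "sin (a - b) * sin (a + b) = (sin a)\<^sup>2 * (cos b)\<^sup>2 - (cos a)\<^sup>2 * (sin b)\<^sup>2"
      unfolding sin_add sin_diff by (simp add: power2_eq_square algebra_simps)
    then show ?thesis by (simp add: cos_squared_eq algebra_simps)
  qed
  from this[of "real (Suc k) * \<theta>" "real k * \<theta>"]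
  have "(sin (real (Suc k) * \<theta>))\<^sup>2 - (sin (real k * \<theta>))\<^sup>2 = sin \<theta> * sin (real (2 * k + 1) * \<theta>)"
    by (simp add: algebra_simps)
  then have "(sin (real (Suc k) * \<theta>))\<^sup>2 = (sin (real k * \<theta>))\<^sup>2 + sin \<theta> * sin (real (2 * k + 1) * \<theta>)"
    by simp
  then show ?thesis unfolding lattice_phase_def by (simp add: algebra_simps)
qed

text \<open>The second difference is centred at \<open>Suc k\<close>, hence the argument of the
  cosine. It changes sign at 2 (k + 1) \<theta> = pi / 2, the degenerate point of the dispersion
  relation.\<close>

lemma lattice_phase_second_diff:
  "lattice_phase h \<theta> t z (Suc (Suc k)) - lattice_phase h \<theta> t z (Suc k)
     - (lattice_phase h \<theta> t z (Suc k) - lattice_phase h \<theta> t z k)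
     = - (8 * t / h\<^sup>2) * (sin \<theta>)\<^sup>2 * cos (2 * real (Suc k) * \<theta>)"
proof -
  have 1: "real (2 * Suc k + 1) * \<theta> = 2 * real (Suc k) * \<theta> + \<theta>"
    and 2: "real (2 * k + 1) * \<theta> = 2 * real (Suc k) * \<theta> - \<theta>" by (simp_all add: algebra_simps)
  show ?thesis
    unfolding lattice_phase_diff 1 2 sin_add sin_diff
    by (simp add: power2_eq_square algebra_simps)
qed

text \<open>The subtracted term of \<open>lattice_phase\<close> is t times the eigenvalue of the
  k-th sine mode. Mode k has spatial frequency of order k / R, so \<open>N\<close> bounds the
  frequency; 2 M \<theta> \<le> pi keeps the modes inside the lattice band, and R / N is, up to a
  constant, the time a wave of speed N takes to cross the box.\<close>

locale lattice_scale =
  fixes h \<theta> t N :: real and R M :: nat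
  assumes h: "0 < h" "h \<le> 1" and R: "1 \<le> R" and N: "1 \<le> N"
    and \<theta>: "\<theta> = h / (4 * real R)" and M: "1 \<le> M" "real M \<le> N * real R" "2 * real M * \<theta> \<le> pi"
    and t: "0 < t" "t \<le> real R / N"
begin

lemma \<theta>_pos: "0 < \<theta>" using h R by (simp add: \<theta>)

lemma \<theta>_le: "\<theta> \<le> pi / 2"
proof -
  have "1 * \<theta> \<le> real M * \<theta>" using M(1) \<theta>_pos by (intro mult_right_mono) auto
  then show ?thesis using M(3) by simp
qed

lemma sin_\<theta>: "\<theta> / 2 \<le> sin \<theta>" "sin \<theta> \<le> \<theta>" "0 \<le> sin \<theta>"
  using half_le_sin[of \<theta>] \<theta>_pos \<theta>_le sin_x_le_x[of \<theta>] by auto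

text \<open>\<open>z\<close> contributes at most pi and the dispersive part at most t (2M + 1) / (4
  R^2) \<le> (R/N)(3 N R) / (4 R^2) = 3/4. Here the restriction to times up to R / N keeps the
  increments away from all nonzero multiples of 2 pi.\<close>

lemma phase_diff_le:
  assumes "\<bar>z\<bar> \<le> pi" "k \<le> M"
  shows "\<bar>lattice_phase h \<theta> t z (Suc k) - lattice_phase h \<theta> t z k\<bar> \<le> 2 * pi - 1"
proof -
  have "\<bar>(4 * t / h\<^sup>2) * sin \<theta> * sin (real (2 * k + 1) * \<theta>)\<bar>
      = (4 * t / h\<^sup>2) * sin \<theta> * \<bar>sin (real (2 * k + 1) * \<theta>)\<bar>"
    using t sin_\<theta> by (simp add: abs_mult)
  also have "\<dots> \<le> (4 * t / h\<^sup>2) * \<theta> * (real (2 * M + 1) * \<theta>)"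
  proof (intro mult_mono)
    have "\<bar>sin (real (2 * k + 1) * \<theta>)\<bar> \<le> \<bar>real (2 * k + 1) * \<theta>\<bar>" by (rule abs_sin_x_le_abs_x)
    also have "\<dots> \<le> real (2 * M + 1) * \<theta>" using assms \<theta>_pos by (simp add: mult_right_mono)
    finally show "\<bar>sin (real (2 * k + 1) * \<theta>)\<bar> \<le> real (2 * M + 1) * \<theta>" .
  qed (use t sin_\<theta> \<theta>_pos in auto)
  also have "\<dots> = t * real (2 * M + 1) / (4 * (real R)\<^sup>2)"
    using h R by (simp add: \<theta> field_simps power2_eq_square)
  also have "\<dots> \<le> (real R / N) * (2 * (N * real R) + N * real R) / (4 * (real R)\<^sup>2)"
  proof (intro divide_right_mono mult_mono)
    have "1 \<le> N * real R" using N R mult_mono[of 1 N 1 "real R"] by simp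
    then show "real (2 * M + 1) \<le> 2 * (N * real R) + N * real R" using M by simp
  qed (use t N R in auto)
  also have "\<dots> = 3 / 4" using N R by (simp add: field_simps power2_eq_square)
  finally have "\<bar>(4 * t / h\<^sup>2) * sin \<theta> * sin (real (2 * k + 1) * \<theta>)\<bar> \<le> 3 / 4" .
  moreover have "3 \<le> pi" using pi_approx by simp
  moreover note abs_triangle_ineq4[of z "(4 * t / h\<^sup>2) * sin \<theta> * sin (real (2 * k + 1) * \<theta>)"]
  ultimately show ?thesis unfolding lattice_phase_diff using assms(1) by argo
qed

lemma second_diff_coeff: "t / (8 * (real R)\<^sup>2) \<le> (8 * t / h\<^sup>2) * (sin \<theta>)\<^sup>2"
proof -
  have "t / (8 * (real R)\<^sup>2) = (8 * t / h\<^sup>2) * (\<theta> / 2)\<^sup>2"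
    using h R by (simp add: \<theta> field_simps power2_eq_square)
  also have "\<dots> \<le> (8 * t / h\<^sup>2) * (sin \<theta>)\<^sup>2"
    using sin_\<theta> t \<theta>_pos by (intro mult_left_mono power_mono) auto
  finally show ?thesis .
qed

lemma t_le_R: "t \<le> real R"
  using t N R by (smt (verit) divide_le_eq mult_le_cancel_left1 of_nat_0_le_iff)

text \<open>The degenerate point is out of range: the cosine is at least 1/2 and the second
  differences have size at least t / (16 R^2). Van der Corput and the trivial bound give R times the
  smaller of N and 1 / sqrt t up to a constant, and this is at most the weighted geometric mean
  N^(1/3) (t^(-1/2))^(2/3) = (N/t)^(1/3).\<close>

lemma low_frequency_sum:
  assumes z: "\<bar>z\<bar> \<le> pi" and low: "2 * real M * \<theta> \<le> pi / 3"
  shows "cmod (\<Sum>k\<in>{1..<Suc M}. cis (lattice_phase h \<theta> t z k)) \<le> 76 * real R * (N / t) powr (1/3)"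
proof -
  define y where "y = (N / t) powr (1/3)"
  have y: "0 < y" "y ^ 3 = N / t"
    using cube_root_bounds[of N "real R" t] N R t by (simp_all add: y_def)
  define l where "l = t / (16 * (real R)\<^sup>2)"
  have R2: "real R \<le> (real R)\<^sup>2" using R by (simp add: self_le_power)
  have l: "0 < l" "l \<le> 1" using t R order_trans[OF t_le_R R2] unfolding l_def by (auto simp: divide_le_eq)
  let ?S = "cmod (\<Sum>k\<in>{1..<Suc M}. cis (lattice_phase h \<theta> t z k))"
  have "?S \<le> 19 / sqrt l"
  proof (rule second_derivative_test_decreasing[OF l])
    show "\<bar>lattice_phase h \<theta> t z (Suc i) - lattice_phase h \<theta> t z i\<bar> \<le> 2 * pi - 1"
      if "i \<in> {1..<Suc M}" for i using that by (intro phase_diff_le[OF z]) auto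
  next
    fix i assume i: "i \<in> {1..<Suc M}" "Suc i \<in> {1..<Suc M}"
    have "cos (pi / 3) \<le> cos (2 * real (Suc i) * \<theta>)"
    proof (rule cos_monotone_0_pi_le)
      have "2 * real (Suc i) * \<theta> \<le> 2 * real M * \<theta>" using i \<theta>_pos by (intro mult_right_mono) auto
      then show "2 * real (Suc i) * \<theta> \<le> pi / 3" using low by simp
    qed (use \<theta>_pos in auto)
    then have "1 / 2 \<le> cos (2 * real (Suc i) * \<theta>)" by (simp add: cos_60)
    then have "t / (8 * (real R)\<^sup>2) * (1 / 2) \<le> (8 * t / h\<^sup>2) * (sin \<theta>)\<^sup>2 * cos (2 * real (Suc i) * \<theta>)"
      using second_diff_coeff t by (intro mult_mono) auto
    then show "lattice_phase h \<theta> t z (Suc (Suc i)) - lattice_phase h \<theta> t z (Suc i)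
       - (lattice_phase h \<theta> t z (Suc i) - lattice_phase h \<theta> t z i) \<le> - l"
      unfolding lattice_phase_second_diff l_def by simp
  qed
  also have "19 / sqrt l = 76 * real R * (1 / sqrt t)"
    using R t by (simp add: l_def real_sqrt_divide real_sqrt_mult)
  finally have 1: "?S \<le> 76 * real R * (1 / sqrt t)" .
  have "?S \<le> real M" using norm_sum[of "\<lambda>k. cis (lattice_phase h \<theta> t z k)" "{1..<Suc M}"] by simp
  then have 2: "?S \<le> N * real R" using M by simp
  show ?thesis
  proof (cases "N \<le> y")
    case True
    have "?S \<le> y * real R" using 2 True by (smt (verit) mult_right_mono of_nat_0_le_iff)
    also have "\<dots> \<le> 76 * real R * y" using y by simp
    finally show ?thesis by (simp add: y_def)
  next
    case False
    then have "y * 1 \<le> y ^ 3 * t" using y t by simp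
    also have "y ^ 3 * t = y * (y\<^sup>2 * t)" by (simp add: power3_eq_cube power2_eq_square)
    finally have "1 \<le> y\<^sup>2 * t" using y(1) by (simp only: mult_le_cancel_left_pos)
    then have "1 \<le> y * sqrt t" using y t
      by (metis real_sqrt_le_mono real_sqrt_mult real_sqrt_one real_sqrt_pow2_iff real_sqrt_unique less_imp_le)
    then have "1 / sqrt t \<le> y" using t by (simp add: field_simps)
    then have "76 * real R * (1 / sqrt t) \<le> 76 * real R * y" by (intro mult_left_mono) auto
    then show ?thesis using 1 by (simp add: y_def)
  qed
qed

text \<open>The terms within about \<Delta> indices of the degenerate point are counted; outside,
  the cosine has size at least \<Delta> \<theta>, so the second differences have size at least
  \<open>l\<close>. The choice \<Delta> = R y balances the window against 1 / sqrt l, and 307 = 152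
  + 3 + 152.\<close>

lemma high_frequency_sum:
  assumes z: "\<bar>z\<bar> \<le> pi" and high: "pi / 3 < 2 * real M * \<theta>"
  shows "cmod (\<Sum>k\<in>{1..<Suc M}. cis (lattice_phase h \<theta> t z k)) \<le> 307 * real R * (N / t) powr (1/3)"
proof -
  define y where "y = (N / t) powr (1/3)"
  define \<Delta> where "\<Delta> = real R * y"
  have y: "0 < y" "y ^ 3 = N / t" "1 \<le> \<Delta>" "t * y \<le> (real R)\<^sup>2"
    using cube_root_bounds[of N "real R" t] N R t by (simp_all add: y_def \<Delta>_def)
  \<comment> \<open>Frequencies this high force N to be at least of order 1/h. With y^3 t = N this
    removes h from the lower bound for \<open>l\<close> and yields 1/l \<le> 64 \<Delta>^2.\<close>
  have Nh: "1 / 2 \<le> N * h"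
  proof -
    have "2 * real M * \<theta> \<le> 2 * (N * real R) * \<theta>" using M \<theta>_pos by (intro mult_right_mono) auto
    also have "\<dots> = N * h / 2" using R by (simp add: \<theta>)
    finally have "pi / 3 < N * h / 2" using high by simp
    then show ?thesis using pi_approx by simp
  qed
  define l where "l = t / (8 * (real R)\<^sup>2) * (\<Delta> * \<theta>)"
  have l_eq: "l = t * \<Delta> * h / (32 * (real R) ^ 3)"
    using R by (simp add: l_def \<theta> power2_eq_square power3_eq_cube)
  have l0: "0 < l" using t R y \<theta>_pos by (simp add: l_def)
  have "t * \<Delta> * h \<le> t * \<Delta> * 1" using t y h by (intro mult_left_mono) auto
  also have "\<dots> = real R * (t * y)" by (simp add: \<Delta>_def)
  also have "\<dots> \<le> real R * (real R)\<^sup>2" using y by (intro mult_left_mono) auto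
  finally have "t * \<Delta> * h \<le> real R ^ 3" by (simp add: power2_eq_square power3_eq_cube)
  then have "t * \<Delta> * h \<le> 32 * real R ^ 3" by (rule order_trans) simp
  then have l1: "l \<le> 1" using R by (simp add: l_eq divide_le_eq)
  have "1 / l \<le> 64 * \<Delta>\<^sup>2"
  proof -
    have "real R ^ 3 * 1 \<le> real R ^ 3 * (2 * (N * h))" using Nh by (intro mult_left_mono) auto
    also have "\<dots> = 2 * real R ^ 3 * h * (t * y ^ 3)" using y t by simp
    also have "\<dots> = 2 * \<Delta> ^ 3 * t * h" by (simp add: \<Delta>_def power_mult_distrib)
    finally have "32 * real R ^ 3 \<le> 64 * \<Delta>\<^sup>2 * (t * \<Delta> * h)"
      by (simp add: power2_eq_square power3_eq_cube mult_ac)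
    then show ?thesis using t y h R by (simp add: l_eq divide_le_eq)
  qed
  then have "sqrt (1 / l) \<le> sqrt (64 * \<Delta>\<^sup>2)" by (rule real_sqrt_le_mono)
  also have "\<dots> = 8 * \<Delta>" using y(3) by (simp add: real_sqrt_mult)
  finally have sl: "19 / sqrt l \<le> 152 * \<Delta>" by (simp add: real_sqrt_divide)
  let ?f = "lattice_phase h \<theta> t z"
  define g where "g k = 2 * real k * \<theta>" for k
  have gmono: "g i \<le> g (Suc i)" for i using \<theta>_pos by (simp add: g_def mult_right_mono)
  \<comment> \<open>\<open>g\<close> advances by 2 \<theta> per index, so a distance of 2 \<Delta>
    \<theta> from pi / 2 means \<Delta> indices on each side; \<open>half_le_sin\<close> then costs
    a factor 2 in the cosine.\<close>
  obtain c1 where c1: "c1 \<in> {1..Suc M}" "\<forall>i\<in>{1..<c1}. g i < pi / 2 - 2 * \<Delta> * \<theta>"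
      "\<forall>i\<in>{c1..<Suc M}. pi / 2 - 2 * \<Delta> * \<theta> \<le> g i"
    using monotone_cut[of 1 "Suc M" g "pi / 2 - 2 * \<Delta> * \<theta>"] gmono by auto
  obtain c2 where c2: "c2 \<in> {c1..Suc M}" "\<forall>i\<in>{c1..<c2}. g i < pi / 2 + 2 * \<Delta> * \<theta>"
      "\<forall>i\<in>{c2..<Suc M}. pi / 2 + 2 * \<Delta> * \<theta> \<le> g i"
    using monotone_cut[of c1 "Suc M" g "pi / 2 + 2 * \<Delta> * \<theta>"] gmono c1 by auto
  have coeff: "l \<le> (8 * t / h\<^sup>2) * (sin \<theta>)\<^sup>2 * x" if "\<Delta> * \<theta> \<le> x" for x
    unfolding l_def using second_diff_coeff that t y \<theta>_pos by (intro mult_mono) auto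
  have A: "cmod (\<Sum>k\<in>{1..<c1}. cis (?f k)) \<le> 19 / sqrt l"
  proof (rule second_derivative_test_decreasing[OF l0 l1])
    show "\<bar>?f (Suc i) - ?f i\<bar> \<le> 2 * pi - 1" if "i \<in> {1..<c1}" for i
      using that c1 by (intro phase_diff_le[OF z]) auto
  next
    fix i assume i: "i \<in> {1..<c1}" "Suc i \<in> {1..<c1}"
    then have "g (Suc i) < pi / 2 - 2 * \<Delta> * \<theta>" using c1 by blast
    then have "\<Delta> * \<theta> \<le> (pi / 2 - g (Suc i)) / 2" by simp
    also have "\<dots> \<le> sin (pi / 2 - g (Suc i))"
    proof (rule half_le_sin)
      have "0 < \<Delta> * \<theta>" using y \<theta>_pos by simp
      then show "0 \<le> pi / 2 - g (Suc i)" using \<open>g (Suc i) < _\<close> by simp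
    qed (use \<theta>_pos in \<open>simp add: g_def\<close>)
    also have "\<dots> = cos (g (Suc i))" by (simp add: sin_diff)
    finally show "?f (Suc (Suc i)) - ?f (Suc i) - (?f (Suc i) - ?f i) \<le> - l"
      unfolding lattice_phase_second_diff using coeff[of "cos (g (Suc i))"] by (simp add: g_def)
  qed
  have C: "cmod (\<Sum>k\<in>{c2..<Suc M}. cis (?f k)) \<le> 19 / sqrt l"
  proof (rule second_derivative_test[OF l0 l1])
    show "\<bar>?f (Suc i) - ?f i\<bar> \<le> 2 * pi - 1" if "i \<in> {c2..<Suc M}" for i
      using that by (intro phase_diff_le[OF z]) auto
  next
    fix i assume i: "i \<in> {c2..<Suc M}" "Suc i \<in> {c2..<Suc M}"
    then have gi: "pi / 2 + 2 * \<Delta> * \<theta> \<le> g (Suc i)" using c2 by blast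
    then have "\<Delta> * \<theta> \<le> (g (Suc i) - pi / 2) / 2" by simp
    also have "\<dots> \<le> sin (g (Suc i) - pi / 2)"
    proof (rule half_le_sin)
      have "0 < \<Delta> * \<theta>" using y \<theta>_pos by simp
      then show "0 \<le> g (Suc i) - pi / 2" using gi by simp
      have "g (Suc i) \<le> 2 * real M * \<theta>" unfolding g_def using i \<theta>_pos by (intro mult_right_mono) auto
      then show "g (Suc i) - pi / 2 \<le> pi / 2" using M(3) by simp
    qed
    also have "\<dots> = - cos (g (Suc i))" by (simp add: sin_diff)
    finally show "l \<le> ?f (Suc (Suc i)) - ?f (Suc i) - (?f (Suc i) - ?f i)"
      unfolding lattice_phase_second_diff using coeff[of "- cos (g (Suc i))"] by (simp add: g_def)
  qed
  have B: "cmod (\<Sum>k\<in>{c1..<c2}. cis (?f k)) \<le> 3 * \<Delta>"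
  proof (cases "c1 < c2")
    case True
    have "pi / 2 - 2 * \<Delta> * \<theta> \<le> g c1" "g (c2 - 1) < pi / 2 + 2 * \<Delta> * \<theta>" using True c1 c2 by auto
    then have "(real (c2 - 1) - real c1) * (2 * \<theta>) \<le> (2 * \<Delta>) * (2 * \<theta>)"
      by (simp add: g_def algebra_simps)
    then have "real (c2 - 1) - real c1 \<le> 2 * \<Delta>"
      using \<theta>_pos by (subst (asm) mult_le_cancel_right_pos) auto
    \<comment> \<open>There are at most 2 \<Delta> + 1 indices, and 1 \<le> \<Delta>.\<close>
    then have "real (c2 - c1) \<le> 3 * \<Delta>" using True y(3) by (simp add: of_nat_diff)
    moreover have "cmod (\<Sum>k\<in>{c1..<c2}. cis (?f k)) \<le> real (c2 - c1)"
      using norm_sum[of "\<lambda>k. cis (?f k)" "{c1..<c2}"] by simp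
    ultimately show ?thesis by linarith
  qed (use y in auto)
  have "(\<Sum>k\<in>{1..<Suc M}. cis (?f k)) = (\<Sum>k\<in>{1..<c1}. cis (?f k)) + (\<Sum>k\<in>{c1..<c2}. cis (?f k)) + (\<Sum>k\<in>{c2..<Suc M}. cis (?f k))"
    using c1 c2 by (simp add: sum.atLeastLessThan_concat del: sum.op_ivl_Suc)
  also have "cmod \<dots> \<le> 152 * \<Delta> + 3 * \<Delta> + 152 * \<Delta>"
    using order_trans[OF A sl] B order_trans[OF C sl] by (intro norm_triangle_mono)
  finally show ?thesis by (simp add: \<Delta>_def y_def)
qed

text \<open>\<open>z\<close> enters only through k z with integral k, so it may be reduced modulo 2
  pi to the range |z| \<le> pi that both frequency regimes assume.\<close>

lemma lattice_exponential_sum: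
  "cmod (\<Sum>k\<in>{1..M}. cis (lattice_phase h \<theta> t z k)) \<le> 307 * real R * (N / t) powr (1/3)"
proof -
  define n where "n = round (z / (2 * pi))"
  define z' where "z' = z - 2 * pi * of_int n"
  have z': "\<bar>z'\<bar> \<le> pi"
  proof -
    have "\<bar>of_int n - z / (2 * pi)\<bar> \<le> 1 / 2" unfolding n_def by (rule of_int_round_abs_le)
    then have "\<bar>of_int n - z / (2 * pi)\<bar> * (2 * pi) \<le> 1 / 2 * (2 * pi)" by (intro mult_right_mono) auto
    moreover have "\<bar>of_int n - z / (2 * pi)\<bar> * (2 * pi) = \<bar>z'\<bar>"
    proof -
      have "\<bar>of_int n - z / (2 * pi)\<bar> * (2 * pi) = \<bar>(of_int n - z / (2 * pi)) * (2 * pi)\<bar>"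
        by (simp only: abs_mult) simp
      also have "(of_int n - z / (2 * pi)) * (2 * pi) = - z'" by (simp add: z'_def field_simps)
      finally show ?thesis by simp
    qed
    ultimately show ?thesis by simp
  qed
  have "cis (lattice_phase h \<theta> t z k) = cis (lattice_phase h \<theta> t z' k)" for k
  proof -
    have "lattice_phase h \<theta> t z k = lattice_phase h \<theta> t z' k + 2 * pi * of_int (int k * n)"
      by (simp add: lattice_phase_def z'_def algebra_simps)
    then show ?thesis by (metis cis_mult cis_multiple_2pi Ints_of_int mult.right_neutral)
  qed
  then have eq: "(\<Sum>k\<in>{1..M}. cis (lattice_phase h \<theta> t z k)) = (\<Sum>k\<in>{1..<Suc M}. cis (lattice_phase h \<theta> t z' k))"
    by (simp add: atLeastLessThanSuc_atLeastAtMost)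
  have "76 * real R * (N / t) powr (1/3) \<le> 307 * real R * (N / t) powr (1/3)"
    by (intro mult_right_mono) auto
  then show ?thesis unfolding eq
    using low_frequency_sum[OF z'] high_frequency_sum[OF z'] by (meson not_le order_trans)
qed

end

text \<open>The product of two sines is a quarter of a signed sum of four exponentials, with
  \<open>z\<close> equal to plus or minus A - B and A + B, so the bound for one exponential sum
  carries over with the same constant.\<close>

lemma sine_kernel_bound_pos:
  assumes "lattice_scale h \<theta> t N R M"
  shows "cmod (\<Sum>k\<in>{1..M}. cis (- t * (4 / h\<^sup>2 * (sin (real k * \<theta>))\<^sup>2)) * of_real (sin (real k * A) * sin (real k * B)))
      \<le> 307 * real R * (N / t) powr (1/3)" (is "cmod (\<Sum>k\<in>_. ?F k) \<le> ?b")
proof -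
  let ?E = "\<lambda>z. \<Sum>k\<in>{1..M}. cis (lattice_phase h \<theta> t z k)"
  have eq: "?F k
     = (cis (lattice_phase h \<theta> t (A - B) k) + cis (lattice_phase h \<theta> t (B - A) k)
       - cis (lattice_phase h \<theta> t (A + B) k) - cis (lattice_phase h \<theta> t (- (A + B)) k)) / 4" for k
  proof -
    define u where "u = cis (- t * (4 / h\<^sup>2 * (sin (real k * \<theta>))\<^sup>2))"
    have p: "cis (lattice_phase h \<theta> t z k) = u * cis (real k * z)" for z
      by (simp add: lattice_phase_def u_def cis_mult algebra_simps)
    have s: "complex_of_real (sin (real k * A) * sin (real k * B))
      = (cis (real k * (A - B)) + cis (real k * (B - A)) - cis (real k * (A + B)) - cis (real k * (- (A + B)))) / 4"
      by (simp add: complex_eq_iff algebra_simps sin_add sin_diff cos_add cos_diff)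
    show ?thesis unfolding p s u_def[symmetric] by (simp add: algebra_simps)
  qed
  have "cmod (\<Sum>k\<in>{1..M}. ?F k)
    = cmod (?E (A - B) + ?E (B - A) - ?E (A + B) - ?E (- (A + B))) / 4"
    unfolding eq sum_divide_distrib[symmetric] sum.distrib sum_subtractf norm_divide by simp
  also have "\<dots> \<le> (cmod (?E (A - B)) + cmod (?E (B - A)) + cmod (?E (A + B)) + cmod (?E (- (A + B)))) / 4"
    by (intro divide_right_mono norm_triangle_mono order_trans[OF norm_triangle_ineq4] add_mono order_refl) auto
  also have "\<dots> \<le> (?b + ?b
      + ?b + ?b) / 4"
    by (intro divide_right_mono add_mono lattice_scale.lattice_exponential_sum[OF assms]) auto
  finally show ?thesis by simp
qed

lemma sine_kernel_bound:
  fixes h \<theta> t N A B :: real and R M :: nat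
  assumes h: "0 < h" "h \<le> 1" and R: "1 \<le> R" and N: "1 \<le> N"
    and \<theta>: "\<theta> = h / (4 * real R)" and M: "real M \<le> N * real R" "2 * real M * \<theta> \<le> pi"
    and t: "t \<noteq> 0" "\<bar>t\<bar> \<le> real R / N"
  shows "cmod (\<Sum>k\<in>{1..M}. cis (- t * (4 / h\<^sup>2 * (sin (real k * \<theta>))\<^sup>2)) * of_real (sin (real k * A) * sin (real k * B)))
      \<le> 307 * real R * (N / \<bar>t\<bar>) powr (1/3)"
proof (cases "M = 0")
  case False
  then have sc: "lattice_scale h \<theta> \<bar>t\<bar> N R M" using assms by unfold_locales auto
  let ?S = "\<lambda>t. \<Sum>k\<in>{1..M}. cis (- t * (4 / h\<^sup>2 * (sin (real k * \<theta>))\<^sup>2)) * of_real (sin (real k * A) * sin (real k * B))"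
  show ?thesis
  proof (cases "0 < t")
    case True
    then show ?thesis using sine_kernel_bound_pos[OF sc] by simp
  next
    case False
    have "cmod (?S t)
      = cmod (cnj (?S t))"
      by (rule complex_mod_cnj [symmetric])
    also have "cnj (?S t)
      = ?S \<bar>t\<bar>"
      using False by (simp add: cis_cnj)
    finally show ?thesis using sine_kernel_bound_pos[OF sc] by simp
  qed
qed simp

subsection \<open>Real interpolation\<close>

text \<open>A geometric series read from its largest index: each step down multiplies by
  2^(-\<epsilon>), so the top term, at most Y^\<epsilon>, dominates.\<close>

lemma dyadic_sum_le:
  fixes \<epsilon> Y :: real and I :: "int set"
  assumes "0 < \<epsilon>" "0 < Y" "finite I" and I: "\<And>i. i \<in> I \<Longrightarrow> 2 powi i \<le> Y"
  shows "(\<Sum>i\<in>I. (2 powi i) powr \<epsilon>) \<le> Y powr \<epsilon> / (1 - 2 powr (-\<epsilon>))"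
proof (cases "I = {}")
  case False
  define b where "b = Max I"
  define x where "x = (2::real) powr (-\<epsilon>)"
  have b: "b \<in> I" "\<And>i. i \<in> I \<Longrightarrow> i \<le> b" using False assms by (auto simp: b_def)
  have x: "0 < x" "x < 1" using assms by (simp_all add: x_def powr_less_one)
  have tm: "(2 powi i) powr \<epsilon> = (2 powi b) powr \<epsilon> * x ^ nat (b - i)" if "i \<in> I" for i
  proof -
    have "real (nat (b - i)) = of_int (b - i)" using b(2)[OF that] by simp
    then have "x ^ nat (b - i) = 2 powr (- \<epsilon> * of_int (b - i))"
      using x by (simp add: x_def powr_powr flip: powr_realpow)
    then show ?thesis
      by (simp add: powr_powr algebra_simps flip: powr_real_of_int' powr_add)
  qed
  have "(\<Sum>i\<in>I. x ^ nat (b - i)) = (\<Sum>n\<in>(\<lambda>i. nat (b - i)) ` I. x ^ n)"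
    using b(2) by (subst sum.reindex) (fastforce simp: inj_on_def eq_nat_nat_iff)+
  also have "\<dots> \<le> (\<Sum>n. x ^ n)"
    using x assms by (intro sum_le_suminf summable_geometric) auto
  also have "\<dots> = 1 / (1 - x)" using x by (intro suminf_geometric) auto
  finally have geo: "(\<Sum>i\<in>I. x ^ nat (b - i)) \<le> 1 / (1 - x)" .
  have "(\<Sum>i\<in>I. (2 powi i) powr \<epsilon>) = (2 powi b) powr \<epsilon> * (\<Sum>i\<in>I. x ^ nat (b - i))"
    unfolding sum_distrib_left by (intro sum.cong refl tm)
  also have "\<dots> \<le> Y powr \<epsilon> * (1 / (1 - x))"
    using I[OF b(1)] assms x geo by (intro mult_mono powr_mono2 sum_nonneg) auto
  finally show ?thesis by (simp add: x_def)
qed (use assms in \<open>simp add: powr_less_one less_imp_le\<close>)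

lemma norm_sum_mult_le_L2:
  fixes f g :: "'a \<Rightarrow> complex"
  shows "cmod (\<Sum>x\<in>X. f x * g x) \<le> sqrt (\<Sum>x\<in>X. (cmod (f x))\<^sup>2) * sqrt (\<Sum>x\<in>X. (cmod (g x))\<^sup>2)"
proof -
  have "cmod (\<Sum>x\<in>X. f x * g x) \<le> (\<Sum>x\<in>X. \<bar>cmod (f x)\<bar> * \<bar>cmod (g x)\<bar>)"
    by (rule order_trans[OF norm_sum]) (simp add: norm_mult)
  also have "\<dots> \<le> L2_set (\<lambda>x. cmod (f x)) X * L2_set (\<lambda>x. cmod (g x)) X"
    by (rule L2_set_mult_ineq)
  finally show ?thesis by (simp add: L2_set_def)
qed

text \<open>Real interpolation between \<open>\<ell>\<^sup>1 \<rightarrow> \<ell>\<^sup>\<infinity>\<close> and \<open>\<ell>\<^sup>2 \<rightarrow> \<ell>\<^sup>2\<close>. The pairs \<open>(x, y)\<close> are split according to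
  whether \<open>\<bar>f x\<bar> \<bar>g y\<bar>\<close> exceeds \<open>A\<close> to the power \<open>2 / p\<close>; rounding \<open>\<bar>f x\<bar>\<close> to a power of two turns the
  region of small products into a disjoint union of rectangles, where the \<open>\<ell>\<^sup>2\<close> bound applies.\<close>

lemma bilinear_interpolation:
  fixes K :: "'a \<Rightarrow> 'a \<Rightarrow> complex" and A p :: real and f g :: "'a \<Rightarrow> complex"
  assumes X: "finite X" and A: "0 < A" and p: "1 < p" "p < 2"
    and K1: "\<And>x y. x \<in> X \<Longrightarrow> y \<in> X \<Longrightarrow> cmod (K x y) \<le> A"
    and K2: "\<And>f g. cmod (\<Sum>x\<in>X. \<Sum>y\<in>X. K x y * f x * g y)
        \<le> sqrt (\<Sum>x\<in>X. (cmod (f x))\<^sup>2) * sqrt (\<Sum>x\<in>X. (cmod (g x))\<^sup>2)"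
    and f: "(\<Sum>x\<in>X. cmod (f x) powr p) \<le> 1" and g: "(\<Sum>x\<in>X. cmod (g x) powr p) \<le> 1"
  shows "cmod (\<Sum>x\<in>X. \<Sum>y\<in>X. K x y * f x * g y) \<le> (3 + 1 / (1 - 2 powr (p - 2))) * A powr (2 / p - 1)"
proof -
  \<comment> \<open>The threshold solves A M^(1-p) = \<rho> and M^(2-p) = \<rho>^2 at once, so that
    large and small products contribute the same power of \<open>A\<close>.\<close>
  define M where "M = A powr (2 / p)"
  define lev where "lev x = \<lfloor>log 2 (cmod (f x))\<rfloor>" for x
  define c where "c = 1 / (1 - 2 powr (p - 2))"
  define \<rho> where "\<rho> = M powr ((2 - p) / 2)"
  have M: "0 < M" and \<rho>: "0 < \<rho>" using A by (simp_all add: M_def \<rho>_def)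
  have "2 / p * ((2 - p) / 2) = 2 / p - 1" using p by (simp add: field_simps)
  then have \<rho>_eq: "\<rho> = A powr (2 / p - 1)" by (simp only: \<rho>_def M_def powr_powr)
  have lev: "2 powi lev x \<le> cmod (f x)" "cmod (f x) < 2 * 2 powi lev x" if "f x \<noteq> 0" for x
  proof -
    have "lev x = \<lfloor>log 2 (cmod (f x))\<rfloor>" by (simp add: lev_def)
    then have "2 powr lev x \<le> cmod (f x) \<and> cmod (f x) < 2 powr (lev x + 1)"
      using that floor_log_eq_powr_iff[of "cmod (f x)" 2 "lev x"] by simp
    then show "2 powi lev x \<le> cmod (f x)" "cmod (f x) < 2 * 2 powi lev x"
      by (simp_all add: powr_real_of_int' powr_add)
  qed
  define X' where "X' = {x\<in>X. f x \<noteq> 0}"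
  define lo where "lo x y \<longleftrightarrow> cmod (g y) * 2 powi lev x \<le> M" for x y
  have X': "finite X'" "X' \<subseteq> X" using X by (auto simp: X'_def)
  have split: "(\<Sum>x\<in>X. \<Sum>y\<in>X. K x y * f x * g y)
    = (\<Sum>x\<in>X'. \<Sum>y\<in>X. if lo x y then K x y * f x * g y else 0)
      + (\<Sum>x\<in>X'. \<Sum>y\<in>X. if lo x y then 0 else K x y * f x * g y)"
  proof -
    have "(\<Sum>x\<in>X. \<Sum>y\<in>X. K x y * f x * g y) = (\<Sum>x\<in>X'. \<Sum>y\<in>X. K x y * f x * g y)"
      using X by (intro sum.mono_neutral_right) (auto simp: X'_def)
    also have "\<dots> = (\<Sum>x\<in>X'. \<Sum>y\<in>X. (if lo x y then K x y * f x * g y else 0)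
        + (if lo x y then 0 else K x y * f x * g y))"
      by (intro sum.cong refl) auto
    finally show ?thesis by (simp only: sum.distrib)
  qed
  \<comment> \<open>Here m = |f x| |g y| exceeds M, and m = m^(1-p) m^p with 1 - p negative converts
    the l^1 bound into p-th powers.\<close>
  have high: "cmod (\<Sum>x\<in>X'. \<Sum>y\<in>X. if lo x y then 0 else K x y * f x * g y) \<le> \<rho>"
  proof -
    have "cmod (\<Sum>x\<in>X'. \<Sum>y\<in>X. if lo x y then 0 else K x y * f x * g y)
        \<le> (\<Sum>x\<in>X'. \<Sum>y\<in>X. A * M powr (1 - p) * (cmod (f x) powr p * cmod (g y) powr p))"
    proof (intro sum_norm_le)
      fix x y assume xy: "x \<in> X'" "y \<in> X"
      show "cmod (if lo x y then 0 else K x y * f x * g y)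
         \<le> A * M powr (1 - p) * (cmod (f x) powr p * cmod (g y) powr p)"
      proof (cases "lo x y")
        case True
        then show ?thesis using A by simp
      next
        case False
        define m where "m = cmod (f x) * cmod (g y)"
        have fx: "f x \<noteq> 0" using xy by (simp add: X'_def)
        have "M < cmod (g y) * 2 powi lev x" using False by (simp add: lo_def)
        also have "\<dots> \<le> m" unfolding m_def using mult_left_mono[OF lev(1)[OF fx], of "cmod (g y)"] by (simp add: mult.commute)
        finally have Mm: "M < m" .
        then have m: "0 < m" using M by simp
        have "cmod (K x y * f x * g y) = cmod (K x y) * m" by (simp add: norm_mult m_def)
        also have "\<dots> \<le> A * m" using K1 xy X' m by (intro mult_right_mono) auto
        also have "m = m powr (1 - p) * m powr p" using m by (simp flip: powr_add)
        also have "A * \<dots> \<le> A * (M powr (1 - p) * m powr p)"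
          using Mm M A p by (intro mult_left_mono mult_right_mono powr_mono2') auto
        also have "m powr p = cmod (f x) powr p * cmod (g y) powr p"
          unfolding m_def by (rule powr_mult)
        finally show ?thesis using False by (simp add: mult.assoc)
      qed
    qed
    also have "\<dots> = A * M powr (1 - p) * ((\<Sum>x\<in>X'. cmod (f x) powr p) * (\<Sum>y\<in>X. cmod (g y) powr p))"
      unfolding sum_product by (simp only: sum_distrib_left)
    also have "\<dots> \<le> A * M powr (1 - p) * (1 * 1)"
    proof (intro mult_left_mono mult_mono)
      have "(\<Sum>x\<in>X'. cmod (f x) powr p) \<le> (\<Sum>x\<in>X. cmod (f x) powr p)"
        using X X' by (intro sum_mono2) auto
      then show "(\<Sum>x\<in>X'. cmod (f x) powr p) \<le> 1" using f by simp
    qed (use g A in \<open>auto intro: sum_nonneg\<close>)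
    also have "A * M powr (1 - p) * (1 * 1) = \<rho>"
    proof -
      have "A powr 1 * A powr (2 / p * (1 - p)) = A powr (2 / p - 1)"
        using p by (simp only: powr_add [symmetric]) (simp add: field_simps)
      then show ?thesis using A by (simp add: \<rho>_eq M_def powr_powr)
    qed
    finally show ?thesis .
  qed
  define I where "I = lev ` X'"
  have I: "finite I" using X' by (simp add: I_def)
  define F where "F i = (\<Sum>x\<in>{x\<in>X'. lev x = i}. (cmod (f x))\<^sup>2)" for i
  define G where "G i = (\<Sum>y\<in>{y\<in>X. cmod (g y) * 2 powi i \<le> M}. (cmod (g y))\<^sup>2)" for i
  have FG0: "0 \<le> F i" "0 \<le> G i" for i by (simp_all add: F_def G_def sum_nonneg)
  have rect: "cmod (\<Sum>x\<in>{x\<in>X'. lev x = i}. \<Sum>y\<in>X. if lo x y then K x y * f x * g y else 0)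
      \<le> \<rho> * ((2 powi i) powr (p - 2) * F i) + (2 powi i) powr (2 - p) * G i / \<rho>" for i
  proof -
    define f' where "f' x = (if x \<in> X' \<and> lev x = i then f x else 0)" for x
    define g' where "g' y = (if cmod (g y) * 2 powi i \<le> M then g y else 0)" for y
    have "(\<Sum>x\<in>{x\<in>X'. lev x = i}. \<Sum>y\<in>X. if lo x y then K x y * f x * g y else 0)
        = (\<Sum>x\<in>X. \<Sum>y\<in>X. K x y * f' x * g' y)"
      using X X' by (intro sum.mono_neutral_cong_left) (auto simp: f'_def g'_def lo_def intro!: sum.cong)
    also have "cmod \<dots> \<le> sqrt (\<Sum>x\<in>X. (cmod (f' x))\<^sup>2) * sqrt (\<Sum>x\<in>X. (cmod (g' x))\<^sup>2)" by (rule K2)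
    also have "(\<Sum>x\<in>X. (cmod (f' x))\<^sup>2) = F i"
      unfolding F_def using X X' by (intro sum.mono_neutral_cong_right) (auto simp: f'_def)
    also have "(\<Sum>x\<in>X. (cmod (g' x))\<^sup>2) = G i"
      unfolding G_def using X by (intro sum.mono_neutral_cong_right) (auto simp: g'_def)
    also have "sqrt (F i) * sqrt (G i) \<le> \<rho> * ((2 powi i) powr (p - 2) * F i) + (2 powi i) powr (2 - p) * G i / \<rho>"
    proof -
      \<comment> \<open>The AM-GM weight that makes both resulting series over the levels summable:
        \<open>Fsum\<close> bounds the first, \<open>Gsum\<close> the second.\<close>
      define w where "w = \<rho> * (2 powi i) powr (p - 2)"
      have w: "0 < w" using \<rho> by (simp add: w_def)
      have iw: "1 / w = (2 powi i) powr (2 - p) / \<rho>"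
        using powr_minus_divide[of "2 powi i" "p - 2"] by (simp add: w_def mult.commute)
      have "sqrt (F i) * sqrt (G i) = sqrt ((w * F i) * (G i / w))"
        using w by (simp add: real_sqrt_mult [symmetric])
      also have "\<dots> \<le> (w * F i + G i / w) / 2"
        using w FG0 by (intro arith_geo_mean_sqrt) auto
      also have "\<dots> \<le> w * F i + G i * (1 / w)"
      proof -
        have half: "(x + y) / 2 \<le> x + y" if "0 \<le> x" "0 \<le> y" for x y :: real using that by simp
        show ?thesis using half[of "w * F i" "G i / w"] w FG0 by simp
      qed
      finally show ?thesis unfolding iw by (simp add: w_def mult_ac)
    qed
    finally show ?thesis .
  qed
  have Fsum: "(\<Sum>i\<in>I. (2 powi i) powr (p - 2) * F i) \<le> 2"
  proof -
    have "(\<Sum>i\<in>I. (2 powi i) powr (p - 2) * F i)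
        = (\<Sum>i\<in>I. \<Sum>x\<in>{x\<in>X'. lev x = i}. (2 powi lev x) powr (p - 2) * (cmod (f x))\<^sup>2)"
      unfolding F_def sum_distrib_left by (intro sum.cong) auto
    also have "\<dots> = (\<Sum>x\<in>X'. (2 powi lev x) powr (p - 2) * (cmod (f x))\<^sup>2)"
      using X' by (intro sum.group) (auto simp: I_def)
    also have "\<dots> \<le> (\<Sum>x\<in>X'. 2 * cmod (f x) powr p)"
    proof (rule sum_mono)
      fix x assume "x \<in> X'"
      then have fx: "f x \<noteq> 0" by (simp add: X'_def)
      have "(2 powi lev x) powr (p - 2) \<le> (cmod (f x) / 2) powr (p - 2)"
        using lev[OF fx] fx p by (intro powr_mono2') auto
      also have "\<dots> = 2 powr (2 - p) * cmod (f x) powr (p - 2)"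
        using powr_minus[of 2 "p - 2"] by (simp add: powr_divide field_simps)
      also have "\<dots> \<le> 2 * cmod (f x) powr (p - 2)"
        using p powr_mono[of "2 - p" 1 2] by (intro mult_right_mono) auto
      finally have "(2 powi lev x) powr (p - 2) * (cmod (f x))\<^sup>2 \<le> 2 * cmod (f x) powr (p - 2) * (cmod (f x))\<^sup>2"
        by (rule mult_right_mono) simp
      also have "\<dots> = 2 * cmod (f x) powr p"
        using fx by (simp add: powr_diff powr_numeral)
      finally show "(2 powi lev x) powr (p - 2) * (cmod (f x))\<^sup>2 \<le> 2 * cmod (f x) powr p" .
    qed
    also have "\<dots> \<le> 2 * (\<Sum>x\<in>X. cmod (f x) powr p)"
      unfolding sum_distrib_left using X X' by (intro sum_mono2) auto
    finally show ?thesis using f by simp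
  qed
  \<comment> \<open>The order of summation is reversed: for fixed \<open>y\<close> the levels with
    2^i \<le> M / |g y| form a geometric sum, convergent because p < 2.\<close>
  have Gsum: "(\<Sum>i\<in>I. (2 powi i) powr (2 - p) * G i) \<le> c * M powr (2 - p)"
  proof -
    have "(\<Sum>i\<in>I. (2 powi i) powr (2 - p) * G i)
        = (\<Sum>i\<in>I. \<Sum>y\<in>X. if cmod (g y) * 2 powi i \<le> M then (2 powi i) powr (2 - p) * (cmod (g y))\<^sup>2 else 0)"
      unfolding G_def sum_distrib_left using X by (intro sum.cong refl sum.mono_neutral_cong_left) auto
    also have "\<dots> = (\<Sum>y\<in>X. \<Sum>i\<in>I. if cmod (g y) * 2 powi i \<le> M then (2 powi i) powr (2 - p) * (cmod (g y))\<^sup>2 else 0)"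
      by (rule sum.swap)
    also have "\<dots> \<le> (\<Sum>y\<in>X. c * M powr (2 - p) * cmod (g y) powr p)"
    proof (rule sum_mono)
      fix y assume y: "y \<in> X"
      show "(\<Sum>i\<in>I. if cmod (g y) * 2 powi i \<le> M then (2 powi i) powr (2 - p) * (cmod (g y))\<^sup>2 else 0)
         \<le> c * M powr (2 - p) * cmod (g y) powr p"
      proof (cases "g y = 0")
        case False
        have "(\<Sum>i\<in>I. if cmod (g y) * 2 powi i \<le> M then (2 powi i) powr (2 - p) * (cmod (g y))\<^sup>2 else 0)
          = (\<Sum>i\<in>{i\<in>I. 2 powi i \<le> M / cmod (g y)}. (2 powi i) powr (2 - p)) * (cmod (g y))\<^sup>2"
          unfolding sum_distrib_right using I False
          by (intro sum.mono_neutral_cong_right) (auto simp: field_simps)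
        also have "\<dots> \<le> ((M / cmod (g y)) powr (2 - p) / (1 - 2 powr (- (2 - p)))) * (cmod (g y))\<^sup>2"
          using p M False I by (intro mult_right_mono dyadic_sum_le) auto
        also have "\<dots> = c * ((M / cmod (g y)) powr (2 - p) * (cmod (g y))\<^sup>2)" by (simp add: c_def)
        also have "(M / cmod (g y)) powr (2 - p) * (cmod (g y))\<^sup>2 = M powr (2 - p) * cmod (g y) powr p"
          using M False by (simp add: powr_divide powr_diff powr_numeral)
        finally show ?thesis by (simp add: mult.assoc)
      qed (simp add: sum.neutral)
    qed
    also have "\<dots> = c * M powr (2 - p) * (\<Sum>y\<in>X. cmod (g y) powr p)" by (simp only: sum_distrib_left)
    also have "\<dots> \<le> c * M powr (2 - p) * 1"
      using g p by (intro mult_left_mono) (auto simp: c_def powr_less_one less_imp_le)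
    finally show ?thesis by simp
  qed
  have low: "cmod (\<Sum>x\<in>X'. \<Sum>y\<in>X. if lo x y then K x y * f x * g y else 0) \<le> (2 + c) * \<rho>"
  proof -
    have "(\<Sum>x\<in>X'. \<Sum>y\<in>X. if lo x y then K x y * f x * g y else 0)
      = (\<Sum>i\<in>I. \<Sum>x\<in>{x\<in>X'. lev x = i}. \<Sum>y\<in>X. if lo x y then K x y * f x * g y else 0)"
      using X' by (intro sum.group [symmetric]) (auto simp: I_def)
    also have "cmod \<dots> \<le> (\<Sum>i\<in>I. \<rho> * ((2 powi i) powr (p - 2) * F i) + (2 powi i) powr (2 - p) * G i / \<rho>)"
      by (intro sum_norm_le rect)
    also have "\<dots> = \<rho> * (\<Sum>i\<in>I. (2 powi i) powr (p - 2) * F i) + (\<Sum>i\<in>I. (2 powi i) powr (2 - p) * G i) / \<rho>"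
      by (simp only: sum.distrib sum_distrib_left sum_divide_distrib)
    also have "\<dots> \<le> \<rho> * 2 + c * M powr (2 - p) / \<rho>"
      using Fsum Gsum \<rho> by (intro add_mono mult_left_mono divide_right_mono) auto
    also have "M powr (2 - p) = \<rho> * \<rho>"
      unfolding \<rho>_def by (simp only: powr_add [symmetric]) simp
    finally show ?thesis using \<rho> by (simp add: algebra_simps)
  qed
  have "cmod (\<Sum>x\<in>X. \<Sum>y\<in>X. K x y * f x * g y) \<le> (2 + c) * \<rho> + \<rho>"
    unfolding split by (rule norm_triangle_mono[OF low high])
  then show ?thesis by (simp add: \<rho>_eq c_def algebra_simps)
qed

subsection \<open>Strichartz estimates on a time grid\<close>

text \<open>Jensen for the concave power s, proved with the tangent at the mean \<open>y\<close>. It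
  later recombines the time blocks at the price of a power of their number.\<close>

lemma sum_powr_le_card:
  fixes x :: "'b \<Rightarrow> real"
  assumes "finite B" "\<And>b. b \<in> B \<Longrightarrow> 0 \<le> x b" and s: "0 < s" "s < 1"
  shows "(\<Sum>b\<in>B. x b powr s) \<le> real (card B) powr (1 - s) * (\<Sum>b\<in>B. x b) powr s"
proof (cases "(\<Sum>b\<in>B. x b) = 0")
  case True
  then have "\<And>b. b \<in> B \<Longrightarrow> x b = 0" using assms by (simp add: sum_nonneg_eq_0_iff)
  then show ?thesis using True by simp
next
  case False
  define S where "S = (\<Sum>b\<in>B. x b)"
  define m where "m = real (card B)"
  have S: "0 < S" using False assms unfolding S_def by (metis sum_nonneg less_eq_real_def)
  have m: "0 < m" using False assms by (auto simp: m_def card_gt_0_iff)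
  define y where "y = S / m"
  have y: "0 < y" using S m by (simp add: y_def)
  have tangent: "x b powr s \<le> s * y powr (s - 1) * x b + (1 - s) * y powr s" if b: "b \<in> B" for b
  proof (cases "x b = 0")
    case True
    then show ?thesis using s by simp
  next
    case False
    then have xb: "0 < x b" using assms(2)[OF b] by simp
    have "(x b) powr s * y powr (1 - s) \<le> s * x b + (1 - s) * y"
      using s xb y by (intro Youngs_inequality_0) auto
    then have "(x b) powr s * y powr (1 - s) * y powr (s - 1) \<le> (s * x b + (1 - s) * y) * y powr (s - 1)"
      by (rule mult_right_mono) simp
    moreover have "y powr (1 - s) * y powr (s - 1) = 1" using y by (simp flip: powr_add)
    moreover have "y * y powr (s - 1) = y powr s" using y by (simp add: powr_diff)
    ultimately show ?thesis by (simp add: algebra_simps)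
  qed
  have "(\<Sum>b\<in>B. x b powr s) \<le> (\<Sum>b\<in>B. s * y powr (s - 1) * x b + (1 - s) * y powr s)"
    by (intro sum_mono tangent)
  also have "\<dots> = s * y powr (s - 1) * S + m * ((1 - s) * y powr s)"
    by (simp add: sum.distrib S_def m_def flip: sum_distrib_left)
  also have "S = m * y" using m by (simp add: y_def)
  also have "s * y powr (s - 1) * (m * y) + m * ((1 - s) * y powr s) = m * y powr s"
    using y by (simp add: powr_diff field_simps)
  also have "\<dots> = m powr (1 - s) * S powr s"
    using m S by (simp add: y_def powr_divide powr_diff)
  finally show ?thesis by (simp add: m_def S_def)
qed

text \<open>The embedding of l^p into l^2: no (a i)^p exceeds the whole sum S, so in (a i)^2 = (a
  i)^p (a i)^(2-p) the last factor is at most S^(2/p - 1).\<close>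

lemma sum_squares_le_powr:
  fixes a :: "'b \<Rightarrow> real"
  assumes I: "finite I" "\<And>i. i \<in> I \<Longrightarrow> 0 \<le> a i" and p: "0 < p" "p \<le> 2"
  shows "(\<Sum>i\<in>I. (a i)\<^sup>2) \<le> (\<Sum>i\<in>I. a i powr p) powr (2 / p)"
proof -
  define S where "S = (\<Sum>i\<in>I. a i powr p)"
  have S: "0 \<le> S" by (simp add: S_def sum_nonneg)
  have "(a i)\<^sup>2 \<le> a i powr p * S powr (2 / p - 1)" if i: "i \<in> I" for i
  proof (cases "a i = 0")
    case False
    then have ai: "0 < a i" using I(2)[OF i] by simp
    have "a i powr p \<le> S" unfolding S_def using I i by (intro member_le_sum) auto
    then have "(a i powr p) powr (2 / p - 1) \<le> S powr (2 / p - 1)" using p by (intro powr_mono2) auto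
    then have "a i powr p * (a i powr p) powr (2 / p - 1) \<le> a i powr p * S powr (2 / p - 1)"
      by (intro mult_left_mono) auto
    moreover have "a i powr p * (a i powr p) powr (2 / p - 1) = a i powr 2"
      using p by (simp only: powr_powr powr_add [symmetric]) (simp add: field_simps)
    ultimately show ?thesis using ai by (simp add: powr_numeral)
  qed simp
  then have "(\<Sum>i\<in>I. (a i)\<^sup>2) \<le> (\<Sum>i\<in>I. a i powr p * S powr (2 / p - 1))" by (rule sum_mono)
  also have "\<dots> = S powr 1 * S powr (2 / p - 1)" using S by (simp add: S_def sum_distrib_right)
  also have "\<dots> = S powr (2 / p)" by (simp only: powr_add [symmetric]) simp
  finally show ?thesis by (simp add: S_def)
qed

text \<open>In the application \<open>S\<close> is a dyadic shell and \<open>S'\<close> a cube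
  containing it. Cauchy-Schwarz is used on \<open>S\<close>; enlarging the sum of squares to
  \<open>S'\<close> then makes the dispersive bound available. In the TT-star form the diagonal has
  no decay and is handled by \<open>diag\<close> and the embedding into l^2, the rest by
  \<open>discrete_hls\<close>. \<open>p\<close> is the dual exponent in time, not in space.\<close>

lemma tt_star_block:
  fixes X :: "'x set" and e :: "'k \<Rightarrow> 'x \<Rightarrow> real" and \<omega> :: "'k \<Rightarrow> real" and c :: "'k \<Rightarrow> complex" and G :: "nat \<Rightarrow> 'x \<Rightarrow> complex"
    and t a :: "nat \<Rightarrow> real" and \<sigma> \<kappa> p :: real
  assumes I: "finite I" "\<And>i. i \<in> I \<Longrightarrow> 0 \<le> a i" and S: "finite S'" "S \<subseteq> S'"
    and \<sigma>: "0 < \<sigma>" "\<sigma> < 1" and p: "p = 2 / (2 - \<sigma>)"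
  defines "b \<equiv> \<lambda>i k. \<Sum>x\<in>X. of_real (e k x) * G i x"
  assumes diag: "\<And>i. i \<in> I \<Longrightarrow> (\<Sum>k\<in>S'. (cmod (b i k))\<^sup>2) \<le> 1"
    and off: "\<And>i j. i \<in> I \<Longrightarrow> j \<in> I \<Longrightarrow> i \<noteq> j \<Longrightarrow>
      cmod (\<Sum>k\<in>S'. cis (- (t i - t j) * \<omega> k) * b i k * cnj (b j k)) \<le> \<kappa> * \<bar>real i - real j\<bar> powr (-\<sigma>)"
    and \<kappa>: "0 \<le> \<kappa>"
  shows "cmod (\<Sum>i\<in>I. of_real (a i) * (\<Sum>x\<in>X. (\<Sum>k\<in>S. c k * cis (- t i * \<omega> k) * of_real (e k x)) * G i x))
      \<le> sqrt (\<Sum>k\<in>S. (cmod (c k))\<^sup>2) * sqrt (2 * (2 / (1 - \<sigma>) + 5) * \<kappa> + 1)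
         * (\<Sum>i\<in>I. a i powr p) powr (1 / p)"
proof -
  define B where "B k = (\<Sum>i\<in>I. of_real (a i) * cis (- t i * \<omega> k) * b i k)" for k
  define Q where "Q i j = (\<Sum>k\<in>S'. cis (- (t i - t j) * \<omega> k) * b i k * cnj (b j k))" for i j
  define P where "P = (\<Sum>i\<in>I. a i powr p)"
  define C where "C = 2 * (2 / (1 - \<sigma>) + 5)"
  have P: "0 \<le> P" by (simp add: P_def sum_nonneg)
  have C: "0 \<le> C" using \<sigma> by (simp add: C_def)
  have p2: "2 / p = 2 - \<sigma>" using \<sigma> by (simp add: p)
  have p02: "0 < p" "p \<le> 2" using \<sigma> by (simp_all add: p field_simps)
  have "(\<Sum>i\<in>I. of_real (a i) * (\<Sum>x\<in>X. (\<Sum>k\<in>S. c k * cis (- t i * \<omega> k) * of_real (e k x)) * G i x))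
     = (\<Sum>i\<in>I. \<Sum>x\<in>X. \<Sum>k\<in>S. c k * (of_real (a i) * cis (- t i * \<omega> k) * (of_real (e k x) * G i x)))"
    by (simp only: sum_distrib_left sum_distrib_right mult_ac)
  also have "\<dots> = (\<Sum>i\<in>I. \<Sum>k\<in>S. \<Sum>x\<in>X. c k * (of_real (a i) * cis (- t i * \<omega> k) * (of_real (e k x) * G i x)))"
    by (intro sum.cong refl sum.swap)
  also have "\<dots> = (\<Sum>k\<in>S. \<Sum>i\<in>I. \<Sum>x\<in>X. c k * (of_real (a i) * cis (- t i * \<omega> k) * (of_real (e k x) * G i x)))"
    by (rule sum.swap)
  also have "\<dots> = (\<Sum>k\<in>S. c k * B k)"
    by (simp only: B_def b_def sum_distrib_left mult_ac)
  finally have eq: "(\<Sum>i\<in>I. of_real (a i) * (\<Sum>x\<in>X. (\<Sum>k\<in>S. c k * cis (- t i * \<omega> k) * of_real (e k x)) * G i x))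
     = (\<Sum>k\<in>S. c k * B k)" .
  have BB: "(\<Sum>k\<in>S'. (cmod (B k))\<^sup>2) \<le> (C * \<kappa> + 1) * P powr (2 / p)"
  proof -
    have "complex_of_real (\<Sum>k\<in>S'. (cmod (B k))\<^sup>2) = (\<Sum>k\<in>S'. B k * cnj (B k))"
      by (simp only: of_real_sum complex_norm_square)
    also have "\<dots> = (\<Sum>k\<in>S'. \<Sum>i\<in>I. \<Sum>j\<in>I. of_real (a i * a j) * (cis (- (t i - t j) * \<omega> k) * b i k * cnj (b j k)))"
    proof (rule sum.cong[OF refl])
      fix k
      have "cis (- (t i - t j) * \<omega> k) = cis (- t i * \<omega> k) * cnj (cis (- t j * \<omega> k))" for i j
      proof -
        have "cnj (cis (- t j * \<omega> k)) = cis (t j * \<omega> k)" by (simp add: complex_eq_iff)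
        moreover have "- (t i - t j) * \<omega> k = - t i * \<omega> k + t j * \<omega> k" by (simp add: algebra_simps)
        ultimately show ?thesis by (simp only: cis_mult)
      qed
      then show "B k * cnj (B k) = (\<Sum>i\<in>I. \<Sum>j\<in>I. of_real (a i * a j) * (cis (- (t i - t j) * \<omega> k) * b i k * cnj (b j k)))"
        unfolding B_def cnj_sum sum_product by (intro sum.cong refl) (simp only: complex_cnj_mult complex_cnj_complex_of_real of_real_mult mult_ac)
    qed
    also have "\<dots> = (\<Sum>i\<in>I. \<Sum>j\<in>I. of_real (a i * a j) * Q i j)"
      unfolding Q_def sum_distrib_left by (subst sum.swap, intro sum.cong refl, rule sum.swap)
    finally have "cmod (complex_of_real (\<Sum>k\<in>S'. (cmod (B k))\<^sup>2)) = cmod (\<Sum>i\<in>I. \<Sum>j\<in>I. of_real (a i * a j) * Q i j)"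
      by (rule arg_cong)
    then have "(\<Sum>k\<in>S'. (cmod (B k))\<^sup>2) = cmod (\<Sum>i\<in>I. \<Sum>j\<in>I. of_real (a i * a j) * Q i j)"
      by (simp only: norm_of_real abs_of_nonneg[OF sum_nonneg] zero_le_power2)
    also have "\<dots> \<le> (\<Sum>i\<in>I. \<Sum>j\<in>I. a i * a j * cmod (Q i j))"
      using I by (intro sum_norm_le) (simp add: norm_mult)
    also have "\<dots> = (\<Sum>i\<in>I. a i * a i * cmod (Q i i) + (\<Sum>j\<in>I - {i}. a i * a j * cmod (Q i j)))"
      using I by (intro sum.cong refl sum.remove) auto
    also have "\<dots> \<le> (\<Sum>i\<in>I. (a i)\<^sup>2 + (\<Sum>j\<in>I - {i}. \<kappa> * (a i * a j * \<bar>real i - real j\<bar> powr (-\<sigma>))))"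
    proof (intro sum_mono add_mono)
      fix i assume i: "i \<in> I"
      have "Q i i = of_real (\<Sum>k\<in>S'. (cmod (b i k))\<^sup>2)"
        unfolding Q_def of_real_sum complex_norm_square by simp
      then have "cmod (Q i i) \<le> 1"
        using diag[OF i] by (simp only: norm_of_real) (simp add: sum_nonneg)
      then have "a i * a i * cmod (Q i i) \<le> a i * a i * 1" using I(2)[OF i] by (intro mult_left_mono) auto
      then show "a i * a i * cmod (Q i i) \<le> (a i)\<^sup>2" by (simp add: power2_eq_square)
      fix j assume j: "j \<in> I - {i}"
      have "a i * a j * cmod (Q i j) \<le> a i * a j * (\<kappa> * \<bar>real i - real j\<bar> powr (-\<sigma>))"
        using off[of i j] i j I unfolding Q_def by (intro mult_left_mono) auto
      then show "a i * a j * cmod (Q i j) \<le> \<kappa> * (a i * a j * \<bar>real i - real j\<bar> powr (-\<sigma>))"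
        by (simp add: mult_ac)
    qed
    also have "\<dots> = (\<Sum>i\<in>I. (a i)\<^sup>2) + \<kappa> * (\<Sum>i\<in>I. \<Sum>j\<in>I - {i}. a i * a j * \<bar>real i - real j\<bar> powr (-\<sigma>))"
      by (simp only: sum.distrib sum_distrib_left)
    also have "\<dots> \<le> P powr (2 / p) + \<kappa> * (C * P powr (2 - \<sigma>))"
      unfolding P_def C_def using \<kappa> I
      by (intro add_mono sum_squares_le_powr mult_left_mono discrete_hls \<sigma> p p02) auto
    finally show ?thesis by (simp add: p2 algebra_simps)
  qed
  have "cmod (\<Sum>k\<in>S. c k * B k) \<le> sqrt (\<Sum>k\<in>S. (cmod (c k))\<^sup>2) * sqrt (\<Sum>k\<in>S. (cmod (B k))\<^sup>2)"
    by (rule norm_sum_mult_le_L2)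
  also have "\<dots> \<le> sqrt (\<Sum>k\<in>S. (cmod (c k))\<^sup>2) * sqrt ((C * \<kappa> + 1) * P powr (2 / p))"
  proof (intro mult_left_mono real_sqrt_le_mono)
    have "(\<Sum>k\<in>S. (cmod (B k))\<^sup>2) \<le> (\<Sum>k\<in>S'. (cmod (B k))\<^sup>2)" using S by (intro sum_mono2) auto
    then show "(\<Sum>k\<in>S. (cmod (B k))\<^sup>2) \<le> (C * \<kappa> + 1) * P powr (2 / p)" using BB by simp
  qed (simp add: sum_nonneg)
  also have "sqrt ((C * \<kappa> + 1) * P powr (2 / p)) = sqrt (C * \<kappa> + 1) * P powr (1 / p)"
  proof -
    have "sqrt (P powr (2 / p)) = (P powr (2 / p)) powr (1 / 2)"
      by (simp add: powr_half_sqrt)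
    then show ?thesis by (simp add: real_sqrt_mult powr_powr)
  qed
  finally show ?thesis unfolding eq by (simp add: C_def P_def mult.assoc)
qed

lemma card_div_image_le:
  assumes "0 < b" "0 < n"
  shows "real (card ((\<lambda>i. i div b) ` {..<n})) \<le> real n / real b + 1"
proof -
  have "(\<lambda>i. i div b) ` {..<n} \<subseteq> {..(n - 1) div b}"
    using assms by (auto intro!: div_le_mono)
  then have "card ((\<lambda>i. i div b) ` {..<n}) \<le> Suc ((n - 1) div b)"
    using card_mono[of "{..(n - 1) div b}"] by simp
  then have "real (card ((\<lambda>i. i div b) ` {..<n})) \<le> real ((n - 1) div b) + 1" by simp
  also have "real ((n - 1) div b) \<le> real (n - 1) / real b" by (rule of_nat_div_le_of_nat)
  also have "real (n - 1) / real b \<le> real n / real b" by (intro divide_right_mono) auto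
  finally show ?thesis by simp
qed

text \<open>Each frequency level \<open>j\<close> only has a dispersive estimate on time intervals of length \<open>T j\<close>, so
  the grid is cut into blocks of that length. Duality is used once, for the whole solution, which
  makes the triangle inequality for mixed norms unnecessary.\<close>

lemma grid_strichartz:
  fixes X :: "'x set" and e :: "'k \<Rightarrow> 'x \<Rightarrow> real" and \<omega> :: "'k \<Rightarrow> real" and c :: "'k \<Rightarrow> complex" and G :: "nat \<Rightarrow> 'x \<Rightarrow> complex"
    and v :: "nat \<Rightarrow> real" and T \<kappa> :: "nat \<Rightarrow> real" and lev :: "'k \<Rightarrow> nat" and \<tau> \<sigma> :: real
  assumes fin: "finite Ks" "finite J" "lev ` Ks \<subseteq> J" and n: "0 < n"
    and \<sigma>: "0 < \<sigma>" "\<sigma> < 1"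
    and S': "\<And>j. j \<in> J \<Longrightarrow> finite (S' j) \<and> {k\<in>Ks. lev k = j} \<subseteq> S' j"
  defines "t \<equiv> \<lambda>i. \<tau> + real i / real n"
  defines "b \<equiv> \<lambda>i k. \<Sum>x\<in>X. of_real (e k x) * G i x"
  assumes v: "\<And>i. 0 \<le> v i"
    and dual: "\<And>i. of_real (v i) = (\<Sum>x\<in>X. (\<Sum>k\<in>Ks. c k * cis (- t i * \<omega> k) * of_real (e k x)) * G i x)"
    and T: "\<And>j. j \<in> J \<Longrightarrow> 0 < T j"
    and \<kappa>: "\<And>j. j \<in> J \<Longrightarrow> real n powr (-\<sigma>) \<le> \<kappa> j"
    and diag: "\<And>j i. j \<in> J \<Longrightarrow> (\<Sum>k\<in>S' j. (cmod (b i k))\<^sup>2) \<le> 1"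
    and off: "\<And>j i i'. j \<in> J \<Longrightarrow> t i \<noteq> t i' \<Longrightarrow> \<bar>t i - t i'\<bar> \<le> T j \<Longrightarrow>
      cmod (\<Sum>k\<in>S' j. cis (- (t i - t i') * \<omega> k) * b i k * cnj (b i' k)) \<le> \<kappa> j * \<bar>t i - t i'\<bar> powr (-\<sigma>)"
  shows "((\<Sum>i<n. v i powr (2 / \<sigma>)) / real n) powr (\<sigma> / 2)
     \<le> (\<Sum>j\<in>J. sqrt (\<Sum>k\<in>{k\<in>Ks. lev k = j}. (cmod (c k))\<^sup>2)
           * sqrt ((2 * (2 / (1 - \<sigma>) + 5) + 1) * \<kappa> j) * (1 / T j + 1) powr (\<sigma> / 2))"
proof -
  define q where "q = 2 / \<sigma>"
  define p where "p = 2 / (2 - \<sigma>)"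
  \<comment> \<open>The extremal weight of duality in time: both \<open>a i powr p\<close> and
    \<open>a i * v i\<close> equal \<open>v i powr q\<close>.\<close>
  define a where "a i = v i powr (q - 1)" for i
  define C where "C = 2 * (2 / (1 - \<sigma>) + 5)"
  define P where "P = (\<Sum>i<n. v i powr q)"
  define W where "W j = sqrt (\<Sum>k\<in>{k\<in>Ks. lev k = j}. (cmod (c k))\<^sup>2)" for j
  define R where "R = (\<Sum>j\<in>J. W j * sqrt ((C + 1) * \<kappa> j) * (1 / T j + 1) powr (\<sigma> / 2))"
  have C: "0 \<le> C" using \<sigma> by (simp add: C_def)
  have q: "2 < q" "1 / q = \<sigma> / 2" using \<sigma> by (simp_all add: q_def field_simps)
  have p1: "1 / p = 1 - \<sigma> / 2" "(q - 1) * p = q" using \<sigma> by (simp_all add: p_def q_def field_simps)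
  have P: "0 \<le> P" by (simp add: P_def sum_nonneg)
  have n\<sigma>: "0 < real n powr \<sigma>" using n by simp
  have \<kappa>0: "0 < \<kappa> j" if "j \<in> J" for j
    using \<kappa>[OF that] n by (smt (verit) of_nat_0_less_iff powr_gt_zero)
  have ap: "a i powr p = v i powr q" for i by (simp add: a_def powr_powr p1)
  have av: "a i * v i = v i powr q" for i
  proof -
    have "v i powr (q - 1) * v i powr 1 = v i powr q" by (simp only: powr_add [symmetric]) simp
    then show ?thesis using v[of i] by (simp add: a_def)
  qed
  define U where "U j i = (\<Sum>x\<in>X. (\<Sum>k\<in>{k\<in>Ks. lev k = j}. c k * cis (- t i * \<omega> k) * of_real (e k x)) * G i x)" for j i
  have vU: "of_real (v i) = (\<Sum>j\<in>J. U j i)" for i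
  proof -
    have "of_real (v i) = (\<Sum>x\<in>X. (\<Sum>j\<in>J. \<Sum>k\<in>{k\<in>Ks. lev k = j}. c k * cis (- t i * \<omega> k) * of_real (e k x)) * G i x)"
      unfolding dual by (subst sum.group[OF fin]) simp
    also have "\<dots> = (\<Sum>j\<in>J. U j i)"
      unfolding U_def sum_distrib_right by (rule sum.swap)
    finally show ?thesis .
  qed
  have level: "cmod (\<Sum>i<n. of_real (a i) * U j i)
      \<le> W j * sqrt ((C + 1) * \<kappa> j) * (1 / T j + 1) powr (\<sigma> / 2) * (real n powr (\<sigma> / 2) * P powr (1 - \<sigma> / 2))"
    if j: "j \<in> J" for j
  proof -
    \<comment> \<open>Indices in one block differ by at most m - 1 < n T, so their times differ by
      at most \<open>T j\<close>.\<close>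
    define m where "m = nat \<lceil>real n * T j\<rceil>"
    have nT: "0 < real n * T j" using n T[OF j] by simp
    have m: "0 < m" "real n * T j \<le> real m" "real m < real n * T j + 1"
      using nT unfolding m_def by linarith+
    define D where "D = (\<lambda>i. i div m) ` {..<n}"
    define Blk where "Blk d = {i\<in>{..<n}. i div m = d}" for d
    have D: "finite D" by (simp add: D_def)
    have block: "cmod (\<Sum>i\<in>Blk d. of_real (a i) * U j i)
        \<le> W j * sqrt (C * (\<kappa> j * real n powr \<sigma>) + 1) * (\<Sum>i\<in>Blk d. a i powr p) powr (1 / p)" for d
      unfolding U_def W_def C_def
    proof (rule tt_star_block[OF _ _ _ _ \<sigma> p_def, where S'="S' j"])
      show "finite (S' j)" "{k\<in>Ks. lev k = j} \<subseteq> S' j" using S'[OF j] by auto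
      show "(\<Sum>k\<in>S' j. (cmod (\<Sum>x\<in>X. of_real (e k x) * G i x))\<^sup>2) \<le> 1" for i
        using diag[OF j, of i] by (simp add: b_def)
      fix i i' assume i: "i \<in> Blk d" "i' \<in> Blk d" "i \<noteq> i'"
      have td: "t i - t i' = (real i - real i') / real n" by (simp add: t_def diff_divide_distrib)
      have "\<bar>real i - real i'\<bar> \<le> real m - 1"
      proof -
        have "i div m = d" "i' div m = d" using i by (auto simp: Blk_def)
        then have "i = d * m + i mod m" "i' = d * m + i' mod m" by (metis div_mult_mod_eq)+
        moreover have "i mod m < m" "i' mod m < m" using m by auto
        ultimately have "i < i' + m" "i' < i + m" by linarith+
        then show ?thesis by linarith
      qed
      then have "\<bar>real i - real i'\<bar> \<le> real n * T j" using m by simp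
      then have le: "\<bar>t i - t i'\<bar> \<le> T j" using n by (simp add: td divide_le_eq mult.commute)
      have ne: "t i \<noteq> t i'" using i n by (simp add: t_def)
      have "\<bar>t i - t i'\<bar> powr (-\<sigma>) = \<bar>real i - real i'\<bar> powr (-\<sigma>) * real n powr \<sigma>"
        using n by (simp add: td powr_divide powr_minus field_simps)
      then show "cmod (\<Sum>k\<in>S' j. cis (- (t i - t i') * \<omega> k) * (\<Sum>x\<in>X. of_real (e k x) * G i x) * cnj (\<Sum>x\<in>X. of_real (e k x) * G i' x))
          \<le> \<kappa> j * real n powr \<sigma> * \<bar>real i - real i'\<bar> powr (-\<sigma>)"
        using off[OF j ne le] by (simp only: b_def mult_ac)
    qed (use \<kappa>0[OF j] in \<open>auto simp: Blk_def a_def\<close>)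
    have "(\<Sum>i<n. of_real (a i) * U j i) = (\<Sum>d\<in>D. \<Sum>i\<in>Blk d. of_real (a i) * U j i)"
      unfolding Blk_def using D by (intro sum.group [symmetric]) (auto simp: D_def)
    also have "cmod \<dots> \<le> (\<Sum>d\<in>D. W j * sqrt (C * (\<kappa> j * real n powr \<sigma>) + 1) * (\<Sum>i\<in>Blk d. a i powr p) powr (1 / p))"
      by (intro sum_norm_le block)
    also have "\<dots> = W j * sqrt (C * (\<kappa> j * real n powr \<sigma>) + 1) * (\<Sum>d\<in>D. (\<Sum>i\<in>Blk d. a i powr p) powr (1 - \<sigma> / 2))"
      by (simp only: sum_distrib_left p1)
    also have "\<dots> \<le> W j * (sqrt ((C + 1) * \<kappa> j) * real n powr (\<sigma> / 2)) * ((1 / T j + 1) powr (\<sigma> / 2) * P powr (1 - \<sigma> / 2))"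
    proof (intro mult_mono order_refl)
      \<comment> \<open>The 1 comes from the diagonal; the fineness of the grid,
        \<open>real n powr (-\<sigma>) \<le> \<kappa> j\<close>, absorbs it into the dispersive
        constant.\<close>
      have "1 = real n powr (-\<sigma>) * real n powr \<sigma>" using n by (simp flip: powr_add)
      also have "\<dots> \<le> \<kappa> j * real n powr \<sigma>" using \<kappa>[OF j] by (intro mult_right_mono) auto
      finally have "C * (\<kappa> j * real n powr \<sigma>) + 1 \<le> (C + 1) * \<kappa> j * real n powr \<sigma>" by (simp add: algebra_simps)
      then have "sqrt (C * (\<kappa> j * real n powr \<sigma>) + 1) \<le> sqrt ((C + 1) * \<kappa> j * real n powr \<sigma>)"
        by (rule real_sqrt_le_mono)
      also have "\<dots> = sqrt ((C + 1) * \<kappa> j) * real n powr (\<sigma> / 2)"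
        by (simp add: real_sqrt_mult powr_half_sqrt [symmetric] powr_powr)
      finally show "sqrt (C * (\<kappa> j * real n powr \<sigma>) + 1) \<le> sqrt ((C + 1) * \<kappa> j) * real n powr (\<sigma> / 2)" .
      \<comment> \<open>Recombining the blocks costs their number to the power 1 - 1/p = \<sigma>/2
        = 1/q; this is the loss (1/T + 1)^(1/q).\<close>
      have "(\<Sum>d\<in>D. (\<Sum>i\<in>Blk d. a i powr p) powr (1 - \<sigma> / 2))
          \<le> real (card D) powr (1 - (1 - \<sigma> / 2)) * (\<Sum>d\<in>D. \<Sum>i\<in>Blk d. a i powr p) powr (1 - \<sigma> / 2)"
        using \<sigma> D by (intro sum_powr_le_card) (auto intro: sum_nonneg)
      also have "(\<Sum>d\<in>D. \<Sum>i\<in>Blk d. a i powr p) = P"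
        unfolding P_def Blk_def ap using D by (intro sum.group) (auto simp: D_def)
      also have "real (card D) powr (1 - (1 - \<sigma> / 2)) * P powr (1 - \<sigma> / 2) \<le> (1 / T j + 1) powr (\<sigma> / 2) * P powr (1 - \<sigma> / 2)"
      proof -
        have "real (card D) \<le> real n / real m + 1"
          unfolding D_def using m n by (intro card_div_image_le) auto
        also have "real n / real m \<le> real n / (real n * T j)"
          using m nT by (intro divide_left_mono) auto
        also have "\<dots> = 1 / T j" using n by simp
        finally have "real (card D) powr (\<sigma> / 2) \<le> (1 / T j + 1) powr (\<sigma> / 2)"
          using \<sigma> by (intro powr_mono2) auto
        then show ?thesis by (simp add: mult_right_mono)
      qed
      finally show "(\<Sum>d\<in>D. (\<Sum>i\<in>Blk d. a i powr p) powr (1 - \<sigma> / 2)) \<le> (1 / T j + 1) powr (\<sigma> / 2) * P powr (1 - \<sigma> / 2)" .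
    qed (use \<kappa>0[OF j] C in \<open>auto simp: W_def intro!: sum_nonneg mult_nonneg_nonneg\<close>)
    finally show ?thesis by (simp add: mult_ac)
  qed
  have "complex_of_real P = (\<Sum>i<n. of_real (a i) * of_real (v i))"
    by (simp add: P_def flip: av)
  also have "\<dots> = (\<Sum>j\<in>J. \<Sum>i<n. of_real (a i) * U j i)"
    unfolding vU sum_distrib_left by (rule sum.swap)
  finally have "cmod (complex_of_real P) = cmod (\<Sum>j\<in>J. \<Sum>i<n. of_real (a i) * U j i)" by simp
  then have "P = cmod (\<Sum>j\<in>J. \<Sum>i<n. of_real (a i) * U j i)" using P by simp
  also have "\<dots> \<le> (\<Sum>j\<in>J. W j * sqrt ((C + 1) * \<kappa> j) * (1 / T j + 1) powr (\<sigma> / 2) * (real n powr (\<sigma> / 2) * P powr (1 - \<sigma> / 2)))"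
    by (intro sum_norm_le level)
  also have "\<dots> = R * (real n powr (\<sigma> / 2) * P powr (1 - \<sigma> / 2))"
    by (simp only: R_def sum_distrib_right)
  finally have main: "P \<le> R * (real n powr (\<sigma> / 2) * P powr (1 - \<sigma> / 2))" .
  have R0: "0 \<le> R" unfolding R_def W_def using C \<kappa>0
    by (intro sum_nonneg mult_nonneg_nonneg) (auto intro!: sum_nonneg simp: less_imp_le)
  have "(P / real n) powr (\<sigma> / 2) \<le> R"
  proof (cases "P = 0")
    case False
    then have P0: "0 < P" using P by simp
    have "P powr (\<sigma> / 2) * P powr (1 - \<sigma> / 2) = P" using P0 by (simp flip: powr_add)
    with main have "P powr (\<sigma> / 2) * P powr (1 - \<sigma> / 2) \<le> R * real n powr (\<sigma> / 2) * P powr (1 - \<sigma> / 2)"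
      by (simp add: mult.assoc)
    then have "P powr (\<sigma> / 2) \<le> R * real n powr (\<sigma> / 2)"
      using P0 by (subst (asm) mult_le_cancel_right_pos) auto
    then show ?thesis using n P0 by (simp add: powr_divide divide_le_eq)
  qed (use R0 in simp)
  then show ?thesis by (simp add: P_def R_def q_def W_def C_def)
qed

subsection \<open>The sine basis and the dispersive estimate\<close>

locale symmetric_orthonormal =
  fixes A :: "'a set" and E :: "'a \<Rightarrow> 'a \<Rightarrow> real"
  assumes fin: "finite A" and sym: "E k m = E m k"
    and orth: "k \<in> A \<Longrightarrow> k' \<in> A \<Longrightarrow> (\<Sum>m\<in>A. E k m * E k' m) = (if k = k' then 1 else 0)"
begin

definition coef :: "('a \<Rightarrow> complex) \<Rightarrow> 'a \<Rightarrow> complex" where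
  "coef F k = (\<Sum>m\<in>A. of_real (E k m) * F m)"

lemma coef_synthesis:
  assumes "k \<in> A"
  shows "coef (\<lambda>m. \<Sum>k'\<in>A. c k' * of_real (E k' m)) k = c k"
proof -
  have "coef (\<lambda>m. \<Sum>k'\<in>A. c k' * of_real (E k' m)) k = (\<Sum>k'\<in>A. c k' * of_real (\<Sum>m\<in>A. E k m * E k' m))"
    unfolding coef_def of_real_sum sum_distrib_left
    by (subst sum.swap) (simp only: of_real_mult mult_ac)
  also have "\<dots> = (\<Sum>k'\<in>A. if k' = k then c k else 0)"
    using assms by (intro sum.cong) (auto simp: orth)
  finally show ?thesis using assms fin by simp
qed

text \<open>Completeness comes from symmetry: orthonormal rows are orthonormal columns, so analysis
  and synthesis are given by one matrix that is its own inverse.\<close>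

lemma synthesis_coef:
  assumes "m \<in> A"
  shows "(\<Sum>k\<in>A. coef F k * of_real (E k m)) = F m"
  using coef_synthesis[OF assms, of F] unfolding coef_def
  by (simp add: sym[of m] mult.commute) (simp add: sym)

lemma parseval: "(\<Sum>k\<in>A. coef F k * cnj (coef G k)) = (\<Sum>m\<in>A. F m * cnj (G m))"
proof -
  have "(\<Sum>k\<in>A. coef F k * cnj (coef G k)) = (\<Sum>k\<in>A. \<Sum>m\<in>A. coef F k * of_real (E k m) * cnj (G m))"
    unfolding coef_def[of G] cnj_sum sum_distrib_left by (simp add: mult_ac)
  also have "\<dots> = (\<Sum>m\<in>A. (\<Sum>k\<in>A. coef F k * of_real (E k m)) * cnj (G m))"
    unfolding sum_distrib_right by (rule sum.swap)
  finally show ?thesis by (simp add: synthesis_coef)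
qed

lemma parseval_norm: "(\<Sum>k\<in>A. (cmod (coef F k))\<^sup>2) = (\<Sum>m\<in>A. (cmod (F m))\<^sup>2)"
proof -
  have "complex_of_real (\<Sum>k\<in>A. (cmod (coef F k))\<^sup>2) = of_real (\<Sum>m\<in>A. (cmod (F m))\<^sup>2)"
    using parseval[of F F] by (simp only: of_real_sum complex_norm_square)
  then show ?thesis by (simp only: of_real_eq_iff)
qed

lemma bessel: "S \<subseteq> A \<Longrightarrow> (\<Sum>k\<in>S. (cmod (coef F k))\<^sup>2) \<le> (\<Sum>m\<in>A. (cmod (F m))\<^sup>2)"
  using fin parseval_norm[of F] sum_mono2[of A S "\<lambda>k. (cmod (coef F k))\<^sup>2"] by auto

end

text \<open>The matrix of the type-I discrete sine transform. It is symmetric, orthogonal on the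
  indices 1 to L - 1, and vanishes at the boundary nodes 0 and L.\<close>

definition sine_vec :: "nat \<Rightarrow> nat \<Rightarrow> nat \<Rightarrow> real" where
  "sine_vec L k m = sqrt (2 / real L) * sin (real k * (pi * real m / real L))"

definition box_index :: "nat \<Rightarrow> ('d::finite \<Rightarrow> nat) set" where
  "box_index L = PiE UNIV (\<lambda>_. {1..<L})"

definition sine_basis :: "nat \<Rightarrow> ('d::finite \<Rightarrow> nat) \<Rightarrow> ('d \<Rightarrow> nat) \<Rightarrow> real" where
  "sine_basis L k m = (\<Prod>j\<in>UNIV. sine_vec L (k j) (m j))"

lemma finite_box_index: "finite (box_index L)"
  by (simp add: box_index_def finite_PiE)

lemma box_index_iff: "k \<in> box_index L \<longleftrightarrow> (\<forall>j. 1 \<le> k j \<and> k j < L)"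
  by (auto simp: box_index_def PiE_UNIV_domain Pi_iff)

text \<open>The Dirichlet kernel, telescoped after multiplication by 2 sin (a/2). Only the parity of
  \<open>j\<close> survives; k' - k and k' + k have the same parity, so for distinct modes the two
  sums in \<open>sine_vec_orth\<close> cancel.\<close>

lemma cos_sum_parity:
  assumes "0 < j" "j < 2 * L"
  shows "(\<Sum>m\<in>{1..<L}. cos (real j * (pi * real m / real L))) = - (1 + (-1) ^ j) / 2"
proof -
  define a where "a = real j * pi / real L"
  have L: "0 < L" using assms by auto
  have "0 < a / 2" "a / 2 < pi" using assms L by (auto simp: a_def field_simps)
  then have s: "sin (a / 2) \<noteq> 0" using sin_gt_zero by fastforce
  have tele: "(\<Sum>m\<in>{1..<Suc n}. 2 * sin (a / 2) * cos (real m * a)) = sin ((real n + 1 / 2) * a) - sin (a / 2)" for n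
  proof (induction n)
    case (Suc n)
    have "2 * sin (a / 2) * cos (real (Suc n) * a) = sin (real (Suc n) * a + a / 2) - sin (real (Suc n) * a - a / 2)"
      by (simp add: sin_add sin_diff)
    also have "real (Suc n) * a + a / 2 = (real (Suc n) + 1 / 2) * a" by (simp add: algebra_simps)
    also have "real (Suc n) * a - a / 2 = (real n + 1 / 2) * a" by (simp add: algebra_simps)
    finally show ?case using Suc by simp
  qed simp
  obtain n where n: "L = Suc n" using L by (cases L) auto
  have "(real n + 1 / 2) * a = real j * pi - a / 2"
    using L by (simp add: a_def n field_simps)
  then have "sin ((real n + 1 / 2) * a) = - ((-1) ^ j * sin (a / 2))"
    by (simp add: sin_diff sin_npi cos_npi)
  with tele[of n] have "2 * sin (a / 2) * (\<Sum>m\<in>{1..<L}. cos (real m * a)) = - ((-1) ^ j * sin (a / 2)) - sin (a / 2)"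
    by (simp add: n sum_distrib_left del: sum.op_ivl_Suc)
  then have "2 * sin (a / 2) * (\<Sum>m\<in>{1..<L}. cos (real m * a)) = 2 * sin (a / 2) * (- (1 + (-1) ^ j) / 2)"
    by (simp add: algebra_simps)
  then have "(\<Sum>m\<in>{1..<L}. cos (real m * a)) = - (1 + (-1) ^ j) / 2"
    using s by simp
  then show ?thesis by (simp add: a_def mult_ac)
qed

lemma sine_vec_orth:
  assumes "k \<in> {1..<L}" "k' \<in> {1..<L}"
  shows "(\<Sum>m\<in>{1..<L}. sine_vec L k m * sine_vec L k' m) = (if k = k' then 1 else 0)"
  using assms
proof (induction k k' rule: linorder_wlog)
  case (le k k')
  have L: "0 < real L" using le by auto
  have "sine_vec L k m * sine_vec L k' m
      = (1 / real L) * (cos (real (k' - k) * (pi * real m / real L)) - cos (real (k' + k) * (pi * real m / real L)))" for m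
  proof -
    define x where "x = pi * real m / real L"
    have "cos (real (k' - k) * x) - cos (real (k' + k) * x) = 2 * (sin (real k * x) * sin (real k' * x))"
      using le by (simp add: of_nat_diff left_diff_distrib distrib_right cos_diff cos_add)
    moreover have "sine_vec L k m * sine_vec L k' m = (sqrt (2 / real L) * sqrt (2 / real L)) * (sin (real k * x) * sin (real k' * x))"
      by (simp only: sine_vec_def x_def mult_ac)
    ultimately show ?thesis using L by (simp add: x_def)
  qed
  then have eq: "(\<Sum>m\<in>{1..<L}. sine_vec L k m * sine_vec L k' m)
     = (1 / real L) * ((\<Sum>m\<in>{1..<L}. cos (real (k' - k) * (pi * real m / real L)))
         - (\<Sum>m\<in>{1..<L}. cos (real (k' + k) * (pi * real m / real L))))"
    by (simp only: sum_distrib_left right_diff_distrib sum_subtractf)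
  have plus: "(\<Sum>m\<in>{1..<L}. cos (real (k' + k) * (pi * real m / real L))) = - (1 + (-1) ^ (k' + k)) / 2"
    using le by (intro cos_sum_parity) auto
  show ?case
  proof (cases "k = k'")
    case True
    then show ?thesis unfolding eq plus using L le by (simp add: of_nat_diff field_simps)
  next
    case False
    have "(\<Sum>m\<in>{1..<L}. cos (real (k' - k) * (pi * real m / real L))) = - (1 + (-1) ^ (k' - k)) / 2"
      using le False by (intro cos_sum_parity) auto
    moreover have "(-1::real) ^ (k' - k) = (-1) ^ (k' + k)"
      using le by (simp add: minus_one_power_iff)
    ultimately show ?thesis unfolding eq plus using False by simp
  qed
next
  case (sym k k')
  then show ?case by (simp add: mult.commute eq_commute)
qed

lemma sine_vec_sym: "sine_vec L k m = sine_vec L m k"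
  by (simp add: sine_vec_def mult_ac)

interpretation sb: symmetric_orthonormal "box_index L :: ('d::finite \<Rightarrow> nat) set" "sine_basis L" for L
proof
  show "finite (box_index L)" by (rule finite_box_index)
  show "sine_basis L k m = sine_basis L m k" for k m
    unfolding sine_basis_def by (subst sine_vec_sym) simp
  fix k k' :: "'d \<Rightarrow> nat"
  assume k: "k \<in> box_index L" "k' \<in> box_index L"
  have "(\<Sum>m\<in>box_index L. sine_basis L k m * sine_basis L k' m)
      = (\<Sum>m\<in>PiE UNIV (\<lambda>_. {1..<L}). \<Prod>j\<in>UNIV. sine_vec L (k j) (m j) * sine_vec L (k' j) (m j))"
    by (simp add: box_index_def sine_basis_def prod.distrib)
  also have "\<dots> = (\<Prod>j\<in>UNIV. \<Sum>m\<in>{1..<L}. sine_vec L (k j) m * sine_vec L (k' j) m)"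
    by (intro prod_sum_PiE [symmetric]) auto
  also have "\<dots> = (\<Prod>j\<in>UNIV. if k j = k' j then 1 else 0)"
    using k by (intro prod.cong sine_vec_orth) (auto simp: box_index_iff)
  also have "\<dots> = (if k = k' then 1 else 0)"
  proof (cases "k = k'")
    case False
    then obtain j where "k j \<noteq> k' j" by blast
    then have "(\<Prod>j\<in>UNIV. if k j = k' j then 1 else 0 :: real) = 0"
      by (intro prod_zero) auto
    then show ?thesis using False by simp
  qed simp
  finally show "(\<Sum>m\<in>box_index L. sine_basis L k m * sine_basis L k' m) = (if k = k' then 1 else 0)" .
qed

section \<open>The box, its frequencies and the kernel of the flow\<close>

locale dirichlet_box =
  fixes h :: real and K R :: nat
  assumes h: "0 < h" "h \<le> 1" and K: "real K = pi / h" and R: "1 \<le> R"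
begin

text \<open>\<open>L\<close> counts the lattice steps along a side, L h = 2 pi R, and \<theta>
  equals pi / (2 L). \<open>freq\<close> is the eigenvalue of the one-dimensional negative
  Laplacian, \<open>symbol\<close> that of the full one.\<close>

definition L :: nat where "L = 2 * K * R"
definition \<theta> :: real where "\<theta> = h / (4 * real R)"
definition freq :: "nat \<Rightarrow> real" where "freq k = 4 / h\<^sup>2 * (sin (real k * \<theta>))\<^sup>2"
definition symbol :: "('d::finite \<Rightarrow> nat) \<Rightarrow> real" where "symbol k = (\<Sum>j\<in>UNIV. freq (k j))"

lemma Kh: "real K * h = pi" using h K by simp

lemma Lh: "real L * h = 2 * pi * real R" using Kh by (simp add: L_def)

lemma K_pos: "0 < K"
  using Kh by (cases K) auto

lemma L_pos: "0 < L" using K_pos R by (simp add: L_def)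

lemma \<theta>_eq: "\<theta> = pi / (2 * real L)"
proof -
  have "h = 2 * pi * real R / real L" using Lh L_pos by (simp add: field_simps)
  then show ?thesis using R L_pos by (simp add: \<theta>_def field_simps)
qed

text \<open>The normalisation 2 / L equals h / (pi R); it cancels the R of the exponential sum and
  leaves one h per dimension. 205 is a generous bound for 307 / pi.\<close>

lemma sine_vec_kernel_bound:
  assumes N: "1 \<le> N" and M: "real M \<le> N * real R" "M < L"
    and t: "t \<noteq> 0" "\<bar>t\<bar> \<le> real R / N"
  shows "cmod (\<Sum>k\<in>{1..M}. cis (- t * freq k) * of_real (sine_vec L k x * sine_vec L k y))
      \<le> 205 * h * (N / \<bar>t\<bar>) powr (1/3)"
proof -
  let ?S = "\<Sum>k\<in>{1..M}. cis (- t * (4 / h\<^sup>2 * (sin (real k * \<theta>))\<^sup>2))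
       * of_real (sin (real k * (pi * real x / real L)) * sin (real k * (pi * real y / real L)))"
  have "sine_vec L k x * sine_vec L k y
      = (2 / real L) * (sin (real k * (pi * real x / real L)) * sin (real k * (pi * real y / real L)))" for k
  proof -
    have "sine_vec L k x * sine_vec L k y = (sqrt (2 / real L) * sqrt (2 / real L))
        * (sin (real k * (pi * real x / real L)) * sin (real k * (pi * real y / real L)))"
      by (simp only: sine_vec_def mult_ac)
    then show ?thesis using L_pos by simp
  qed
  then have "(\<Sum>k\<in>{1..M}. cis (- t * freq k) * of_real (sine_vec L k x * sine_vec L k y)) = of_real (2 / real L) * ?S"
    by (simp only: sum_distrib_left freq_def of_real_mult mult_ac)
  then have "cmod (\<Sum>k\<in>{1..M}. cis (- t * freq k) * of_real (sine_vec L k x * sine_vec L k y)) = (2 / real L) * cmod ?S"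
    by (simp only: norm_mult norm_of_real) simp
  also have "\<dots> \<le> (2 / real L) * (307 * real R * (N / \<bar>t\<bar>) powr (1/3))"
  proof (rule mult_left_mono[OF sine_kernel_bound[OF h R N \<theta>_def M(1) _ t]])
    have "2 * real M * \<theta> \<le> 2 * real L * \<theta>" using M h by (intro mult_right_mono) (auto simp: \<theta>_def)
    also have "\<dots> = pi" using L_pos by (simp add: \<theta>_eq)
    finally show "2 * real M * \<theta> \<le> pi" .
  qed simp
  also have "\<dots> = (307 / pi) * h * (N / \<bar>t\<bar>) powr (1/3)"
  proof -
    have "2 * real R / real L = h / pi" using Lh L_pos by (simp add: field_simps)
    moreover have "2 / real L * (307 * real R) = 307 * (2 * real R / real L)" by simp
    ultimately have "2 / real L * (307 * real R) = 307 * (h / pi)" by (simp only:)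
    then show ?thesis by (simp add: mult.assoc [symmetric])
  qed
  also have "\<dots> \<le> 205 * h * (N / \<bar>t\<bar>) powr (1/3)"
  proof (intro mult_right_mono)
    have "307 / pi \<le> 307 / 3" using pi_approx by (intro divide_left_mono) auto
    then show "307 / pi \<le> 205" by simp
  qed (use h in auto)
  finally show ?thesis .
qed

text \<open>A full cube rather than a dyadic shell, so that the kernel factors into one-dimensional
  sums.\<close>

definition low_freqs :: "nat \<Rightarrow> ('d::finite \<Rightarrow> nat) set" where
  "low_freqs M = PiE UNIV (\<lambda>_. {1..M})"

lemma low_freqs_subset: "M < L \<Longrightarrow> low_freqs M \<subseteq> box_index L"
  unfolding low_freqs_def box_index_def by (intro PiE_mono) auto

definition kernel :: "nat \<Rightarrow> real \<Rightarrow> ('d::finite \<Rightarrow> nat) \<Rightarrow> ('d \<Rightarrow> nat) \<Rightarrow> complex" where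
  "kernel M t x y = (\<Sum>k\<in>low_freqs M. cis (- t * symbol k) * of_real (sine_basis L k x * sine_basis L k y))"

lemma kernel_bound:
  fixes x y :: "'d::finite \<Rightarrow> nat"
  assumes N: "1 \<le> N" and M: "real M \<le> N * real R" "M < L"
    and t: "t \<noteq> 0" "\<bar>t\<bar> \<le> real R / N"
  shows "cmod (kernel M t x y) \<le> (205 * h * (N / \<bar>t\<bar>) powr (1/3)) ^ CARD('d)"
proof -
  have cis_sum: "cis (\<Sum>j\<in>B. f j) = (\<Prod>j\<in>B. cis (f j))" if "finite B" for f :: "'d \<Rightarrow> real" and B
    using that by (induction B rule: finite_induct) (simp_all flip: cis_mult)
  have "kernel M t x y = (\<Sum>k\<in>low_freqs M. \<Prod>j\<in>UNIV. cis (- t * freq (k j)) * of_real (sine_vec L (k j) (x j) * sine_vec L (k j) (y j)))"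
    unfolding kernel_def symbol_def sum_distrib_left sine_basis_def
    by (intro sum.cong refl) (simp add: cis_sum prod.distrib)
  also have "\<dots> = (\<Prod>j\<in>UNIV. \<Sum>k\<in>{1..M}. cis (- t * freq k) * of_real (sine_vec L k (x j) * sine_vec L k (y j)))"
    unfolding low_freqs_def by (intro prod_sum_PiE [symmetric]) auto
  finally have "cmod (kernel M t x y) = (\<Prod>j\<in>UNIV. cmod (\<Sum>k\<in>{1..M}. cis (- t * freq k) * of_real (sine_vec L k (x j) * sine_vec L k (y j))))"
    by (simp add: prod_norm)
  also have "\<dots> \<le> (\<Prod>j\<in>(UNIV::'d set). 205 * h * (N / \<bar>t\<bar>) powr (1/3))"
    by (intro prod_mono conjI sine_vec_kernel_bound[OF N M t]) auto
  finally show ?thesis by simp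
qed

text \<open>The exponent \<open>p = 1\<close> serves the case \<open>r = \<infinity>\<close> and needs no interpolation.\<close>

lemma dispersive_estimate:
  fixes F G :: "('d::finite \<Rightarrow> nat) \<Rightarrow> complex"
  assumes N: "1 \<le> N" and M: "real M \<le> N * real R" "M < L"
    and t: "t \<noteq> 0" "\<bar>t\<bar> \<le> real R / N"
    and p: "1 \<le> p" "p < 2"
    and F: "(\<Sum>x\<in>box_index L. cmod (F x) powr p) \<le> 1" and G: "(\<Sum>x\<in>box_index L. cmod (G x) powr p) \<le> 1"
  shows "cmod (\<Sum>k\<in>low_freqs M. cis (- t * symbol k) * sb.coef L F k * cnj (sb.coef L G k))
     \<le> (3 + 1 / (1 - 2 powr (p - 2))) * ((205 * h) ^ CARD('d) * (N / \<bar>t\<bar>) powr (CARD('d) / 3)) powr (2 / p - 1)"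
proof -
  define A where "A = (205 * h) ^ CARD('d) * (N / \<bar>t\<bar>) powr (CARD('d) / 3)"
  have A: "0 < A" using h N t by (simp add: A_def)
  have A_eq: "A = (205 * h * (N / \<bar>t\<bar>) powr (1/3)) ^ CARD('d)"
    using N t by (simp add: A_def power_mult_distrib powr_powr flip: powr_realpow)
  have K1: "cmod (kernel M t x y) \<le> A" for x y :: "'d \<Rightarrow> nat"
    unfolding A_eq by (rule kernel_bound[OF N M t])
  have form: "(\<Sum>x\<in>box_index L. \<Sum>y\<in>box_index L. kernel M t x y * f x * g y)
      = (\<Sum>k\<in>low_freqs M. cis (- t * symbol k) * sb.coef L f k * sb.coef L g k)"
    for f g :: "('d \<Rightarrow> nat) \<Rightarrow> complex"
  proof -
    have "(\<Sum>x\<in>box_index L. \<Sum>y\<in>box_index L. kernel M t x y * f x * g y)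
      = (\<Sum>x\<in>box_index L. \<Sum>y\<in>box_index L. \<Sum>k\<in>low_freqs M.
           cis (- t * symbol k) * (of_real (sine_basis L k x) * f x) * (of_real (sine_basis L k y) * g y))"
      unfolding kernel_def sum_distrib_right by (simp only: of_real_mult mult_ac)
    also have "\<dots> = (\<Sum>x\<in>box_index L. \<Sum>k\<in>low_freqs M. \<Sum>y\<in>box_index L.
           cis (- t * symbol k) * (of_real (sine_basis L k x) * f x) * (of_real (sine_basis L k y) * g y))"
      by (intro sum.cong refl sum.swap)
    also have "\<dots> = (\<Sum>k\<in>low_freqs M. \<Sum>x\<in>box_index L. \<Sum>y\<in>box_index L.
           cis (- t * symbol k) * (of_real (sine_basis L k x) * f x) * (of_real (sine_basis L k y) * g y))"
      by (rule sum.swap)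
    also have "\<dots> = (\<Sum>k\<in>low_freqs M. cis (- t * symbol k) * sb.coef L f k * sb.coef L g k)"
      unfolding sb.coef_def mult.assoc sum_product unfolding sum_distrib_left mult.assoc ..
    finally show ?thesis .
  qed
  have K2: "cmod (\<Sum>x\<in>box_index L. \<Sum>y\<in>box_index L. kernel M t x y * f x * g y)
      \<le> sqrt (\<Sum>x\<in>box_index L. (cmod (f x))\<^sup>2) * sqrt (\<Sum>x\<in>box_index L. (cmod (g x))\<^sup>2)"
    for f g :: "('d \<Rightarrow> nat) \<Rightarrow> complex"
  proof -
    have "cmod (\<Sum>x\<in>box_index L. \<Sum>y\<in>box_index L. kernel M t x y * f x * g y)
       \<le> sqrt (\<Sum>k\<in>low_freqs M. (cmod (cis (- t * symbol k) * sb.coef L f k))\<^sup>2)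
         * sqrt (\<Sum>k\<in>low_freqs M. (cmod (sb.coef L g k))\<^sup>2)"
      unfolding form by (rule norm_sum_mult_le_L2)
    also have "\<dots> \<le> sqrt (\<Sum>x\<in>box_index L. (cmod (f x))\<^sup>2) * sqrt (\<Sum>x\<in>box_index L. (cmod (g x))\<^sup>2)"
      using low_freqs_subset[OF M(2)]
      by (intro mult_mono real_sqrt_le_mono) (auto simp: norm_mult sum_nonneg intro!: sb.bessel)
    finally show ?thesis .
  qed
  have cnj: "sb.coef L (\<lambda>x. cnj (G x)) k = cnj (sb.coef L G k)" for k
    by (simp add: sb.coef_def)
  have "cmod (\<Sum>x\<in>box_index L. \<Sum>y\<in>box_index L. kernel M t x y * F x * cnj (G y))
     \<le> (3 + 1 / (1 - 2 powr (p - 2))) * A powr (2 / p - 1)"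
  proof (cases "p = 1")
    case True
    have "cmod (\<Sum>x\<in>box_index L. \<Sum>y\<in>box_index L. kernel M t x y * F x * cnj (G y))
       \<le> (\<Sum>x\<in>box_index L. \<Sum>y\<in>box_index L. A * (cmod (F x) * cmod (G y)))"
      using K1 by (intro sum_norm_le) (simp add: norm_mult mult_right_mono mult.assoc)
    also have "\<dots> = A * ((\<Sum>x\<in>box_index L. cmod (F x)) * (\<Sum>y\<in>box_index L. cmod (G y)))"
      unfolding sum_product by (simp only: sum_distrib_left)
    also have "\<dots> \<le> A * (1 * 1)"
      using F G A True by (intro mult_left_mono mult_mono) (auto intro: sum_nonneg)
    \<comment> \<open>5 is the value of 3 + 1 / (1 - 2^(p-2)) at p = 1, so one formula for the
      constant covers the whole range of p.\<close>
    also have "\<dots> \<le> 5 * A" using A by simp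
    also have "\<dots> = (3 + 1 / (1 - 2 powr (p - 2))) * A powr (2 / p - 1)"
      using A True by (simp add: powr_minus)
    finally show ?thesis .
  next
    case False
    show ?thesis
      using p False F G
      by (intro bilinear_interpolation[OF finite_box_index A _ _ K1 K2]) auto
  qed
  then show ?thesis unfolding form cnj A_def .
qed

end

subsection \<open>Functional calculus of the box Laplacian\<close>

text \<open>sin (a + b) + sin (a - b) - 2 sin a = -4 sin^2 (b/2) sin a. The condition on
  \<open>m\<close> makes \<open>m - 1\<close> a true predecessor.\<close>

lemma sine_vec_second_difference:
  assumes "0 < L" "1 \<le> m"
  shows "sine_vec L k (Suc m) + sine_vec L k (m - 1) - 2 * sine_vec L k m
     = - (4 * (sin (real k * (pi / (2 * real L))))\<^sup>2) * sine_vec L k m"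
proof -
  define a where "a = real k * (pi * real m / real L)"
  define b where "b = real k * (pi / real L)"
  define s where "s = sin (real k * (pi / (2 * real L)))"
  have e1: "real k * (pi * real (Suc m) / real L) = a + b"
    by (simp add: a_def b_def add_divide_distrib distrib_left)
  have e2: "real k * (pi * real (m - 1) / real L) = a - b"
    using assms by (simp add: a_def b_def of_nat_diff diff_divide_distrib right_diff_distrib)
  have cb: "cos b = 1 - 2 * s\<^sup>2"
  proof -
    have "b = 2 * (real k * (pi / (2 * real L)))" by (simp add: b_def)
    then show ?thesis by (simp only: cos_double_sin s_def)
  qed
  show ?thesis
    unfolding sine_vec_def e1 e2 sin_add sin_diff cb a_def [symmetric] s_def [symmetric]
    by (simp add: algebra_simps)
qed

lemma sine_vec_boundary: "sine_vec L k 0 = 0" "sine_vec L k L = 0"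
  by (cases "L = 0"; simp add: sine_vec_def sin_npi)+

section \<open>The box as a grid of multi-indices\<close>

context dirichlet_box
begin

text \<open>Indices run from 0 at the lower face to L at the upper one; the shift is right because h
  K = pi, so the faces at distance pi R from the origin carry lattice points.\<close>

definition grid :: "('d::finite \<Rightarrow> nat) \<Rightarrow> real ^ 'd" where
  "grid m = (\<chi> j. h * (real (m j) - real (K * R)))"

definition box_interior :: "(real ^ 'd::finite) set" where
  "box_interior = lattice_box h R - box_boundary h R"

lemma grid_nth: "grid m $ j = h * (real (m j) - real (K * R))"
  by (simp add: grid_def)

lemma h_KR: "h * real (K * R) = pi * real R"
proof -
  have "h * real (K * R) = (real K * h) * real R" by simp
  then show ?thesis by (simp only: Kh)
qed

lemma inj_grid: "inj grid"
  using h by (auto simp: inj_def grid_def vec_eq_iff)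

lemma lattice_box_eq: "lattice_box h R = grid ` {m :: 'd::finite \<Rightarrow> nat. \<forall>j. m j \<le> L}"
proof (intro set_eqI iffI)
  fix x :: "real ^ 'd" assume x: "x \<in> lattice_box h R"
  have "\<exists>n::nat. n \<le> L \<and> x $ j = h * (real n - real (K * R))" for j
  proof -
    obtain i :: int where i: "x $ j = h * of_int i" using x by (auto simp: lattice_box_def)
    have "- pi * real R \<le> x $ j" "x $ j \<le> pi * real R" using x by (auto simp: lattice_box_def)
    then have "h * (- real (K * R)) \<le> h * of_int i" "h * of_int i \<le> h * real (K * R)"
      using i h_KR by (simp_all only: mult_minus_right mult_minus_left)
    then have "- real (K * R) \<le> of_int i" "of_int i \<le> real (K * R)"
      using h by (simp_all only: mult_le_cancel_left_pos)
    then have "- int (K * R) \<le> i" "i \<le> int (K * R)"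
      by (metis of_int_le_iff of_int_minus of_int_of_nat_eq)+
    then have "nat (i + int (K * R)) \<le> L" "real (nat (i + int (K * R))) - real (K * R) = of_int i"
      by (auto simp: L_def nat_le_iff)
    then show ?thesis using i by metis
  qed
  then obtain m where "\<And>j. m j \<le> L \<and> x $ j = h * (real (m j) - real (K * R))" by metis
  then show "x \<in> grid ` {m. \<forall>j. m j \<le> L}"
    by (intro image_eqI[of _ _ m]) (auto simp: grid_def vec_eq_iff)
next
  fix x :: "real ^ 'd" assume "x \<in> grid ` {m. \<forall>j. m j \<le> L}"
  then obtain m where m: "x = grid m" "\<And>j. m j \<le> L" by auto
  have "x $ j = h * of_int (int (m j) - int (K * R))" for j by (simp add: m grid_nth)
  moreover have "- pi * real R \<le> x $ j \<and> x $ j \<le> pi * real R" for j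
  proof -
    have "h * (- real (K * R)) \<le> h * (real (m j) - real (K * R))"
      using h by (intro mult_left_mono) auto
    moreover have "h * (real (m j) - real (K * R)) \<le> h * real (K * R)"
    proof (intro mult_left_mono)
      have "real (m j) \<le> real L" using m(2) by simp
      also have "\<dots> = 2 * real (K * R)" by (simp add: L_def)
      finally show "real (m j) - real (K * R) \<le> real (K * R)" by linarith
    qed (use h in simp)
    ultimately show ?thesis
      unfolding m(1) grid_nth by (simp only: h_KR mult_minus_right mult_minus_left)
  qed
  ultimately show "x \<in> lattice_box h R" unfolding lattice_box_def by blast
qed

lemma grid_boundary_iff:
  "grid m $ j = pi * real R \<or> grid m $ j = - pi * real R \<longleftrightarrow> m j = L \<or> m j = 0"
proof -
  have L2: "real L = 2 * real (K * R)" by (simp add: L_def)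
  have pR: "pi * real R = h * real (K * R)" by (rule h_KR [symmetric])
  have "grid m $ j = pi * real R \<longleftrightarrow> real (m j) - real (K * R) = real (K * R)"
    unfolding pR grid_nth using h by (simp only: mult_cancel_left) auto
  moreover have "grid m $ j = - pi * real R \<longleftrightarrow> real (m j) - real (K * R) = - real (K * R)"
  proof -
    have "- pi * real R = h * (- real (K * R))" by (simp only: pR mult_minus_right mult_minus_left)
    then show ?thesis unfolding grid_nth using h by (simp only: mult_cancel_left) auto
  qed
  ultimately have "grid m $ j = pi * real R \<or> grid m $ j = - pi * real R \<longleftrightarrow> real (m j) = real L \<or> real (m j) = 0"
    unfolding L2 by linarith
  then show ?thesis by simp
qed

lemma box_interior_eq: "box_interior = grid ` (box_index L :: ('d::finite \<Rightarrow> nat) set)"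
proof (intro set_eqI iffI)
  fix x :: "real ^ 'd" assume "x \<in> box_interior"
  then obtain m where m: "x = grid m" "\<And>j. m j \<le> L" and nb: "x \<notin> box_boundary h R"
    by (auto simp: box_interior_def lattice_box_eq)
  have xL: "x \<in> lattice_box h R" using m by (auto simp: lattice_box_eq)
  have "m j \<noteq> L \<and> m j \<noteq> 0" for j
  proof -
    have "\<not> (x $ j = pi * real R \<or> x $ j = - pi * real R)"
      using nb xL unfolding box_boundary_def by blast
    then show ?thesis unfolding m(1) grid_boundary_iff by simp
  qed
  then have "1 \<le> m j \<and> m j < L" for j
    using m(2)[of j] by (metis One_nat_def Suc_leI le_neq_implies_less neq0_conv)
  then have "m \<in> box_index L" by (simp add: box_index_iff)
  then show "x \<in> grid ` box_index L" using m by blast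
next
  fix x :: "real ^ 'd" assume "x \<in> grid ` box_index L"
  then obtain m where m: "x = grid m" "m \<in> box_index L" by auto
  then have mj: "0 < m j" "m j < L" for j by (auto simp: box_index_iff Suc_le_eq)
  have "x \<in> lattice_box h R" using m mj by (auto simp: lattice_box_eq less_imp_le)
  moreover have "x \<notin> box_boundary h R"
  proof
    assume "x \<in> box_boundary h R"
    then obtain j where "grid m $ j = pi * real R \<or> grid m $ j = - pi * real R"
      by (auto simp: box_boundary_def m(1))
    then have "m j = L \<or> m j = 0" by (simp only: grid_boundary_iff)
    then show False using mj[of j] by simp
  qed
  ultimately show "x \<in> box_interior" by (simp add: box_interior_def)
qed

lemma finite_lattice_box: "finite (lattice_box h R :: (real ^ 'd::finite) set)"
proof -
  have "{m :: 'd \<Rightarrow> nat. \<forall>j. m j \<le> L} = PiE UNIV (\<lambda>_. {..L})" by (auto simp: PiE_UNIV_domain)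
  then show ?thesis unfolding lattice_box_eq by (simp add: finite_PiE)
qed

lemma sum_lattice_box:
  fixes F :: "real ^ 'd::finite \<Rightarrow> 'b::comm_monoid_add"
  assumes "\<And>x. x \<notin> box_interior \<Longrightarrow> F x = 0"
  shows "(\<Sum>x\<in>lattice_box h R. F x) = (\<Sum>m\<in>box_index L. F (grid m))"
proof -
  have "(\<Sum>x\<in>lattice_box h R. F x) = (\<Sum>x\<in>box_interior. F x)"
    using assms finite_lattice_box by (intro sum.mono_neutral_right) (auto simp: box_interior_def)
  also have "\<dots> = (\<Sum>m\<in>box_index L. F (grid m))"
    unfolding box_interior_eq using inj_grid by (subst sum.reindex) (auto simp: inj_on_def inj_def)
  finally show ?thesis .
qed

lemma dirichlet_space_iff: "f \<in> dirichlet_space h R \<longleftrightarrow> (\<forall>x. x \<notin> box_interior \<longrightarrow> f x = 0)"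
  by (simp add: dirichlet_space_def box_interior_def)

lemma dirichlet_eqI:
  assumes "f \<in> dirichlet_space h R" "g \<in> dirichlet_space h R"
    and "\<And>m. m \<in> box_index L \<Longrightarrow> f (grid m) = g (grid m)"
  shows "f = g"
proof
  fix x
  show "f x = g x" using assms by (cases "x \<in> box_interior") (auto simp: dirichlet_space_iff box_interior_eq)
qed

definition mode :: "('d::finite \<Rightarrow> nat) \<Rightarrow> real ^ 'd \<Rightarrow> real" where
  "mode k x = (if x \<in> box_interior then sine_basis L k (inv grid x) else 0)"

text \<open>Includes the boundary, where the sine vanishes just as the extension by zero does. This
  is needed because neighbours of interior points may be boundary points when the Laplacian is
  evaluated.\<close>

lemma mode_grid:
  fixes m :: "'d::finite \<Rightarrow> nat"
  assumes "\<And>j. m j \<le> L"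
  shows "mode k (grid m) = sine_basis L k m"
proof (cases "m \<in> box_index L")
  case True
  then show ?thesis by (simp add: mode_def box_interior_eq inv_f_f[OF inj_grid])
next
  case False
  then have "grid m \<notin> box_interior" using inj_grid by (auto simp: box_interior_eq inj_def)
  moreover obtain j where "m j = 0 \<or> m j = L"
    using False assms by (auto simp: box_index_iff not_le not_less less_Suc_eq_le intro: antisym)
  then have "sine_vec L (k j) (m j) = 0" by (auto simp: sine_vec_boundary)
  then have "sine_basis L k m = 0"
    unfolding sine_basis_def by (intro prod_zero bexI[of _ j]) auto
  ultimately show ?thesis by (simp add: mode_def)
qed

lemma mode_grid_index: "m \<in> box_index L \<Longrightarrow> mode k (grid m) = sine_basis L k m"
  by (rule mode_grid) (auto simp: box_index_iff less_imp_le)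

definition synth :: "(('d::finite \<Rightarrow> nat) \<Rightarrow> complex) \<Rightarrow> real ^ 'd \<Rightarrow> complex" where
  "synth c x = (\<Sum>k\<in>box_index L. c k * of_real (mode k x))"

definition dcoef :: "(real ^ 'd::finite \<Rightarrow> complex) \<Rightarrow> ('d \<Rightarrow> nat) \<Rightarrow> complex" where
  "dcoef f = sb.coef L (\<lambda>m. f (grid m))"

lemma synth_dirichlet: "synth c \<in> dirichlet_space h R"
  by (simp add: dirichlet_space_iff synth_def mode_def)

lemma synth_grid: "m \<in> box_index L \<Longrightarrow> synth c (grid m) = (\<Sum>k\<in>box_index L. c k * of_real (sine_basis L k m))"
  by (simp add: synth_def mode_grid_index)

lemma synth_cong:
  assumes "\<And>k. k \<in> box_index L \<Longrightarrow> c k = c' k"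
  shows "synth c = synth c'"
  by (rule ext) (simp add: synth_def assms)

lemma dcoef_synth: "k \<in> box_index L \<Longrightarrow> dcoef (synth c) k = c k"
proof -
  assume k: "k \<in> box_index L"
  have "dcoef (synth c) k = sb.coef L (\<lambda>m. \<Sum>k'\<in>box_index L. c k' * of_real (sine_basis L k' m)) k"
    unfolding dcoef_def sb.coef_def by (intro sum.cong refl) (simp add: synth_grid)
  then show ?thesis by (simp only: sb.coef_synthesis[OF k])
qed

lemma synth_dcoef: "f \<in> dirichlet_space h R \<Longrightarrow> synth (dcoef f) = f"
  by (rule dirichlet_eqI) (auto simp: synth_dirichlet synth_grid dcoef_def sb.synthesis_coef)

section \<open>Diagonalisation of the Laplacian and its functional calculus\<close>

lemma laplacian_mode:
  fixes m :: "'d::finite \<Rightarrow> nat"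
  assumes m: "m \<in> box_index L"
  shows "(\<Sum>j\<in>UNIV. mode k (grid m + h *\<^sub>R axis j 1) + mode k (grid m - h *\<^sub>R axis j 1) - 2 * mode k (grid m))
      = - h\<^sup>2 * symbol k * mode k (grid m)"
proof -
  have mj: "0 < m j" "m j < L" for j using m by (auto simp: box_index_iff Suc_le_eq)
  have "mode k (grid m + h *\<^sub>R axis j 1) + mode k (grid m - h *\<^sub>R axis j 1) - 2 * mode k (grid m)
      = - h\<^sup>2 * freq (k j) * sine_basis L k m" for j
  proof -
    define m1 where "m1 = m(j := Suc (m j))"
    define m2 where "m2 = m(j := m j - 1)"
    define Q where "Q = (\<Prod>i\<in>UNIV - {j}. sine_vec L (k i) (m i))"
    have upd: "sine_basis L k (m(j := n)) = sine_vec L (k j) n * Q" for n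
      unfolding sine_basis_def Q_def
      by (subst prod.remove[of _ j]) (auto intro!: prod.cong)
    have g1: "grid m + h *\<^sub>R axis j 1 = grid m1" and g2: "grid m - h *\<^sub>R axis j 1 = grid m2"
      using mj(1)[of j] by (auto simp: vec_eq_iff grid_nth m1_def m2_def axis_def of_nat_diff algebra_simps)
    have "mode k (grid m1) = sine_basis L k m1" "mode k (grid m2) = sine_basis L k m2"
      using mj by (auto simp: m1_def m2_def Suc_le_eq less_imp_le intro!: mode_grid le_trans[OF diff_le_self])
    moreover have "sine_basis L k m = sine_vec L (k j) (m j) * Q" using upd[of "m j"] by simp
    ultimately have "mode k (grid m + h *\<^sub>R axis j 1) + mode k (grid m - h *\<^sub>R axis j 1) - 2 * mode k (grid m)
      = (sine_vec L (k j) (Suc (m j)) + sine_vec L (k j) (m j - 1) - 2 * sine_vec L (k j) (m j)) * Q"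
      unfolding g1 g2 mode_grid_index[OF m] m1_def m2_def by (simp add: upd algebra_simps)
    also have "\<dots> = - h\<^sup>2 * freq (k j) * sine_basis L k m"
      using sine_vec_second_difference[OF L_pos, of "m j" "k j"] mj(1)[of j] h upd[of "m j"]
      by (simp add: freq_def \<theta>_eq)
    finally show ?thesis .
  qed
  then show ?thesis
    by (simp add: symbol_def sum_distrib_left sum_distrib_right mode_grid_index[OF m] sum_negf)
qed

lemma laplacian_synth:
  fixes c :: "('d::finite \<Rightarrow> nat) \<Rightarrow> complex"
  shows "discrete_laplacian h R (synth c) = synth (\<lambda>k. - of_real (symbol k) * c k)"
proof
  fix x :: "real ^ 'd"
  show "discrete_laplacian h R (synth c) x = synth (\<lambda>k. - of_real (symbol k) * c k) x"
  proof (cases "x \<in> box_interior")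
    case False
    then show ?thesis
      by (simp add: discrete_laplacian_def synth_def mode_def flip: box_interior_def)
  next
    case True
    then obtain m where m: "m \<in> box_index L" "x = grid m" by (auto simp: box_interior_eq)
    have "(\<Sum>j\<in>UNIV. synth c (x + h *\<^sub>R axis j 1) + synth c (x - h *\<^sub>R axis j 1) - 2 * synth c x)
      = (\<Sum>j\<in>UNIV. \<Sum>k\<in>box_index L. c k * of_real (mode k (x + h *\<^sub>R axis j 1) + mode k (x - h *\<^sub>R axis j 1) - 2 * mode k x))"
      unfolding synth_def
      by (simp add: sum.distrib sum_subtractf sum_distrib_left algebra_simps)
    also have "\<dots> = (\<Sum>k\<in>box_index L. c k * of_real (\<Sum>j\<in>UNIV. mode k (x + h *\<^sub>R axis j 1) + mode k (x - h *\<^sub>R axis j 1) - 2 * mode k x))"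
      unfolding of_real_sum sum_distrib_left by (rule sum.swap)
    also have "\<dots> = (\<Sum>k\<in>box_index L. c k * of_real (- h\<^sup>2 * symbol k * mode k x))"
      by (simp only: m(2) laplacian_mode[OF m(1)])
    also have "\<dots> = of_real (h\<^sup>2) * synth (\<lambda>k. - of_real (symbol k) * c k) x"
      unfolding synth_def sum_distrib_left by (intro sum.cong refl) (simp add: mult_ac)
    finally show ?thesis
      using True h by (simp add: discrete_laplacian_def flip: box_interior_def)
  qed
qed

text \<open>Coefficients determine a function, so the eigenvalue equation can be compared mode by
  mode. Several modes may share an eigenvalue.\<close>

lemma eigenspace_iff:
  fixes f :: "real ^ 'd::finite \<Rightarrow> complex"
  assumes f: "f \<in> dirichlet_space h R"
  shows "f \<in> laplacian_eigenspace h R l \<longleftrightarrow> (\<forall>k\<in>box_index L. dcoef f k \<noteq> 0 \<longrightarrow> - symbol k = l)"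
proof -
  have L: "discrete_laplacian h R f = synth (\<lambda>k. - of_real (symbol k) * dcoef f k)"
    using laplacian_synth[of "dcoef f"] by (simp add: synth_dcoef[OF f])
  have R: "(\<lambda>x. of_real l * f x) = synth (\<lambda>k. of_real l * dcoef f k)"
  proof -
    have "(\<lambda>x. of_real l * f x) = (\<lambda>x. of_real l * synth (dcoef f) x)" by (simp add: synth_dcoef[OF f])
    also have "\<dots> = synth (\<lambda>k. of_real l * dcoef f k)"
      by (rule ext) (simp only: synth_def sum_distrib_left mult.assoc)
    finally show ?thesis .
  qed
  have "f \<in> laplacian_eigenspace h R l \<longleftrightarrow> discrete_laplacian h R f = (\<lambda>x. of_real l * f x)"
    using f by (auto simp: laplacian_eigenspace_def)
  also have "\<dots> \<longleftrightarrow> (\<forall>k\<in>box_index L. - of_real (symbol k) * dcoef f k = of_real l * dcoef f k)"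
    unfolding L R
  proof
    assume "synth (\<lambda>k. - of_real (symbol k) * dcoef f k) = synth (\<lambda>k. of_real l * dcoef f k)"
    then show "\<forall>k\<in>box_index L. - of_real (symbol k) * dcoef f k = of_real l * dcoef f k"
      by (metis (no_types, lifting) dcoef_synth)
  qed (blast intro: synth_cong)
  also have "\<dots> \<longleftrightarrow> (\<forall>k\<in>box_index L. dcoef f k \<noteq> 0 \<longrightarrow> - symbol k = l)"
  proof (intro ball_cong refl)
    fix k :: "'d \<Rightarrow> nat"
    have "- of_real (symbol k) = (of_real l :: complex) \<longleftrightarrow> - symbol k = l"
      by (metis of_real_eq_iff of_real_minus)
    then show "(- of_real (symbol k) * dcoef f k = of_real l * dcoef f k) \<longleftrightarrow> (dcoef f k \<noteq> 0 \<longrightarrow> - symbol k = l)"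
      by (simp only: mult_cancel_right) blast
  qed
  finally show ?thesis .
qed

lemma box_inner_eq:
  assumes "f \<in> dirichlet_space h R"
  shows "box_inner h R f g = of_real (h ^ CARD('d)) * (\<Sum>k\<in>box_index L. dcoef f k * cnj (dcoef (g :: real ^ 'd::finite \<Rightarrow> complex) k))"
proof -
  have "(\<Sum>x\<in>lattice_box h R. f x * cnj (g x)) = (\<Sum>m\<in>box_index L. f (grid m) * cnj (g (grid m)))"
    using assms by (intro sum_lattice_box) (simp add: dirichlet_space_iff)
  then show ?thesis by (simp add: box_inner_def dcoef_def sb.parseval)
qed

lemma dcoef_diff: "dcoef (\<lambda>x. f x - g x) k = dcoef f k - dcoef g k"
  by (simp add: dcoef_def sb.coef_def right_diff_distrib sum_subtractf)

lemma dirichlet_diff: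
  "f \<in> dirichlet_space h R \<Longrightarrow> g \<in> dirichlet_space h R \<Longrightarrow> (\<lambda>x. f x - g x) \<in> dirichlet_space h R"
  by (simp add: dirichlet_space_iff)

text \<open>The \<open>THE\<close> needs uniqueness: the difference of two candidates lies in the
  eigenspace and is orthogonal to it, hence to itself, and Parseval makes its coefficients
  vanish.\<close>

lemma eigenprojection_eq:
  fixes f :: "real ^ 'd::finite \<Rightarrow> complex"
  assumes f: "f \<in> dirichlet_space h R"
  shows "eigenprojection h R l f = synth (\<lambda>k. if - symbol k = l then dcoef f k else 0)" (is "_ = ?g")
proof -
  have hd: "(of_real (h ^ CARD('d)) :: complex) \<noteq> 0" using h by simp
  have g: "?g \<in> laplacian_eigenspace h R l"
    by (subst eigenspace_iff[OF synth_dirichlet]) (auto simp: dcoef_synth split: if_splits)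
  have E: "laplacian_eigenspace h R l \<subseteq> (dirichlet_space h R :: (real ^ 'd \<Rightarrow> complex) set)"
    by (auto simp: laplacian_eigenspace_def)
  have orth: "box_inner h R (\<lambda>x. f x - ?g x) e = 0" if e: "e \<in> laplacian_eigenspace h R l" for e
  proof -
    have "(\<Sum>k\<in>box_index L. dcoef (\<lambda>x. f x - ?g x) k * cnj (dcoef e k)) = 0"
    proof (rule sum.neutral, rule ballI)
      fix k :: "'d \<Rightarrow> nat" assume k: "k \<in> box_index L"
      show "dcoef (\<lambda>x. f x - ?g x) k * cnj (dcoef e k) = 0"
        using eigenspace_iff[of e l] e E k by (auto simp: dcoef_diff dcoef_synth)
    qed
    then show ?thesis using box_inner_eq[OF dirichlet_diff[OF f synth_dirichlet]] by simp
  qed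
  show ?thesis unfolding eigenprojection_def
  proof (rule the_equality)
    show "?g \<in> laplacian_eigenspace h R l \<and> (\<forall>e\<in>laplacian_eigenspace h R l. box_inner h R (\<lambda>x. f x - ?g x) e = 0)"
      using g orth by blast
  next
    fix g' assume g': "g' \<in> laplacian_eigenspace h R l \<and> (\<forall>e\<in>laplacian_eigenspace h R l. box_inner h R (\<lambda>x. f x - g' x) e = 0)"
    then have g'D: "g' \<in> dirichlet_space h R" using E by blast
    let ?d = "\<lambda>x. g' x - ?g x"
    have d: "?d \<in> dirichlet_space h R" by (rule dirichlet_diff[OF g'D synth_dirichlet])
    have dE: "?d \<in> laplacian_eigenspace h R l"
    proof (subst eigenspace_iff[OF d], intro ballI impI)
      fix k assume k: "k \<in> box_index L" and "dcoef ?d k \<noteq> 0"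
      then have "dcoef g' k \<noteq> 0 \<or> dcoef ?g k \<noteq> 0" by (auto simp: dcoef_diff)
      then show "- symbol k = l"
        using g' eigenspace_iff[OF g'D, of l] k dcoef_synth[OF k] by (auto split: if_splits)
    qed
    have "box_inner h R (\<lambda>x. f x - ?g x) ?d = 0" "box_inner h R (\<lambda>x. f x - g' x) ?d = 0"
      using orth dE g' by blast+
    then have "(\<Sum>k\<in>box_index L. dcoef (\<lambda>x. f x - ?g x) k * cnj (dcoef ?d k)) = 0"
        "(\<Sum>k\<in>box_index L. dcoef (\<lambda>x. f x - g' x) k * cnj (dcoef ?d k)) = 0"
      using box_inner_eq[OF dirichlet_diff[OF f synth_dirichlet]] box_inner_eq[OF dirichlet_diff[OF f g'D]] hd
      by simp_all
    then have "(\<Sum>k\<in>box_index L. dcoef ?d k * cnj (dcoef ?d k)) = 0"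
      by (simp add: dcoef_diff left_diff_distrib sum_subtractf)
    then have "complex_of_real (\<Sum>k\<in>box_index L. (cmod (dcoef ?d k))\<^sup>2) = of_real 0"
      by (simp only: of_real_sum complex_norm_square of_real_0)
    then have "(\<Sum>k\<in>box_index L. (cmod (dcoef ?d k))\<^sup>2) = 0" by (simp only: of_real_eq_iff)
    then have "\<forall>k\<in>box_index L. dcoef ?d k = 0"
      by (subst (asm) sum_nonneg_eq_0_iff) (auto simp: finite_box_index)
    then have "synth (dcoef ?d) = synth (\<lambda>k. 0)" by (intro synth_cong) blast
    moreover have "synth (dcoef ?d) = ?d" by (rule synth_dcoef[OF d])
    moreover have "synth (\<lambda>k. 0) = (\<lambda>x :: real ^ 'd. 0)" by (rule ext) (simp add: synth_def)
    ultimately have "?d = (\<lambda>x. 0)" by (simp only:)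
    then show "g' = ?g" by (simp add: fun_eq_iff)
  qed
qed

lemma spectrum_eq: "laplacian_spectrum TYPE('d::finite) h R = (\<lambda>k. - symbol k) ` (box_index L :: ('d \<Rightarrow> nat) set)"
proof (intro set_eqI iffI)
  fix l assume "l \<in> laplacian_spectrum TYPE('d) h R"
  then obtain f :: "real ^ 'd \<Rightarrow> complex" where f: "f \<in> laplacian_eigenspace h R l" "f \<noteq> (\<lambda>x. 0)"
    by (auto simp: laplacian_spectrum_def)
  then have fD: "f \<in> dirichlet_space h R" by (simp add: laplacian_eigenspace_def)
  have "\<exists>k\<in>box_index L. dcoef f k \<noteq> 0"
  proof (rule ccontr)
    assume "\<not> ?thesis"
    then have "synth (dcoef f) = (\<lambda>x. 0)" by (simp add: synth_def fun_eq_iff)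
    then show False using f(2) by (simp add: synth_dcoef[OF fD])
  qed
  then show "l \<in> (\<lambda>k. - symbol k) ` (box_index L :: ('d \<Rightarrow> nat) set)"
    using f(1) eigenspace_iff[OF fD] by (metis image_eqI)
next
  fix l assume "l \<in> (\<lambda>k. - symbol k) ` (box_index L :: ('d \<Rightarrow> nat) set)"
  then obtain k0 :: "'d \<Rightarrow> nat" where k0: "k0 \<in> box_index L" "l = - symbol k0" by auto
  let ?f = "synth (\<lambda>k. if k = k0 then 1 else 0)"
  have "?f \<in> laplacian_eigenspace h R l"
    using k0 by (subst eigenspace_iff[OF synth_dirichlet]) (auto simp: dcoef_synth)
  moreover have "?f \<noteq> (\<lambda>x. 0)"
  proof
    assume "?f = (\<lambda>x. 0)"
    then have "dcoef ?f k0 = 0" by (simp add: dcoef_def sb.coef_def)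
    then show False using k0 by (simp add: dcoef_synth)
  qed
  ultimately show "l \<in> laplacian_spectrum TYPE('d) h R"
    unfolding laplacian_spectrum_def by blast
qed

text \<open>The defining sum runs over distinct eigenvalues; grouping the modes by
  \<open>- symbol k\<close> turns it into a sum over modes, whatever the multiplicities.\<close>

lemma calculus_eq:
  fixes f :: "real ^ 'd::finite \<Rightarrow> complex"
  assumes f: "f \<in> dirichlet_space h R"
  shows "laplacian_calculus h R \<phi> f = synth (\<lambda>k. \<phi> (- symbol k) * dcoef f k)"
proof
  fix x :: "real ^ 'd"
  let ?B = "box_index L :: ('d \<Rightarrow> nat) set"
  have "laplacian_calculus h R \<phi> f x
     = (\<Sum>l\<in>(\<lambda>k. - symbol k) ` ?B. \<phi> l * (\<Sum>k\<in>?B. (if - symbol k = l then dcoef f k else 0) * of_real (mode k x)))"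
    unfolding laplacian_calculus_def spectrum_eq eigenprojection_eq[OF f] by (simp only: synth_def)
  also have "\<dots> = (\<Sum>l\<in>(\<lambda>k. - symbol k) ` ?B. \<Sum>k\<in>{k\<in>?B. - symbol k = l}. \<phi> (- symbol k) * dcoef f k * of_real (mode k x))"
    unfolding sum_distrib_left
    by (intro sum.cong refl sum.mono_neutral_cong_right) (auto simp: finite_box_index)
  also have "\<dots> = (\<Sum>k\<in>?B. \<phi> (- symbol k) * dcoef f k * of_real (mode k x))"
    by (intro sum.group) (auto simp: finite_box_index)
  finally show "laplacian_calculus h R \<phi> f x = synth (\<lambda>k. \<phi> (- symbol k) * dcoef f k) x"
    by (simp add: synth_def)
qed

end

subsection \<open>Duality, time averages and the sum over frequencies\<close>

text \<open>The unweighted norm over indices; \<open>box_Lp_norm_eq\<close> restores the powers of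
  h.\<close>

definition lnorm :: "ereal \<Rightarrow> 'a set \<Rightarrow> ('a \<Rightarrow> complex) \<Rightarrow> real" where
  "lnorm r A v = (if r = \<infinity> then Max ((\<lambda>x. cmod (v x)) ` A)
     else (\<Sum>x\<in>A. cmod (v x) powr real_of_ereal r) powr (1 / real_of_ereal r))"

definition conjugate_exponent :: "ereal \<Rightarrow> real" where
  "conjugate_exponent r = (if r = \<infinity> then 1 else real_of_ereal r / (real_of_ereal r - 1))"

lemma lnorm_nonneg:
  assumes "finite A" "A \<noteq> {}"
  shows "0 \<le> lnorm r A v"
  using assms Max_ge_iff[of "(\<lambda>x. cmod (v x)) ` A" 0] by (auto simp: lnorm_def)

text \<open>An extremiser gives equality: for r = \<infinity> a point mass at a maximum, corrected
  by a phase; for finite r the conjugate phase of v times |v|^(r-1), normalised. The pairing is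
  bilinear, hence the conjugation.\<close>

lemma lnorm_dual:
  assumes A: "finite A" "A \<noteq> {}" and r: "1 < r"
  shows "\<exists>G. (\<Sum>x\<in>A. cmod (G x) powr conjugate_exponent r) \<le> 1 \<and> of_real (lnorm r A v) = (\<Sum>x\<in>A. v x * G x)"
proof (cases "r = \<infinity>")
  case True
  have "lnorm r A v \<in> (\<lambda>x. cmod (v x)) ` A"
    unfolding lnorm_def using True A by (simp add: Max_in del: image_eqI)
  then obtain x0 where x0: "x0 \<in> A" "lnorm r A v = cmod (v x0)" by auto
  let ?G = "\<lambda>x. if x = x0 then cnj (sgn (v x0)) else 0"
  have "(\<Sum>x\<in>A. cmod (?G x) powr conjugate_exponent r) = cmod (sgn (v x0))"
  proof -
    have "(\<Sum>x\<in>A. cmod (?G x) powr conjugate_exponent r) = (\<Sum>x\<in>A. if x = x0 then cmod (sgn (v x0)) else 0)"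
      using True by (intro sum.cong) (auto simp: conjugate_exponent_def)
    then show ?thesis using A x0 by simp
  qed
  then have 1: "(\<Sum>x\<in>A. cmod (?G x) powr conjugate_exponent r) \<le> 1" by (simp add: norm_sgn)
  have "(\<Sum>x\<in>A. v x * ?G x) = v x0 * cnj (sgn (v x0))"
    using A x0 by (simp add: if_distrib cong: if_cong)
  also have "\<dots> = of_real (cmod (v x0))"
    by (cases "v x0 = 0") (auto simp: sgn_div_norm scaleR_conv_of_real complex_norm_square[symmetric] power2_eq_square field_simps)
  finally show ?thesis using 1 x0 by (intro exI[of _ ?G]) simp
next
  case False
  then obtain \<rho> where \<rho>: "r = ereal \<rho>" using r by (cases r) auto
  have \<rho>1: "1 < \<rho>" using r by (simp add: \<rho> one_ereal_def)
  define S where "S = (\<Sum>x\<in>A. cmod (v x) powr \<rho>)"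
  have S: "0 \<le> S" by (simp add: S_def sum_nonneg)
  have l: "lnorm r A v = S powr (1 / \<rho>)" by (simp add: lnorm_def \<rho> S_def)
  have p: "conjugate_exponent r = \<rho> / (\<rho> - 1)" by (simp add: conjugate_exponent_def \<rho>)
  show ?thesis
  proof (cases "S = 0")
    case True
    then have "\<forall>x\<in>A. cmod (v x) powr \<rho> = 0"
      unfolding S_def using A by (subst (asm) sum_nonneg_eq_0_iff) auto
    then show ?thesis using True l by (intro exI[of _ "\<lambda>x. 0"]) simp
  next
    case False
    then have S0: "0 < S" using S by simp
    define G where "G x = cnj (sgn (v x)) * of_real (cmod (v x) powr (\<rho> - 1) / S powr (1 - 1 / \<rho>))" for x
    have G1: "cmod (G x) powr (\<rho> / (\<rho> - 1)) = cmod (v x) powr \<rho> / S" for x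
    proof (cases "v x = 0")
      case False
      then have "cmod (G x) = cmod (v x) powr (\<rho> - 1) / S powr (1 - 1 / \<rho>)"
        by (simp add: G_def norm_mult norm_sgn norm_divide)
      moreover have "(1 - 1 / \<rho>) * (\<rho> / (\<rho> - 1)) = 1" using \<rho>1 by (simp add: field_simps)
      ultimately show ?thesis using \<rho>1 S0 by (simp add: powr_divide powr_powr)
    qed (simp add: G_def)
    have "(\<Sum>x\<in>A. cmod (G x) powr conjugate_exponent r) = 1"
      unfolding p G1 sum_divide_distrib[symmetric] using S0 by (simp add: S_def)
    moreover have "(\<Sum>x\<in>A. v x * G x) = of_real (S powr (1 / \<rho>))"
    proof -
      have "v x * G x = of_real (cmod (v x) powr \<rho> / S powr (1 - 1 / \<rho>))" for x
      proof (cases "v x = 0")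
        case False
        have "v x * cnj (sgn (v x)) = of_real (cmod (v x))"
          using False by (auto simp: sgn_div_norm scaleR_conv_of_real complex_norm_square[symmetric] power2_eq_square field_simps)
        then have "v x * G x = of_real (cmod (v x) * (cmod (v x) powr (\<rho> - 1) / S powr (1 - 1 / \<rho>)))"
          by (simp only: G_def of_real_mult mult.assoc [symmetric])
        also have "cmod (v x) * (cmod (v x) powr (\<rho> - 1) / S powr (1 - 1 / \<rho>)) = cmod (v x) powr \<rho> / S powr (1 - 1 / \<rho>)"
          using False by (simp add: powr_diff)
        finally show ?thesis .
      qed simp
      then have "(\<Sum>x\<in>A. v x * G x) = of_real (S / S powr (1 - 1 / \<rho>))"
        by (simp only: S_def of_real_sum [symmetric] sum_divide_distrib)
      also have "S / S powr (1 - 1 / \<rho>) = S powr (1 / \<rho>)"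
        using S0 by (simp add: powr_diff)
      finally show ?thesis .
    qed
    ultimately show ?thesis using l by (intro exI[of _ G]) simp
  qed
qed

lemma borel_measurable_lnorm:
  assumes "finite A" "\<And>x. x \<in> A \<Longrightarrow> (\<lambda>t. v t x) \<in> borel_measurable M"
  shows "(\<lambda>t. lnorm r A (v t)) \<in> borel_measurable M"
  unfolding lnorm_def using assms by (cases "r = \<infinity>") auto

text \<open>The n pieces of [0,1] are translated onto \<open>J 0\<close>, so the integral becomes
  one over the offset of a sum over the grid, and a bound uniform in the offset passes over without
  error. Shared endpoints are harmless in an upper bound.\<close>

lemma nn_integral_unit_interval_le:
  fixes g :: "real \<Rightarrow> real"
  assumes g: "g \<in> borel_measurable borel" "\<And>t. 0 \<le> g t" and n: "0 < n"
    and avg: "\<And>\<tau>. (\<Sum>i<n. g (\<tau> + real i / real n)) / real n \<le> B"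
  shows "(\<integral>\<^sup>+ t. ennreal (g t) \<partial>lebesgue_on {0..1}) \<le> ennreal B"
proof -
  note [measurable] = g(1)
  define J where "J i = {real i / real n..real (Suc i) / real n}" for i
  have "(\<integral>\<^sup>+ t. ennreal (g t) \<partial>lebesgue_on {0..1}) = (\<integral>\<^sup>+ t. ennreal (g t) * indicator {0..1} t \<partial>lebesgue)"
    by (rule nn_integral_restrict_space) simp
  also have "\<dots> = (\<integral>\<^sup>+ t. ennreal (g t) * indicator {0..1} t \<partial>lborel)"
    by (rule nn_integral_completion)
  also have "\<dots> \<le> (\<integral>\<^sup>+ t. (\<Sum>i<n. ennreal (g t) * indicator (J i) t) \<partial>lborel)"
  proof (rule nn_integral_mono)
    fix t :: real
    show "ennreal (g t) * indicator {0..1} t \<le> (\<Sum>i<n. ennreal (g t) * indicator (J i) t)"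
    proof (cases "t \<in> {0..1}")
      case True
      obtain i where i: "i < n" "t \<in> J i"
      proof (cases "t = 1")
        case True
        then show ?thesis using n that[of "n - 1"] by (simp add: J_def of_nat_diff)
      next
        case False
        define i where "i = nat \<lfloor>t * real n\<rfloor>"
        have t: "0 \<le> t * real n" "t * real n < real n" using True False n by auto
        have "real i \<le> t * real n" "t * real n < real i + 1" unfolding i_def using t by linarith+
        then have "real i < real n" using t by linarith
        moreover have "t \<in> J i" using \<open>real i \<le> t * real n\<close> \<open>t * real n < real i + 1\<close> n
          by (auto simp: J_def field_simps)
        ultimately have "i < n" "t \<in> J i" by simp_all
        then show ?thesis using that by blast
      qed
      have "ennreal (g t) * indicator {0..1} t = ennreal (g t) * indicator (J i) t" using True i by simp
      also have "\<dots> \<le> (\<Sum>i<n. ennreal (g t) * indicator (J i) t)" using i by (intro member_le_sum) auto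
      finally show ?thesis .
    qed simp
  qed
  also have "\<dots> = (\<Sum>i<n. \<integral>\<^sup>+ t. ennreal (g t) * indicator (J i) t \<partial>lborel)"
    by (intro nn_integral_sum) (auto simp: J_def)
  also have "\<dots> = (\<Sum>i<n. \<integral>\<^sup>+ \<tau>. ennreal (g (\<tau> + real i / real n)) * indicator (J 0) \<tau> \<partial>lborel)"
  proof (rule sum.cong[OF refl])
    fix i
    have "(\<integral>\<^sup>+ t. ennreal (g t) * indicator (J i) t \<partial>lborel)
       = (\<integral>\<^sup>+ \<tau>. ennreal (g (real i / real n + 1 * \<tau>)) * indicator (J i) (real i / real n + 1 * \<tau>) \<partial>lborel)"
      by (subst nn_integral_real_affine[where c=1 and t="real i / real n"]) (auto simp: J_def)
    also have "\<dots> = (\<integral>\<^sup>+ \<tau>. ennreal (g (\<tau> + real i / real n)) * indicator (J 0) \<tau> \<partial>lborel)"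
      using n by (intro nn_integral_cong) (auto simp: J_def indicator_def add.commute add_divide_distrib)
    finally show "(\<integral>\<^sup>+ t. ennreal (g t) * indicator (J i) t \<partial>lborel)
       = (\<integral>\<^sup>+ \<tau>. ennreal (g (\<tau> + real i / real n)) * indicator (J 0) \<tau> \<partial>lborel)" .
  qed
  also have "\<dots> = (\<integral>\<^sup>+ \<tau>. (\<Sum>i<n. ennreal (g (\<tau> + real i / real n)) * indicator (J 0) \<tau>) \<partial>lborel)"
    by (intro nn_integral_sum [symmetric]) (auto simp: J_def)
  also have "\<dots> \<le> (\<integral>\<^sup>+ \<tau>. ennreal (real n * B) * indicator (J 0) \<tau> \<partial>lborel)"
  proof (rule nn_integral_mono)
    fix \<tau> :: real
    have "(\<Sum>i<n. ennreal (g (\<tau> + real i / real n))) = ennreal (\<Sum>i<n. g (\<tau> + real i / real n))"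
      using g(2) by (intro sum_ennreal) auto
    also have "\<dots> \<le> ennreal (real n * B)"
      using avg[of \<tau>] n by (intro ennreal_leI) (simp add: divide_le_eq mult.commute)
    finally show "(\<Sum>i<n. ennreal (g (\<tau> + real i / real n)) * indicator (J 0) \<tau>) \<le> ennreal (real n * B) * indicator (J 0) \<tau>"
      by (simp add: sum_distrib_right [symmetric] mult_right_mono)
  qed
  also have "\<dots> = ennreal (real n * B) * emeasure lborel (J 0)"
    by (intro nn_integral_cmult_indicator) (simp add: J_def)
  also have "emeasure lborel (J 0) = ennreal (1 / real n)"
    using n by (simp add: J_def)
  also have "ennreal (real n * B) * ennreal (1 / real n) = ennreal B"
  proof -
    have "0 \<le> B" using avg[of 0] g(2) by (meson divide_nonneg_nonneg of_nat_0_le_iff order_trans sum_nonneg)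
    then show ?thesis using n by (simp flip: ennreal_mult)
  qed
  finally show ?thesis .
qed

lemma unit_time_norm_le:
  fixes N :: "real \<Rightarrow> real"
  assumes N: "N \<in> borel_measurable borel" "\<And>t. 0 \<le> N t" and n: "0 < n" and q: "0 < q" and B: "0 \<le> B"
    and avg: "\<And>\<tau>. ((\<Sum>i<n. N (\<tau> + real i / real n) powr q) / real n) powr (1 / q) \<le> B"
  shows "unit_time_norm (ereal q) N \<le> ennreal B"
proof -
  define I where "I = (\<integral>\<^sup>+ t. ennreal (N t powr q) \<partial>lebesgue_on {0..1})"
  have "I \<le> ennreal (B powr q)"
    unfolding I_def
  proof (rule nn_integral_unit_interval_le[OF _ _ n])
    show "(\<lambda>t. N t powr q) \<in> borel_measurable borel" using N(1) by measurable
    show "(\<Sum>i<n. N (\<tau> + real i / real n) powr q) / real n \<le> B powr q" for \<tau>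
    proof -
      let ?x = "(\<Sum>i<n. N (\<tau> + real i / real n) powr q) / real n"
      have "0 \<le> ?x" by (simp add: sum_nonneg)
      then have "?x = ?x powr 1" by (rule powr_one [symmetric])
      also have "\<dots> = (?x powr (1 / q)) powr q" unfolding powr_powr using q by simp
      also have "\<dots> \<le> B powr q" using avg[of \<tau>] q by (intro powr_mono2) auto
      finally show ?thesis .
    qed
  qed simp
  moreover have "ennreal (enn2real I powr (1 / q)) \<le> ennreal B" if "I \<le> ennreal (B powr q)"
  proof (rule ennreal_leI)
    have "enn2real I \<le> B powr q" using that by (metis enn2real_leI powr_ge_zero)
    then have "enn2real I powr (1 / q) \<le> (B powr q) powr (1 / q)" using q by (intro powr_mono2) auto
    then show "enn2real I powr (1 / q) \<le> B" using q B by (simp add: powr_powr)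
  qed
  moreover have "I \<noteq> \<infinity>" using \<open>I \<le> ennreal (B powr q)\<close> by (auto simp: top_unique)
  ultimately show ?thesis by (simp add: unit_time_norm_def Let_def flip: I_def)
qed

section \<open>Dyadic sums over the frequency levels\<close>

lemma dyadic_nat_sum_le:
  fixes \<epsilon> Y :: real
  assumes "0 < \<epsilon>" "0 < Y" "finite J" "\<And>j. j \<in> J \<Longrightarrow> 2 ^ j \<le> Y"
  shows "(\<Sum>j\<in>J. (2 ^ j) powr \<epsilon>) \<le> Y powr \<epsilon> / (1 - 2 powr (-\<epsilon>))"
proof -
  have "(\<Sum>j\<in>J. (2 ^ j :: real) powr \<epsilon>) = (\<Sum>i\<in>int ` J. (2 powi i) powr \<epsilon>)"
    by (subst sum.reindex) auto
  also have "\<dots> \<le> Y powr \<epsilon> / (1 - 2 powr (-\<epsilon>))"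
    using assms by (intro dyadic_sum_le) auto
  finally show ?thesis .
qed

lemma dyadic_nat_sum_decay:
  fixes \<epsilon> :: real
  assumes "0 < \<epsilon>" "finite J"
  shows "(\<Sum>j\<in>J. (2 ^ j) powr (-\<epsilon>)) \<le> 1 / (1 - 2 powr (-\<epsilon>))"
proof -
  have x: "0 < 2 powr (-\<epsilon>)" "2 powr (-\<epsilon>) < 1" using assms by (auto simp: powr_less_one)
  have "(\<Sum>j\<in>J. (2 ^ j :: real) powr (-\<epsilon>)) = (\<Sum>j\<in>J. (2 powr (-\<epsilon>)) ^ j)"
    by (intro sum.cong refl) (simp add: powr_powr mult.commute flip: powr_realpow)
  also have "\<dots> \<le> (\<Sum>j. (2 powr (-\<epsilon>)) ^ j)"
    using x assms by (intro sum_le_suminf summable_geometric) auto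
  also have "\<dots> = 1 / (1 - 2 powr (-\<epsilon>))" using x by (intro suminf_geometric) auto
  finally show ?thesis .
qed

lemma add_one_powr_le:
  fixes x e :: real
  assumes "0 \<le> x" "0 < e" "e \<le> 1"
  shows "(x + 1) powr e \<le> 2 * (x powr e + 1)"
proof -
  have "(x + 1) powr e \<le> (2 * max x 1) powr e" using assms by (intro powr_mono2) auto
  also have "\<dots> = 2 powr e * max x 1 powr e" using assms by (simp add: powr_mult)
  also have "\<dots> \<le> 2 * (x powr e + 1)"
  proof (intro mult_mono)
    show "2 powr e \<le> (2::real)" using assms powr_mono[of e 1 2] by simp
    show "max x 1 powr e \<le> x powr e + 1" by (cases "x \<le> 1") (auto simp: max_def)
  qed (use assms in auto)
  finally show ?thesis .
qed

text \<open>For \<open>0 < \<alpha> < 1\<close> the second part of the sum grows with \<open>j\<close> and is dominated by the top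
  frequencies \<open>2 ^ j\<close> comparable to \<open>1 / h\<close>; this is why no loss occurs in the exponent there.\<close>

lemma level_sum_bound:
  fixes \<alpha> c0 s e :: real
  assumes e: "0 < e" "e \<le> 1" and c0: "1 \<le> c0" and \<alpha>: "0 \<le> \<alpha>"
    and s1: "1 \<le> \<alpha> \<Longrightarrow> e < s" and s2: "0 < \<alpha> \<Longrightarrow> \<alpha> < 1 \<Longrightarrow> s = (2 - \<alpha>) * e"
    and s3: "\<alpha> = 0 \<Longrightarrow> 2 * e < s"
  shows "\<exists>C>0. \<forall>h R J. 0 < h \<longrightarrow> h \<le> 1 \<longrightarrow> 1 \<le> R \<longrightarrow> h powr (-\<alpha>) / c0 \<le> R \<longrightarrow> finite J \<longrightarrow>
     (\<forall>j\<in>J. 2 ^ j * h \<le> 4 * pi) \<longrightarrow>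
     (\<Sum>j\<in>J. (2 ^ j) powr (e - s) * (2 ^ j / R + 1) powr e) \<le> C"
proof -
  let ?a = "\<lambda>j :: nat. (2 ^ j :: real) powr (e - s)" and ?b = "\<lambda>R (j :: nat). (2 ^ j / R) powr e"
  have split: "(\<Sum>j\<in>J. ?a j * (2 ^ j / R + 1) powr e)
      \<le> 2 * (\<Sum>j\<in>J. ?a j * ?b R j) + 2 * (\<Sum>j\<in>J. ?a j)"
    if "1 \<le> R" for R :: real and J :: "nat set"
  proof -
    have "(\<Sum>j\<in>J. ?a j * (2 ^ j / R + 1) powr e)
        \<le> (\<Sum>j\<in>J. ?a j * (2 * (?b R j + 1)))"
      using that e by (intro sum_mono mult_left_mono add_one_powr_le) auto
    also have "\<dots> = 2 * (\<Sum>j\<in>J. ?a j * ?b R j) + 2 * (\<Sum>j\<in>J. ?a j)"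
      by (simp add: sum.distrib distrib_left sum_distrib_left mult_ac)
    finally show ?thesis .
  qed
  \<comment> \<open>s exceeds e in every regime, for 0 < \<alpha> < 1 because s - e = (1 - \<alpha>)
    e; hence the part of the sum without R is a convergent geometric series.\<close>
  have es: "e < s" if "\<alpha> < 1"
  proof (cases "\<alpha> = 0")
    case True
    then show ?thesis using s3 e by simp
  next
    case False
    then have "0 < (1 - \<alpha>) * e" using that \<alpha> e by simp
    then show ?thesis using s2 that \<alpha> False by (simp add: algebra_simps)
  qed
  then have es: "e < s" using s1 by (cases "\<alpha> < 1") auto
  define D where "D = 1 / (1 - 2 powr (-(s - e)))"
  have x1: "2 powr (-(s - e)) < 1" using es by (simp add: powr_less_one)
  have D: "0 < D" using x1 by (simp add: D_def)
  have low: "(\<Sum>j\<in>J. ?a j) \<le> D" if "finite J" for J :: "nat set"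
    using dyadic_nat_sum_decay[of "s - e" J] es that by (simp add: D_def)
  consider "1 \<le> \<alpha>" | "\<alpha> = 0" | "0 < \<alpha>" "\<alpha> < 1" using \<alpha> by linarith
  then have "\<exists>C'\<ge>0. \<forall>h R J. 0 < h \<longrightarrow> h \<le> 1 \<longrightarrow> 1 \<le> R \<longrightarrow> h powr (-\<alpha>) / c0 \<le> R \<longrightarrow> finite J \<longrightarrow>
     (\<forall>j\<in>J. 2 ^ j * h \<le> 4 * pi) \<longrightarrow> (\<Sum>j\<in>J. ?a j * ?b R j) \<le> C'"
  proof cases
    case 1
    show ?thesis
    proof (intro exI[of _ "(4 * pi * c0) powr e * D"] conjI allI impI)
      fix h R :: real and J :: "nat set"
      assume h: "0 < h" "h \<le> 1" and R: "1 \<le> R" "h powr (-\<alpha>) / c0 \<le> R" and J: "finite J" "\<forall>j\<in>J. 2 ^ j * h \<le> 4 * pi"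
      have "1 / h \<le> h powr (-\<alpha>)"
        using h 1 powr_mono'[of "-\<alpha>" "-1" h] by (simp add: powr_minus_divide)
      \<comment> \<open>For \<alpha> \<ge> 1 the box is so wide that 2^j / R is bounded on all
        levels.\<close>
      then have "1 / h / c0 \<le> R" using R c0 by (meson divide_right_mono order_trans zero_le_one)
      then have hR: "1 \<le> R * (h * c0)" using h c0 by (simp add: field_simps)
      have "?a j * ?b R j \<le> ?a j * (4 * pi * c0) powr e" if "j \<in> J" for j
      proof (intro mult_left_mono powr_mono2)
        have "2 ^ j * 1 \<le> 2 ^ j * (R * (h * c0))" using hR by (intro mult_left_mono) auto
        also have "\<dots> = (2 ^ j * h) * (R * c0)" by simp
        also have "\<dots> \<le> (4 * pi) * (R * c0)" using J that R c0 by (intro mult_right_mono) auto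
        finally show "2 ^ j / R \<le> 4 * pi * c0" using R by (simp add: divide_le_eq mult_ac)
      qed (use e R in auto)
      then have "(\<Sum>j\<in>J. ?a j * ?b R j) \<le> (\<Sum>j\<in>J. ?a j * (4 * pi * c0) powr e)"
        by (rule sum_mono)
      also have "\<dots> = (4 * pi * c0) powr e * (\<Sum>j\<in>J. ?a j)"
        by (simp add: sum_distrib_left mult.commute)
      also have "\<dots> \<le> (4 * pi * c0) powr e * D" using low[OF J(1)] by (intro mult_left_mono) auto
      finally show "(\<Sum>j\<in>J. ?a j * ?b R j) \<le> (4 * pi * c0) powr e * D" .
    qed (use D in simp)
  next
    case 2
    show ?thesis
    proof (intro exI[of _ "1 / (1 - 2 powr (-(s - 2 * e)))"] conjI allI impI)
      fix h R :: real and J :: "nat set"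
      assume h: "0 < h" "h \<le> 1" and R: "1 \<le> R" "h powr (-\<alpha>) / c0 \<le> R" and J: "finite J" "\<forall>j\<in>J. 2 ^ j * h \<le> 4 * pi"
      have "?a j * ?b R j \<le> (2 ^ j) powr (- (s - 2 * e))" for j
      proof -
        \<comment> \<open>With R only bounded below by 1, a full factor 2^(j e) is lost, which s > 2
          e pays for.\<close>
        have "?b R j \<le> (2 ^ j) powr e" using e R by (intro powr_mono2) (auto simp: divide_le_eq)
        then have "?a j * ?b R j \<le> ?a j * (2 ^ j) powr e"
          by (intro mult_left_mono) auto
        also have "\<dots> = (2 ^ j) powr (- (s - 2 * e))" by (simp only: powr_add [symmetric]) simp
        finally show ?thesis .
      qed
      then have "(\<Sum>j\<in>J. ?a j * ?b R j) \<le> (\<Sum>j\<in>J. (2 ^ j) powr (- (s - 2 * e)))"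
        by (intro sum_mono)
      also have "\<dots> \<le> 1 / (1 - 2 powr (-(s - 2 * e)))"
        using s3[OF 2] J by (intro dyadic_nat_sum_decay) auto
      finally show "(\<Sum>j\<in>J. ?a j * ?b R j) \<le> 1 / (1 - 2 powr (-(s - 2 * e)))" .
    qed (use s3[OF 2] in \<open>simp add: powr_less_one less_imp_le\<close>)
  next
    case 3
    \<comment> \<open>The exponent that remains, (e - s) + e = \<alpha> e, is positive; the lower
      bound for R supplies the compensating factor h^\<epsilon>.\<close>
    define \<epsilon> where "\<epsilon> = \<alpha> * e"
    have \<epsilon>: "0 < \<epsilon>" using 3 e by (simp add: \<epsilon>_def)
    show ?thesis
    proof (intro exI[of _ "c0 powr e * ((4 * pi) powr \<epsilon> / (1 - 2 powr (-\<epsilon>)))"] conjI allI impI)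
      fix h R :: real and J :: "nat set"
      assume h: "0 < h" "h \<le> 1" and R: "1 \<le> R" "h powr (-\<alpha>) / c0 \<le> R" and J: "finite J" "\<forall>j\<in>J. 2 ^ j * h \<le> 4 * pi"
      have "?a j * ?b R j \<le> c0 powr e * h powr \<epsilon> * (2 ^ j) powr \<epsilon>" for j
      proof -
        have "h powr (-\<alpha>) \<le> c0 * R" using R c0 by (simp add: divide_le_eq mult.commute)
        then have "1 / R \<le> c0 * h powr \<alpha>" using R h by (simp add: powr_minus field_simps)
        then have "2 ^ j * (1 / R) \<le> 2 ^ j * (c0 * h powr \<alpha>)" by (intro mult_left_mono) auto
        then have "?b R j \<le> (2 ^ j * (c0 * h powr \<alpha>)) powr e"
          using e R by (intro powr_mono2) auto
        also have "\<dots> = (2 ^ j) powr e * c0 powr e * h powr \<epsilon>"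
          by (simp add: powr_mult powr_powr \<epsilon>_def)
        finally have "?a j * ?b R j
            \<le> ?a j * ((2 ^ j) powr e * c0 powr e * h powr \<epsilon>)"
          by (intro mult_left_mono) auto
        also have "\<dots> = c0 powr e * h powr \<epsilon> * (?a j * (2 ^ j) powr e)" by (simp only: mult_ac)
        also have "?a j * (2 ^ j) powr e = (2 ^ j) powr \<epsilon>"
          using s2[OF 3] by (simp only: powr_add [symmetric]) (simp add: \<epsilon>_def algebra_simps)
        finally show ?thesis .
      qed
      then have "(\<Sum>j\<in>J. ?a j * ?b R j) \<le> (\<Sum>j\<in>J. c0 powr e * h powr \<epsilon> * (2 ^ j) powr \<epsilon>)"
        by (intro sum_mono)
      also have "\<dots> = c0 powr e * h powr \<epsilon> * (\<Sum>j\<in>J. (2 ^ j) powr \<epsilon>)" by (simp only: sum_distrib_left)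
      also have "\<dots> \<le> c0 powr e * h powr \<epsilon> * ((4 * pi / h) powr \<epsilon> / (1 - 2 powr (-\<epsilon>)))"
        using J h \<epsilon> by (intro mult_left_mono dyadic_nat_sum_le) (auto simp: field_simps)
      also have "\<dots> = c0 powr e * ((4 * pi) powr \<epsilon> / (1 - 2 powr (-\<epsilon>)))"
        using h by (simp add: powr_divide)
      finally show "(\<Sum>j\<in>J. ?a j * ?b R j) \<le> c0 powr e * ((4 * pi) powr \<epsilon> / (1 - 2 powr (-\<epsilon>)))" .
    qed (use \<epsilon> in \<open>simp add: powr_less_one less_imp_le\<close>)
  qed
  then obtain C' where C': "0 \<le> C'" and bound: "\<forall>h R J. 0 < h \<longrightarrow> h \<le> 1 \<longrightarrow> 1 \<le> R \<longrightarrow> h powr (-\<alpha>) / c0 \<le> R \<longrightarrow> finite J \<longrightarrow>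
     (\<forall>j\<in>J. 2 ^ j * h \<le> 4 * pi) \<longrightarrow> (\<Sum>j\<in>J. ?a j * ?b R j) \<le> C'"
    by blast
  show ?thesis
  proof (intro exI[of _ "2 * C' + 2 * D"] conjI allI impI)
    fix h R :: real and J :: "nat set"
    assume h: "0 < h" "h \<le> 1" and R: "1 \<le> R" "h powr (-\<alpha>) / c0 \<le> R" and J: "finite J" "\<forall>j\<in>J. 2 ^ j * h \<le> 4 * pi"
    show "(\<Sum>j\<in>J. ?a j * (2 ^ j / R + 1) powr e) \<le> 2 * C' + 2 * D"
      using split[OF R(1), of J] bound[THEN spec, THEN spec, THEN spec, THEN mp, THEN mp, THEN mp, THEN mp, THEN mp, THEN mp, OF h R J]
        low[OF J(1)] by linarith
  qed (use C' D in simp)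
qed

subsection \<open>The Strichartz estimate on the box\<close>

context dirichlet_box
begin

text \<open>The dyadic level of the largest entry, measured in units of R so that level j means
  frequency about 2^j. Level 0 collects everything up to frequency 1.\<close>

definition lev :: "('d::finite \<Rightarrow> nat) \<Rightarrow> nat" where
  "lev k = (LEAST j. \<forall>i. k i \<le> 2 ^ j * R)"

text \<open>A mode on level j + 1 has an entry with 2^j R < k i < L = 2 K R, that is 2^(j+1) < 4
  K.\<close>

definition levels :: "nat set" where
  "levels = {j. 2 ^ j < 4 * K}"

lemma finite_levels: "finite levels"
proof (rule finite_subset)
  show "levels \<subseteq> {..<4 * K}"
    unfolding levels_def using less_exp less_trans by blast
qed simp

lemma levels_le: "j \<in> levels \<Longrightarrow> 2 ^ j * h \<le> 4 * pi"
proof -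
  assume "j \<in> levels"
  then have "real (2 ^ j) \<le> real (4 * K)" unfolding levels_def by (simp del: of_nat_power of_nat_mult)
  then have "2 ^ j * h \<le> 4 * real K * h" using h by (intro mult_right_mono) auto
  then show ?thesis using Kh by simp
qed

lemma lev_le: "k i \<le> 2 ^ lev k * R"
proof -
  \<comment> \<open>A witness for the \<open>LEAST\<close> in \<open>lev\<close>, from n \<le> 2^n
    with n the sum of the entries.\<close>
  have "k i \<le> 2 ^ (\<Sum>i\<in>UNIV. k i) * R" for i
  proof -
    have "k i \<le> (\<Sum>i\<in>UNIV. k i)" by (rule member_le_sum) auto
    also have "\<dots> \<le> 2 ^ (\<Sum>i\<in>UNIV. k i)" by (simp add: less_imp_le)
    also have "\<dots> \<le> 2 ^ (\<Sum>i\<in>UNIV. k i) * R" using R by simp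
    finally show ?thesis .
  qed
  then have "\<forall>i. k i \<le> 2 ^ lev k * R" unfolding lev_def by (rule LeastI2_wellorder[where P="\<lambda>j. \<forall>i. k i \<le> 2 ^ j * R", OF allI]) blast
  then show ?thesis by blast
qed

lemma lev_Suc:
  assumes "lev k = Suc j"
  shows "\<exists>i. 2 ^ j * R < k i"
proof (rule ccontr)
  assume "\<not> ?thesis"
  then have "\<forall>i. k i \<le> 2 ^ j * R" by (simp add: not_less)
  then have "lev k \<le> j" unfolding lev_def by (rule Least_le)
  then show False using assms by simp
qed

lemma lev_in_levels:
  assumes "k \<in> box_index L"
  shows "lev k \<in> levels"
proof (cases "lev k")
  case 0
  then show ?thesis using K_pos by (simp add: levels_def)
next
  case (Suc j)
  then obtain i where "2 ^ j * R < k i" using lev_Suc by blast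
  also have "k i < 2 * K * R" using assms by (auto simp: box_index_iff L_def)
  finally show ?thesis using Suc by (simp add: levels_def)
qed

lemma freq_nonneg: "0 \<le> freq k" by (simp add: freq_def)

lemma symbol_nonneg: "0 \<le> symbol k"
  by (simp add: symbol_def sum_nonneg freq_nonneg)

lemma freq_ge:
  assumes "k < L"
  shows "(real k / (4 * real R))\<^sup>2 \<le> freq k"
proof -
  have "0 \<le> real k * \<theta>" using h by (simp add: \<theta>_def)
  moreover have "real k * \<theta> \<le> pi / 2"
  proof -
    have "real k * \<theta> \<le> real L * \<theta>" using assms h by (intro mult_right_mono) (auto simp: \<theta>_def)
    then show ?thesis using L_pos by (simp add: \<theta>_eq)
  qed
  ultimately have "real k * \<theta> / 2 \<le> sin (real k * \<theta>)" by (rule half_le_sin)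
  then have "4 / h\<^sup>2 * (real k * \<theta> / 2)\<^sup>2 \<le> 4 / h\<^sup>2 * (sin (real k * \<theta>))\<^sup>2"
    using \<open>0 \<le> real k * \<theta>\<close> by (intro mult_left_mono power_mono) auto
  moreover have "4 / h\<^sup>2 * (real k * \<theta> / 2)\<^sup>2 = (real k / (4 * real R))\<^sup>2"
    using h R by (simp add: \<theta>_def power_mult_distrib power_divide)
  ultimately show ?thesis by (simp add: freq_def)
qed

text \<open>On level j + 1 some entry exceeds 2^j R, and \<open>freq_ge\<close> gives (2^j / 4)^2 =
  (2^(j+1) / 8)^2; on level 0 the summand 1 suffices.\<close>

lemma lev_symbol:
  assumes k: "k \<in> box_index L"
  shows "(2 ^ lev k / 8)\<^sup>2 \<le> 1 + symbol k"
proof (cases "lev k")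
  case 0
  then show ?thesis using symbol_nonneg[of k] by (simp add: power2_eq_square)
next
  case (Suc j)
  then obtain i where i: "2 ^ j * R < k i" using lev_Suc by blast
  then have "real (2 ^ j * R) \<le> real (k i)" by (simp del: of_nat_mult of_nat_power)
  then have "2 ^ j / 4 \<le> real (k i) / (4 * real R)" using R by (simp add: field_simps)
  then have "(2 ^ j / 4)\<^sup>2 \<le> (real (k i) / (4 * real R))\<^sup>2" by (intro power_mono) auto
  also have "\<dots> \<le> freq (k i)" using k by (intro freq_ge) (simp add: box_index_iff)
  also have "\<dots> \<le> symbol k" unfolding symbol_def by (rule member_le_sum) (auto simp: freq_nonneg)
  finally show ?thesis using Suc by simp
qed

text \<open>By \<open>lev_symbol\<close>, (1 + symbol k)^s is at least (2^j / 8)^(2 s) on level j,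
  so the Sobolev weight buys the decay 2^(-j s) that makes the levels summable.\<close>

lemma level_norm_le:
  fixes c :: "('d::finite \<Rightarrow> nat) \<Rightarrow> complex"
  assumes s: "0 \<le> s"
  shows "sqrt (\<Sum>k\<in>{k\<in>box_index L. lev k = j}. (cmod (c k))\<^sup>2)
    \<le> 8 powr s * (2 ^ j) powr (-s) * sqrt (\<Sum>k\<in>box_index L. (1 + symbol k) powr s * (cmod (c k))\<^sup>2)"
proof -
  define x where "x = (8 :: real) powr s * (2 ^ j) powr (-s)"
  have x: "0 < x" by (simp add: x_def)
  have "(cmod (c k))\<^sup>2 \<le> x\<^sup>2 * ((1 + symbol k) powr s * (cmod (c k))\<^sup>2)"
    if k: "k \<in> box_index L" "lev k = j" for k
  proof -
    have "((2 ^ j / 8)\<^sup>2) powr s \<le> (1 + symbol k) powr s"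
      using lev_symbol[OF k(1)] k(2) s by (intro powr_mono2) auto
    then have "x\<^sup>2 * ((2 ^ j / 8)\<^sup>2) powr s \<le> x\<^sup>2 * (1 + symbol k) powr s"
      by (intro mult_left_mono) auto
    moreover have "x\<^sup>2 * ((2 ^ j / 8)\<^sup>2) powr s = 1"
    proof -
      have "((2 ^ j / 8 :: real)\<^sup>2) powr s = ((2 ^ j / 8) powr s)\<^sup>2"
        unfolding power2_eq_square by (rule powr_mult)
      moreover have "x * (2 ^ j / 8) powr s = 1"
        by (simp add: x_def powr_divide powr_minus)
      ultimately show ?thesis by (simp flip: power_mult_distrib)
    qed
    ultimately have "1 \<le> x\<^sup>2 * (1 + symbol k) powr s" by simp
    then have "1 * (cmod (c k))\<^sup>2 \<le> x\<^sup>2 * (1 + symbol k) powr s * (cmod (c k))\<^sup>2"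
      by (intro mult_right_mono) auto
    then show ?thesis by (simp add: mult.assoc)
  qed
  then have "(\<Sum>k\<in>{k\<in>box_index L. lev k = j}. (cmod (c k))\<^sup>2)
     \<le> (\<Sum>k\<in>{k\<in>box_index L. lev k = j}. x\<^sup>2 * ((1 + symbol k) powr s * (cmod (c k))\<^sup>2))"
    by (intro sum_mono) auto
  also have "\<dots> \<le> (\<Sum>k\<in>box_index L. x\<^sup>2 * ((1 + symbol k) powr s * (cmod (c k))\<^sup>2))"
    by (intro sum_mono2) (auto simp: finite_box_index)
  also have "\<dots> = x\<^sup>2 * (\<Sum>k\<in>box_index L. (1 + symbol k) powr s * (cmod (c k))\<^sup>2)"
    by (simp only: sum_distrib_left)
  finally have "sqrt (\<Sum>k\<in>{k\<in>box_index L. lev k = j}. (cmod (c k))\<^sup>2)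
    \<le> sqrt (x\<^sup>2 * (\<Sum>k\<in>box_index L. (1 + symbol k) powr s * (cmod (c k))\<^sup>2))"
    by (rule real_sqrt_le_mono)
  then show ?thesis using x by (simp add: real_sqrt_mult x_def)
qed

section \<open>The flow in index coordinates, sampled on a time grid\<close>

definition evolution :: "(('d::finite \<Rightarrow> nat) \<Rightarrow> complex) \<Rightarrow> real \<Rightarrow> ('d \<Rightarrow> nat) \<Rightarrow> complex" where
  "evolution c t m = (\<Sum>k\<in>box_index L. c k * cis (- t * symbol k) * of_real (sine_basis L k m))"

lemma box_index_nonempty: "box_index L \<noteq> ({} :: ('d::finite \<Rightarrow> nat) set)"
proof -
  have "1 \<le> K * R" using K_pos R by (simp add: Suc_le_eq)
  moreover have "L = 2 * (K * R)" by (simp add: L_def)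
  ultimately have "1 < L" by linarith
  then have "(\<lambda>_. 1) \<in> (box_index L :: ('d \<Rightarrow> nat) set)" by (simp add: box_index_iff)
  then show ?thesis by blast
qed

text \<open>Level j is treated at frequency 2^j, on times up to R / 2^j. The kernel constant to the
  power 2/p - 1 becomes \<open>\<kappa> j\<close>, in which d (2/p - 1) = 3 \<sigma>.
  \<open>n\<close> depends on h, but the right side does not depend on \<open>n\<close>.\<close>

lemma strichartz_on_grid:
  fixes c :: "('d::finite \<Rightarrow> nat) \<Rightarrow> complex" and p s \<sigma> :: real
  assumes p: "p = conjugate_exponent r" "1 \<le> p" "p < 2" and r: "1 < r"
    and \<sigma>: "\<sigma> = CARD('d) / 3 * (2 / p - 1)" "\<sigma> < 1" and s: "0 \<le> s"
  shows "\<exists>n>0. \<forall>\<tau>. ((\<Sum>i<n. lnorm r (box_index L) (evolution c (\<tau> + real i / real n)) powr (2 / \<sigma>)) / real n) powr (\<sigma> / 2)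
    \<le> 8 powr s * sqrt ((2 * (2 / (1 - \<sigma>) + 5) + 1) * (3 + 1 / (1 - 2 powr (p - 2)))) * 205 powr (3 * \<sigma> / 2)
        * h powr (3 * \<sigma> / 2)
        * (\<Sum>j\<in>levels. (2 ^ j) powr (\<sigma> / 2 - s) * (2 ^ j / real R + 1) powr (\<sigma> / 2))
        * sqrt (\<Sum>k\<in>box_index L. (1 + symbol k) powr s * (cmod (c k))\<^sup>2)"
proof -
  define Cp where "Cp = 3 + 1 / (1 - 2 powr (p - 2))"
  define C\<sigma> where "C\<sigma> = 2 * (2 / (1 - \<sigma>) + 5) + 1"
  define B where "B = sqrt (\<Sum>k\<in>box_index L. (1 + symbol k) powr s * (cmod (c k))\<^sup>2)"
  define \<kappa> where "\<kappa> j = Cp * (205 * h) powr (3 * \<sigma>) * (2 ^ j) powr \<sigma>" for j :: nat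
  \<comment> \<open>Capped at L - 1, the largest mode, so that the cube stays inside
    \<open>box_index L\<close>.\<close>
  define M where "M j = min (2 ^ j * R) (L - 1)" for j :: nat
  have \<sigma>0: "0 < \<sigma>" using p by (simp add: \<sigma> field_simps)
  have x1: "2 powr (p - 2) < (1 :: real)" using p by (simp add: powr_less_one)
  have Cp: "0 < Cp" using x1 by (simp add: Cp_def add_pos_pos)
  have C\<sigma>: "0 < C\<sigma>" using \<sigma>(2) by (simp add: C\<sigma>_def add_pos_pos)
  have \<kappa>0: "0 < \<kappa> j" for j using Cp h by (simp add: \<kappa>_def)
  have \<kappa>_mono: "\<kappa> 0 \<le> \<kappa> j" for j
  proof -
    have "1 \<le> (2 ^ j :: real) powr \<sigma>" using \<sigma>0 by (intro ge_one_powr_ge_zero) auto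
    then have "Cp * (205 * h) powr (3 * \<sigma>) * 1 \<le> Cp * (205 * h) powr (3 * \<sigma>) * (2 ^ j) powr \<sigma>"
      using Cp by (intro mult_left_mono) auto
    then show ?thesis by (simp add: \<kappa>_def)
  qed
  \<comment> \<open>Level 0 has the smallest \<open>\<kappa>\<close>, so one grid is fine enough for
    all levels.\<close>
  obtain n :: nat where n: "0 < n" "real n powr (-\<sigma>) \<le> \<kappa> 0"
  proof -
    define n where "n = Suc (nat \<lceil>\<kappa> 0 powr (- 1 / \<sigma>)\<rceil>)"
    have "\<kappa> 0 powr (- 1 / \<sigma>) \<le> real n" unfolding n_def by linarith
    then have "real n powr (-\<sigma>) \<le> (\<kappa> 0 powr (- 1 / \<sigma>)) powr (-\<sigma>)"
      using \<sigma>0 \<kappa>0[of 0] by (intro powr_mono2') auto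
    also have "\<dots> = \<kappa> 0" unfolding powr_powr using \<sigma>0 \<kappa>0[of 0] by simp
    finally show ?thesis using that[of n] by (simp add: n_def)
  qed
  have main: "((\<Sum>i<n. lnorm r (box_index L) (evolution c (\<tau> + real i / real n)) powr (2 / \<sigma>)) / real n) powr (\<sigma> / 2)
    \<le> (\<Sum>j\<in>levels. sqrt (\<Sum>k\<in>{k\<in>box_index L. lev k = j}. (cmod (c k))\<^sup>2)
           * sqrt (C\<sigma> * \<kappa> j) * (1 / (real R / 2 ^ j) + 1) powr (\<sigma> / 2))" for \<tau>
  proof -
    define P where "P i g \<longleftrightarrow> (\<Sum>x\<in>box_index L. cmod (g x) powr p) \<le> 1 \<and>
        of_real (lnorm r (box_index L) (evolution c (\<tau> + real i / real n)))
          = (\<Sum>x\<in>box_index L. evolution c (\<tau> + real i / real n) x * g x)" for i and g :: "('d \<Rightarrow> nat) \<Rightarrow> complex"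
    \<comment> \<open>Dual functions are needed at the sample times only, so an arbitrary choice at
      each of them suffices.\<close>
    define G where "G i = (SOME g. P i g)" for i
    have "\<exists>g. P i g" for i
      unfolding P_def p(1) by (rule lnorm_dual[OF finite_box_index box_index_nonempty r])
    then have "P i (G i)" for i
      unfolding G_def by (rule someI_ex)
    then have G: "(\<Sum>x\<in>box_index L. cmod (G i x) powr p) \<le> 1"
        "of_real (lnorm r (box_index L) (evolution c (\<tau> + real i / real n)))
          = (\<Sum>x\<in>box_index L. evolution c (\<tau> + real i / real n) x * G i x)" for i
      by (simp_all add: P_def)
    show ?thesis unfolding C\<sigma>_def
    proof (rule grid_strichartz[where Ks="box_index L" and X="box_index L" and S'="\<lambda>j. low_freqs (M j)"
          and G=G and lev=lev and c=c and \<omega>=symbol and e="sine_basis L" and T="\<lambda>j. real R / 2 ^ j" and \<kappa>=\<kappa>])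
      show "finite (box_index L :: ('d \<Rightarrow> nat) set)" "finite levels" by (rule finite_box_index finite_levels)+
      show "lev ` (box_index L :: ('d \<Rightarrow> nat) set) \<subseteq> levels" using lev_in_levels by blast
      show "finite (low_freqs (M j) :: ('d \<Rightarrow> nat) set) \<and> {k \<in> box_index L. lev k = j} \<subseteq> (low_freqs (M j) :: ('d \<Rightarrow> nat) set)" for j
      proof
        show "finite (low_freqs (M j) :: ('d \<Rightarrow> nat) set)" by (simp add: low_freqs_def finite_PiE)
        show "{k :: 'd \<Rightarrow> nat. k \<in> box_index L \<and> lev k = j} \<subseteq> low_freqs (M j)"
        proof
          fix k :: "'d \<Rightarrow> nat" assume k: "k \<in> {k. k \<in> box_index L \<and> lev k = j}"
          have "1 \<le> k i \<and> k i \<le> M j" for i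
          proof -
            have "1 \<le> k i" "k i < L" "lev k = j" using k by (auto simp: box_index_iff)
            then show ?thesis using lev_le[of k i] by (simp add: M_def)
          qed
          then show "k \<in> low_freqs (M j)" by (simp add: low_freqs_def PiE_UNIV_domain)
        qed
      qed
      show "0 \<le> lnorm r (box_index L) (evolution c (\<tau> + real i / real n))" for i
        by (rule lnorm_nonneg[OF finite_box_index box_index_nonempty])
      show "complex_of_real (lnorm r (box_index L) (evolution c (\<tau> + real i / real n)))
        = (\<Sum>x\<in>box_index L. (\<Sum>k\<in>box_index L. c k * cis (- (\<tau> + real i / real n) * symbol k) * of_real (sine_basis L k x)) * G i x)" for i
        using G(2)[of i] unfolding evolution_def .
      show "real n powr (-\<sigma>) \<le> \<kappa> j" for j using n(2) \<kappa>_mono[of j] by simp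
      have M_less: "M j < L" for j
      proof -
        have "M j \<le> L - 1" by (simp add: M_def)
        then show ?thesis using L_pos by linarith
      qed
      show "(\<Sum>k\<in>low_freqs (M j). (cmod (\<Sum>x\<in>box_index L. of_real (sine_basis L k x) * G i x))\<^sup>2) \<le> 1" for j i
      proof -
        have "(\<Sum>k\<in>low_freqs (M j). (cmod (sb.coef L (G i) k))\<^sup>2) \<le> (\<Sum>x\<in>box_index L. (cmod (G i x))\<^sup>2)"
          by (intro sb.bessel low_freqs_subset M_less)
        also have "\<dots> \<le> (\<Sum>x\<in>box_index L. cmod (G i x) powr p) powr (2 / p)"
          using p by (intro sum_squares_le_powr finite_box_index) auto
        also have "\<dots> \<le> 1"
          using G(1)[of i] p(2) sum_nonneg[of "box_index L" "\<lambda>x. cmod (G i x) powr p"] by (intro powr_le1) auto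
        finally show ?thesis by (simp add: sb.coef_def)
      qed
      fix j i i'
      define t where "t = \<tau> + real i / real n - (\<tau> + real i' / real n)"
      assume "\<tau> + real i / real n \<noteq> \<tau> + real i' / real n"
      then have t0: "t \<noteq> 0" by (simp add: t_def)
      assume "\<bar>\<tau> + real i / real n - (\<tau> + real i' / real n)\<bar> \<le> real R / 2 ^ j"
      then have tR: "\<bar>t\<bar> \<le> real R / 2 ^ j" by (simp only: t_def)
      have "cmod (\<Sum>k\<in>low_freqs (M j). cis (- t * symbol k) * sb.coef L (G i) k * cnj (sb.coef L (G i') k))
        \<le> Cp * ((205 * h) ^ CARD('d) * (2 ^ j / \<bar>t\<bar>) powr (CARD('d) / 3)) powr (2 / p - 1)"
        unfolding Cp_def
      proof (rule dispersive_estimate[OF _ _ M_less t0 tR p(2,3) G(1) G(1)])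
        have "M j \<le> 2 ^ j * R" by (simp add: M_def)
        then have "real (M j) \<le> real (2 ^ j * R)" by (rule of_nat_mono)
        then show "real (M j) \<le> 2 ^ j * real R" by simp
      qed simp
      also have "\<dots> = \<kappa> j * \<bar>t\<bar> powr (-\<sigma>)"
      proof -
        have "((205 * h) ^ CARD('d)) powr (2 / p - 1) = (205 * h) powr (3 * \<sigma>)"
        proof -
          have "(205 * h) ^ CARD('d) = (205 * h) powr CARD('d)" using h by (simp add: powr_realpow)
          moreover have "CARD('d) * (2 / p - 1) = 3 * \<sigma>" using \<sigma>(1) by simp
          ultimately show ?thesis by (simp only: powr_powr)
        qed
        moreover have "((2 ^ j / \<bar>t\<bar>) powr (CARD('d) / 3)) powr (2 / p - 1) = (2 ^ j) powr \<sigma> * \<bar>t\<bar> powr (-\<sigma>)"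
        proof -
          have "CARD('d) / 3 * (2 / p - 1) = \<sigma>" using \<sigma>(1) by simp
          then show ?thesis using t0 by (simp only: powr_powr powr_divide powr_minus_divide) simp
        qed
        ultimately show ?thesis by (simp only: powr_mult \<kappa>_def mult.assoc)
      qed
      finally show "cmod (\<Sum>k\<in>low_freqs (M j). cis (- (\<tau> + real i / real n - (\<tau> + real i' / real n)) * symbol k)
           * (\<Sum>x\<in>box_index L. of_real (sine_basis L k x) * G i x) * cnj (\<Sum>x\<in>box_index L. of_real (sine_basis L k x) * G i' x))
         \<le> \<kappa> j * \<bar>\<tau> + real i / real n - (\<tau> + real i' / real n)\<bar> powr (-\<sigma>)"
        by (simp only: t_def sb.coef_def)
    qed (use n \<sigma> \<sigma>0 R in auto)
  qed
  also have "(\<Sum>j\<in>levels. sqrt (\<Sum>k\<in>{k\<in>box_index L. lev k = j}. (cmod (c k))\<^sup>2)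
           * sqrt (C\<sigma> * \<kappa> j) * (1 / (real R / 2 ^ j) + 1) powr (\<sigma> / 2))
     \<le> (\<Sum>j\<in>levels. (8 powr s * (2 ^ j) powr (-s) * B)
           * (sqrt (C\<sigma> * Cp) * 205 powr (3 * \<sigma> / 2) * h powr (3 * \<sigma> / 2) * (2 ^ j) powr (\<sigma> / 2)) * (2 ^ j / real R + 1) powr (\<sigma> / 2))"
  proof (rule sum_mono)
    fix j
    have "sqrt (C\<sigma> * \<kappa> j) = sqrt (C\<sigma> * Cp) * (sqrt ((205 * h) powr (3 * \<sigma>)) * sqrt ((2 ^ j) powr \<sigma>))"
      by (simp add: \<kappa>_def real_sqrt_mult)
    also have "sqrt ((205 * h) powr (3 * \<sigma>)) = 205 powr (3 * \<sigma> / 2) * h powr (3 * \<sigma> / 2)"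
      by (simp add: powr_half_sqrt [symmetric] powr_powr powr_mult)
    also have "sqrt ((2 ^ j) powr \<sigma>) = (2 ^ j) powr (\<sigma> / 2)"
      by (simp add: powr_half_sqrt [symmetric] powr_powr)
    finally have "sqrt (C\<sigma> * \<kappa> j) = sqrt (C\<sigma> * Cp) * 205 powr (3 * \<sigma> / 2) * h powr (3 * \<sigma> / 2) * (2 ^ j) powr (\<sigma> / 2)"
      by (simp only: mult.assoc)
    moreover have "1 / (real R / 2 ^ j) = 2 ^ j / real R" by simp
    ultimately show "sqrt (\<Sum>k\<in>{k\<in>box_index L. lev k = j}. (cmod (c k))\<^sup>2)
           * sqrt (C\<sigma> * \<kappa> j) * (1 / (real R / 2 ^ j) + 1) powr (\<sigma> / 2)
      \<le> (8 powr s * (2 ^ j) powr (-s) * B)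
           * (sqrt (C\<sigma> * Cp) * 205 powr (3 * \<sigma> / 2) * h powr (3 * \<sigma> / 2) * (2 ^ j) powr (\<sigma> / 2)) * (2 ^ j / real R + 1) powr (\<sigma> / 2)"
      unfolding B_def using level_norm_le[OF s, of c j] C\<sigma> Cp
      by (simp only:) (intro mult_right_mono; auto)
  qed
  also have "\<dots> = (\<Sum>j\<in>levels. (8 powr s * sqrt (C\<sigma> * Cp) * 205 powr (3 * \<sigma> / 2) * h powr (3 * \<sigma> / 2))
       * ((2 ^ j) powr (\<sigma> / 2 - s) * (2 ^ j / real R + 1) powr (\<sigma> / 2)) * B)"
  proof (rule sum.cong[OF refl])
    fix j
    have "(2 ^ j :: real) powr (\<sigma> / 2 - s) = (2 ^ j) powr (-s) * (2 ^ j) powr (\<sigma> / 2)"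
      by (simp only: powr_add [symmetric]) simp
    then show "(8 powr s * (2 ^ j) powr (-s) * B)
           * (sqrt (C\<sigma> * Cp) * 205 powr (3 * \<sigma> / 2) * h powr (3 * \<sigma> / 2) * (2 ^ j) powr (\<sigma> / 2)) * (2 ^ j / real R + 1) powr (\<sigma> / 2)
      = (8 powr s * sqrt (C\<sigma> * Cp) * 205 powr (3 * \<sigma> / 2) * h powr (3 * \<sigma> / 2))
       * ((2 ^ j) powr (\<sigma> / 2 - s) * (2 ^ j / real R + 1) powr (\<sigma> / 2)) * B"
      by (simp only: mult_ac)
  qed
  also have "\<dots> = (8 powr s * sqrt (C\<sigma> * Cp) * 205 powr (3 * \<sigma> / 2) * h powr (3 * \<sigma> / 2))
       * (\<Sum>j\<in>levels. (2 ^ j) powr (\<sigma> / 2 - s) * (2 ^ j / real R + 1) powr (\<sigma> / 2)) * B"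
    by (simp only: sum_distrib_left sum_distrib_right)
  finally show ?thesis unfolding B_def C\<sigma>_def Cp_def using n(1) by blast
qed

section \<open>Translation to the norms on the box\<close>

lemma box_Lp_norm_eq:
  fixes f :: "real ^ 'd::finite \<Rightarrow> complex"
  assumes f: "f \<in> dirichlet_space h R" and r: "0 < r"
  shows "box_Lp_norm h R r f = h powr (CARD('d) / real_of_ereal r) * lnorm r (box_index L) (\<lambda>m. f (grid m))"
proof (cases "r = \<infinity>")
  case True
  let ?A = "(\<lambda>m. cmod (f (grid m))) ` box_index L"
  have A: "finite ?A" "?A \<noteq> {}" using finite_box_index box_index_nonempty by auto
  have "(SUP x\<in>lattice_box h R. cmod (f x)) = Max ?A"
  proof (rule cSup_eq_maximum)
    have "Max ?A \<in> ?A" using A by (rule Max_in)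
    then show "Max ?A \<in> (\<lambda>x. cmod (f x)) ` lattice_box h R"
      using box_interior_eq by (auto simp: box_interior_def)
  next
    fix y assume "y \<in> (\<lambda>x. cmod (f x)) ` lattice_box h R"
    then obtain x where x: "y = cmod (f x)" by blast
    show "y \<le> Max ?A"
    proof (cases "x \<in> box_interior")
      case True
      then show ?thesis unfolding x using A by (intro Max_ge) (auto simp: box_interior_eq)
    next
      case False
      then have "y = 0" using f x by (simp add: dirichlet_space_iff)
      then show ?thesis using lnorm_nonneg[OF finite_box_index box_index_nonempty, of \<infinity> "\<lambda>m. f (grid m)"]
        by (simp add: lnorm_def)
    qed
  qed
  \<comment> \<open>\<open>real_of_ereal \<infinity>\<close> is 0 and division by 0 yields 0, so the
    factor in front is \<open>h powr 0 = 1\<close>, as it should be.\<close>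
  then show ?thesis using True h by (simp add: box_Lp_norm_def lnorm_def)
next
  case False
  then obtain \<rho> where \<rho>: "r = ereal \<rho>" "0 < \<rho>" using r by (cases r) auto
  have "(\<Sum>x\<in>lattice_box h R. cmod (f x) powr \<rho>) = (\<Sum>m\<in>box_index L. cmod (f (grid m)) powr \<rho>)"
    using f by (intro sum_lattice_box) (simp add: dirichlet_space_iff)
  then have "box_Lp_norm h R r f = (h ^ CARD('d) * (\<Sum>m\<in>box_index L. cmod (f (grid m)) powr \<rho>)) powr (1 / \<rho>)"
    using \<rho> by (simp add: box_Lp_norm_def)
  also have "\<dots> = (h ^ CARD('d)) powr (1 / \<rho>) * lnorm r (box_index L) (\<lambda>m. f (grid m))"
    using \<rho> by (simp add: powr_mult lnorm_def)
  also have "(h ^ CARD('d)) powr (1 / \<rho>) = h powr (CARD('d) / \<rho>)"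
    using h by (simp add: powr_powr flip: powr_realpow)
  finally show ?thesis using \<rho> by simp
qed

lemma box_L2_norm_synth:
  fixes c :: "('d::finite \<Rightarrow> nat) \<Rightarrow> complex"
  shows "box_Lp_norm h R 2 (synth c) = h powr (CARD('d) / 2) * sqrt (\<Sum>k\<in>box_index L. (cmod (c k))\<^sup>2)"
proof -
  have "lnorm 2 (box_index L) (\<lambda>m. synth c (grid m)) = sqrt (\<Sum>m\<in>box_index L. (cmod (synth c (grid m)))\<^sup>2)"
    by (simp add: lnorm_def powr_half_sqrt sum_nonneg powr_numeral)
  also have "(\<Sum>m\<in>box_index L. (cmod (synth c (grid m)))\<^sup>2) = (\<Sum>k\<in>box_index L. (cmod (dcoef (synth c) k))\<^sup>2)"
    unfolding dcoef_def by (rule sb.parseval_norm [symmetric])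
  also have "\<dots> = (\<Sum>k\<in>box_index L. (cmod (c k))\<^sup>2)"
    by (intro sum.cong refl) (simp add: dcoef_synth)
  finally show ?thesis using box_Lp_norm_eq[OF synth_dirichlet, of 2 c] by simp
qed

lemma schroedinger_flow_eq:
  assumes "w \<in> dirichlet_space h R"
  shows "schroedinger_flow h R t w = synth (\<lambda>k. cis (- t * symbol k) * dcoef w k)"
  unfolding schroedinger_flow_def calculus_eq[OF assms]
  by (intro synth_cong) (simp add: cis_conv_exp)

lemma schroedinger_flow_grid:
  assumes "w \<in> dirichlet_space h R" "m \<in> box_index L"
  shows "schroedinger_flow h R t w (grid m) = evolution (dcoef w) t m"
  by (simp add: schroedinger_flow_eq[OF assms(1)] synth_grid[OF assms(2)] evolution_def mult_ac)

lemma lnorm_cong: "(\<And>x. x \<in> A \<Longrightarrow> f x = g x) \<Longrightarrow> lnorm r A f = lnorm r A g"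
  by (simp add: lnorm_def)

lemma box_norm_flow:
  fixes w :: "real ^ 'd::finite \<Rightarrow> complex"
  assumes w: "w \<in> dirichlet_space h R" and r: "0 < r"
  shows "box_Lp_norm h R r (schroedinger_flow h R t w)
    = h powr (CARD('d) / real_of_ereal r) * lnorm r (box_index L) (evolution (dcoef w) t)"
proof -
  have "schroedinger_flow h R t w \<in> dirichlet_space h R"
    unfolding schroedinger_flow_eq[OF w] by (rule synth_dirichlet)
  moreover have "lnorm r (box_index L) (\<lambda>m. schroedinger_flow h R t w (grid m)) = lnorm r (box_index L) (evolution (dcoef w) t)"
    by (intro lnorm_cong schroedinger_flow_grid[OF w])
  ultimately show ?thesis using box_Lp_norm_eq[OF _ r] by metis
qed

lemma box_norm_flow_L2:
  fixes w :: "real ^ 'd::finite \<Rightarrow> complex"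
  assumes w: "w \<in> dirichlet_space h R"
  shows "box_Lp_norm h R 2 (schroedinger_flow h R t w) = h powr (CARD('d) / 2) * sqrt (\<Sum>k\<in>box_index L. (cmod (dcoef w k))\<^sup>2)"
  unfolding schroedinger_flow_eq[OF w] box_L2_norm_synth by (simp add: norm_mult)

lemma box_norm_bessel:
  fixes w :: "real ^ 'd::finite \<Rightarrow> complex"
  assumes w: "w \<in> dirichlet_space h R"
  shows "box_Lp_norm h R 2 (bessel_potential h R (s / 2) w)
    = h powr (CARD('d) / 2) * sqrt (\<Sum>k\<in>box_index L. (1 + symbol k) powr s * (cmod (dcoef w k))\<^sup>2)"
proof -
  have "(cmod (of_real ((1 - - symbol k) powr (s / 2)) * dcoef w k))\<^sup>2 = (1 + symbol k) powr s * (cmod (dcoef w k))\<^sup>2" for k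
    using symbol_nonneg[of k] by (simp add: norm_mult power_mult_distrib powr_power)
  then show ?thesis
    unfolding bessel_potential_def calculus_eq[OF w] box_L2_norm_synth by (simp only:)
qed

text \<open>The powers of h balance: h^(d/r) from the space norm times h^(3/q) from the kernel is
  h^(d/2), the weight of the L^2 norm. That is the relation \<open>scale\<close>, so the constant is
  free of h.\<close>

lemma strichartz_box:
  fixes w :: "real ^ 'd::finite \<Rightarrow> complex" and q p s :: real
  assumes w: "w \<in> dirichlet_space h R"
    and p: "p = conjugate_exponent r" "1 \<le> p" "p < 2" and r: "1 < r"
    and q: "2 / q = CARD('d) / 3 * (2 / p - 1)" "2 < q" and s: "0 \<le> s"
    and scale: "3 / q + CARD('d) / real_of_ereal r = CARD('d) / 2"
    and D: "(\<Sum>j\<in>levels. (2 ^ j) powr (1 / q - s) * (2 ^ j / real R + 1) powr (1 / q)) \<le> D"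
  shows "unit_time_norm (ereal q) (\<lambda>t. box_Lp_norm h R r (schroedinger_flow h R t w))
    \<le> ennreal (8 powr s * sqrt ((2 * (2 / (1 - 2 / q) + 5) + 1) * (3 + 1 / (1 - 2 powr (p - 2)))) * 205 powr (3 / q)
        * D * box_Lp_norm h R 2 (bessel_potential h R (s / 2) w))"
proof -
  define \<sigma> where "\<sigma> = 2 / q"
  define A where "A = 8 powr s * sqrt ((2 * (2 / (1 - \<sigma>) + 5) + 1) * (3 + 1 / (1 - 2 powr (p - 2)))) * 205 powr (3 * \<sigma> / 2)"
  define W where "W = sqrt (\<Sum>k\<in>box_index L. (1 + symbol k) powr s * (cmod (dcoef w k))\<^sup>2)"
  define H where "H = h powr (CARD('d) / real_of_ereal r)"
  define N where "N t = box_Lp_norm h R r (schroedinger_flow h R t w)" for t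
  have \<sigma>1: "\<sigma> < 1" using q by (simp add: \<sigma>_def)
  have \<sigma>q: "2 / \<sigma> = q" "\<sigma> / 2 = 1 / q" "3 * \<sigma> / 2 = 3 / q" using q by (simp_all add: \<sigma>_def)
  have N: "N t = H * lnorm r (box_index L) (evolution (dcoef w) t)" for t
    unfolding N_def H_def by (intro box_norm_flow[OF w] less_trans[OF _ r]) simp
  have N0: "0 \<le> N t" for t
    unfolding N H_def by (intro mult_nonneg_nonneg lnorm_nonneg finite_box_index box_index_nonempty) simp
  have x1: "2 powr (p - 2) < (1 :: real)" using p by (simp add: powr_less_one)
  have "0 \<le> (2 * (2 / (1 - \<sigma>) + 5) + 1) * (3 + 1 / (1 - 2 powr (p - 2)))"
    using \<sigma>1 x1 by (intro mult_nonneg_nonneg add_nonneg_nonneg) auto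
  then have A0: "0 \<le> A" by (simp add: A_def)
  have W0: "0 \<le> W" by (simp add: W_def sum_nonneg symbol_nonneg)
  have D0: "0 \<le> D" by (rule order_trans[OF sum_nonneg D]) auto
  have H0: "0 < H" using h by (simp add: H_def)
  obtain n where n: "0 < n" and grid: "\<And>\<tau>. ((\<Sum>i<n. lnorm r (box_index L) (evolution (dcoef w) (\<tau> + real i / real n)) powr q) / real n) powr (1 / q)
    \<le> A * h powr (3 / q)
        * (\<Sum>j\<in>levels. (2 ^ j) powr (1 / q - s) * (2 ^ j / real R + 1) powr (1 / q)) * W"
    using strichartz_on_grid[OF p r _ \<sigma>1 s, of "dcoef w"] q(1)
    unfolding A_def W_def \<sigma>q by (auto simp: \<sigma>_def)
  have "unit_time_norm (ereal q) N \<le> ennreal (H * (A * h powr (3 / q) * D * W))"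
  proof (rule unit_time_norm_le[OF _ N0 n])
    show "N \<in> borel_measurable borel"
    proof -
      have "(\<lambda>t. lnorm r (box_index L) (evolution (dcoef w) t)) \<in> borel_measurable borel"
        unfolding evolution_def
        by (intro borel_measurable_lnorm finite_box_index borel_measurable_continuous_onI continuous_intros)
      then show ?thesis unfolding N by simp
    qed
    show "((\<Sum>i<n. N (\<tau> + real i / real n) powr q) / real n) powr (1 / q) \<le> H * (A * h powr (3 / q) * D * W)" for \<tau>
    proof -
      have "(\<Sum>i<n. N (\<tau> + real i / real n) powr q) / real n
        = H powr q * ((\<Sum>i<n. lnorm r (box_index L) (evolution (dcoef w) (\<tau> + real i / real n)) powr q) / real n)"
        unfolding N by (simp add: powr_mult sum_distrib_left)
      then have "((\<Sum>i<n. N (\<tau> + real i / real n) powr q) / real n) powr (1 / q)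
        = (H powr q) powr (1 / q) * ((\<Sum>i<n. lnorm r (box_index L) (evolution (dcoef w) (\<tau> + real i / real n)) powr q) / real n) powr (1 / q)"
        by (simp only: powr_mult)
      also have "(H powr q) powr (1 / q) = H" using H0 q by (simp add: powr_powr)
      also have "H * ((\<Sum>i<n. lnorm r (box_index L) (evolution (dcoef w) (\<tau> + real i / real n)) powr q) / real n) powr (1 / q)
        \<le> H * (A * h powr (3 / q)
        * (\<Sum>j\<in>levels. (2 ^ j) powr (1 / q - s) * (2 ^ j / real R + 1) powr (1 / q)) * W)"
        using grid[of \<tau>] H0 by (intro mult_left_mono) auto
      also have "\<dots> \<le> H * (A * h powr (3 / q) * D * W)"
        using D H0 A0 W0 by (intro mult_left_mono mult_right_mono) auto
      finally show ?thesis .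
    qed
  qed (use q H0 A0 D0 W0 in auto)
  also have "H * (A * h powr (3 / q) * D * W) = A * D * (h powr (CARD('d) / 2) * W)"
  proof -
    have "H * h powr (3 / q) = h powr (CARD('d) / 2)"
      unfolding H_def powr_add [symmetric] scale [symmetric] by (simp only: add.commute)
    moreover have "H * (A * h powr (3 / q) * D * W) = A * D * ((H * h powr (3 / q)) * W)"
      by (simp only: mult_ac)
    ultimately show ?thesis by (simp only:)
  qed
  also have "h powr (CARD('d) / 2) * W = box_Lp_norm h R 2 (bessel_potential h R (s / 2) w)"
    unfolding W_def by (rule box_norm_bessel[OF w, symmetric])
  finally show ?thesis unfolding N_def A_def \<sigma>q unfolding \<sigma>_def .
qed

text \<open>The endpoint q = \<infinity>, r = 2: the flow multiplies coefficients by unimodular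
  numbers, so the norm is constant in time, and the Bessel weight is at least 1.\<close>

lemma unitarity_bound:
  fixes w :: "real ^ 'd::finite \<Rightarrow> complex"
  assumes w: "w \<in> dirichlet_space h R" and s: "0 \<le> s"
  shows "unit_time_norm \<infinity> (\<lambda>t. box_Lp_norm h R 2 (schroedinger_flow h R t w))
    \<le> ennreal (box_Lp_norm h R 2 (bessel_potential h R (s / 2) w))"
proof -
  have "h powr (CARD('d) / 2) * sqrt (\<Sum>k\<in>box_index L. (cmod (dcoef w k))\<^sup>2)
     \<le> box_Lp_norm h R 2 (bessel_potential h R (s / 2) w)"
    unfolding box_norm_bessel[OF w]
  proof (intro mult_left_mono real_sqrt_le_mono sum_mono)
    fix k :: "'d \<Rightarrow> nat"
    have "1 \<le> (1 + symbol k) powr s" using symbol_nonneg[of k] s by (simp add: ge_one_powr_ge_zero)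
    then have "1 * (cmod (dcoef w k))\<^sup>2 \<le> (1 + symbol k) powr s * (cmod (dcoef w k))\<^sup>2"
      by (intro mult_right_mono) auto
    then show "(cmod (dcoef w k))\<^sup>2 \<le> (1 + symbol k) powr s * (cmod (dcoef w k))\<^sup>2" by simp
  qed simp
  then show ?thesis
    unfolding unit_time_norm_def box_norm_flow_L2[OF w]
    by (auto intro!: esssup_I ennreal_leI)
qed

end

text \<open>The strict bound 2 < Q is what the Hardy-Littlewood-Sobolev inequality requires. For r =
  \<infinity>, Q d = 6, and Q = 2 is the excluded triple; for finite r, Q = 2 would force d / r = (d
  - 3) / 2 \<le> 0. Finiteness of Q makes r > 2, hence a dual exponent below 2.\<close>

lemma admissible_exponents:
  assumes d: "d \<in> {2, 3}" and adm: "lattice_admissible d (ereal Q) r"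
  shows "2 < Q" "1 < r" "1 \<le> conjugate_exponent r" "conjugate_exponent r < 2"
    "2 / Q = real d / 3 * (2 / conjugate_exponent r - 1)"
    "3 / Q + real d / real_of_ereal r = real d / 2"
proof -
  have Q: "2 \<le> Q" and r2: "2 \<le> r" and eq: "3 / ereal Q + ereal (real d) / r = ereal (real d / 2)"
    and ex: "(ereal Q, r, d) \<noteq> (2, \<infinity>, 3)"
    using adm by (auto simp: lattice_admissible_def numeral_eq_ereal)
  have 3: "3 / ereal Q = ereal (3 / Q)" using Q by (simp add: numeral_eq_ereal)
  show "1 < r" using r2 by (rule less_le_trans[rotated]) simp
  have "2 < Q \<and> 1 \<le> conjugate_exponent r \<and> conjugate_exponent r < 2 \<and>
    2 / Q = real d / 3 * (2 / conjugate_exponent r - 1) \<and>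
    3 / Q + real d / real_of_ereal r = real d / 2"
  proof (cases "r = \<infinity>")
    case True
    then have e: "3 / Q = real d / 2" using eq unfolding 3 True by simp
    then have Qd: "Q * real d = 6" using Q d by (auto simp: field_simps)
    have "d \<noteq> 3"
    proof
      assume "d = 3"
      then have "Q = 2" using Qd by simp
      then show False using ex True \<open>d = 3\<close> by (simp add: numeral_eq_ereal)
    qed
    \<comment> \<open>Now Q = 3 and the dual exponent is 1; \<open>real d / real_of_ereal r\<close>
      is 0 by the conventions for \<infinity> and for division by 0.\<close>
    then have "d = 2" using d by auto
    then show ?thesis using Qd True by (auto simp: conjugate_exponent_def)
  next
    case False
    then obtain \<rho> where \<rho>: "r = ereal \<rho>" using r2 by (cases r) auto
    have \<rho>2: "2 \<le> \<rho>" using r2 by (simp add: \<rho> numeral_eq_ereal)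
    have e: "3 / Q + real d / \<rho> = real d / 2" using eq \<rho>2 unfolding 3 \<rho> by simp
    have Q0: "0 < 3 / Q" using Q by simp
    then have "real d / \<rho> < real d / 2" using e by linarith
    then have "\<rho> \<noteq> 2" by auto
    then have \<rho>3: "2 < \<rho>" using \<rho>2 by simp
    have "2 < Q"
    proof (rule ccontr)
      assume "\<not> 2 < Q"
      then have "Q = 2" using Q by simp
      then have "3 / 2 + real d / \<rho> = real d / 2" using e by simp
      moreover have "0 < real d / \<rho>" using d \<rho>3 by auto
      ultimately show False using d by auto
    qed
    moreover have "2 / Q = real d / 3 * (2 / (\<rho> / (\<rho> - 1)) - 1)"
    proof -
      have "3 / Q = real d / 2 - real d / \<rho>" using e by simp
      then have "2 / Q = 2 / 3 * (real d / 2 - real d / \<rho>)" by simp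
      also have "\<dots> = real d / 3 * (2 / (\<rho> / (\<rho> - 1)) - 1)" using \<rho>3 by (simp add: field_simps)
      finally show ?thesis .
    qed
    moreover have "1 \<le> \<rho> / (\<rho> - 1)" "\<rho> / (\<rho> - 1) < 2" using \<rho>3 by (simp_all add: field_simps)
    ultimately show ?thesis using e by (simp add: conjugate_exponent_def \<rho>)
  qed
  then show "2 < Q" "1 \<le> conjugate_exponent r" "conjugate_exponent r < 2"
    "2 / Q = real d / 3 * (2 / conjugate_exponent r - 1)"
    "3 / Q + real d / real_of_ereal r = real d / 2" by auto
qed

theorem theorem1p2:
  fixes q r :: ereal and \<alpha> c\<^sub>0 s :: real
  assumes "CARD('d::finite) \<in> {2, 3}"
    and "\<alpha> \<ge> 0" and "c\<^sub>0 \<ge> 1"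
    and "lattice_admissible CARD('d) q r"
    and "\<alpha> \<ge> 1 \<Longrightarrow> ereal s > 1 / q"
    and "0 < \<alpha> \<Longrightarrow> \<alpha> < 1 \<Longrightarrow> ereal s = ereal (2 - \<alpha>) / q"
    and "\<alpha> = 0 \<Longrightarrow> ereal s > 2 / q"
  shows "\<exists>C>0. \<forall>(h::real) (K::nat) (R::nat).
           0 < h \<and> h \<le> 1 \<and> real K = pi / h \<and>
           h powr (-\<alpha>) / c\<^sub>0 \<le> real R \<and> real R \<le> c\<^sub>0 * h powr (-\<alpha>) \<longrightarrow>
           (\<forall>w\<^sub>0 \<in> (dirichlet_space h R :: (real ^ 'd \<Rightarrow> complex) set).
              unit_time_norm q (\<lambda>t. box_Lp_norm h R r (schroedinger_flow h R t w\<^sub>0))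
              \<le> ennreal (C * box_Lp_norm h R 2 (bessel_potential h R (s / 2) w\<^sub>0)))"
proof -
  have box: "dirichlet_box h K R"
    if "0 < h \<and> h \<le> 1 \<and> real K = pi / h \<and> h powr (-\<alpha>) / c\<^sub>0 \<le> real R \<and> real R \<le> c\<^sub>0 * h powr (-\<alpha>)" for h K R
  proof
    have "0 < h powr (-\<alpha>) / c\<^sub>0" using that assms(3) by simp
    \<comment> \<open>The lower bound on R makes it positive, and a positive natural number is at
      least 1.\<close>
    then have "0 < real R" using that by linarith
    then show "1 \<le> R" by simp
  qed (use that in auto)
  show ?thesis
  proof (cases "q = \<infinity>")
    case True
    \<comment> \<open>3/q vanishes, so admissibility reduces to d/r = d/2.\<close>
    have r: "r = 2"
    proof (cases "r = \<infinity>")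
      case True
      then show ?thesis using assms(1,4) \<open>q = \<infinity>\<close> by (auto simp: lattice_admissible_def)
    next
      case False
      then obtain \<rho> where \<rho>: "r = ereal \<rho>" "2 \<le> \<rho>"
        using assms(4) by (cases r) (auto simp: lattice_admissible_def numeral_eq_ereal)
      then have "real CARD('d) / \<rho> = real CARD('d) / 2"
        using assms(4) True by (simp add: lattice_admissible_def)
      then show ?thesis using \<rho> assms(1) by (auto simp: field_simps numeral_eq_ereal)
    qed
    consider "1 \<le> \<alpha>" | "\<alpha> = 0" | "0 < \<alpha>" "\<alpha> < 1" using assms(2) by linarith
    then have s: "0 \<le> s" using assms(5-7) True by cases auto
    show ?thesis
    proof (intro exI[of _ "1 :: real"] conjI allI impI ballI)
      fix h :: real and K R :: nat and w :: "real ^ 'd \<Rightarrow> complex"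
      assume hKR: "0 < h \<and> h \<le> 1 \<and> real K = pi / h \<and> h powr (-\<alpha>) / c\<^sub>0 \<le> real R \<and> real R \<le> c\<^sub>0 * h powr (-\<alpha>)"
        and w: "w \<in> dirichlet_space h R"
      show "unit_time_norm q (\<lambda>t. box_Lp_norm h R r (schroedinger_flow h R t w))
          \<le> ennreal (1 * box_Lp_norm h R 2 (bessel_potential h R (s / 2) w))"
        using dirichlet_box.unitarity_bound[OF box[OF hKR] w s] by (simp add: True r)
    qed simp
  next
    case False
    then obtain Q where Q: "q = ereal Q"
      using assms(4) by (cases q) (auto simp: lattice_admissible_def)
    define p where "p = conjugate_exponent r"
    note ex = admissible_exponents[OF assms(1) assms(4)[unfolded Q]]
    have Q2: "2 < Q" by (rule ex(1))
    have s1: "1 \<le> \<alpha> \<Longrightarrow> 1 / Q < s" and s2: "0 < \<alpha> \<Longrightarrow> \<alpha> < 1 \<Longrightarrow> s = (2 - \<alpha>) * (1 / Q)"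
      and s3: "\<alpha> = 0 \<Longrightarrow> 2 * (1 / Q) < s"
      using assms(5-7) Q2 by (simp_all add: Q one_ereal_def numeral_eq_ereal)
    have s: "0 \<le> s"
    proof -
      consider "1 \<le> \<alpha>" | "\<alpha> = 0" | "0 < \<alpha>" "\<alpha> < 1" using assms(2) by linarith
      then show ?thesis
      proof cases
        case 1
        have "0 < 1 / Q" using Q2 by simp
        then show ?thesis using s1[OF 1] by linarith
      next
        case 2
        have "0 < 1 / Q" using Q2 by simp
        then show ?thesis using s3[OF 2] by linarith
      next
        case 3
        then show ?thesis using s2[OF 3] Q2 by simp
      qed
    qed
    obtain D where D: "0 < D" and level: "\<forall>h R J. 0 < h \<longrightarrow> h \<le> 1 \<longrightarrow> 1 \<le> R \<longrightarrow> h powr (-\<alpha>) / c\<^sub>0 \<le> R \<longrightarrow> finite J \<longrightarrow>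
       (\<forall>j\<in>J. 2 ^ j * h \<le> 4 * pi) \<longrightarrow>
       (\<Sum>j\<in>J. (2 ^ j) powr (1 / Q - s) * (2 ^ j / R + 1) powr (1 / Q)) \<le> D"
      using level_sum_bound[of "1 / Q" c\<^sub>0 \<alpha> s] Q2 assms(2,3) s1 s2 s3 by auto
    define A where "A = 8 powr s * sqrt ((2 * (2 / (1 - 2 / Q) + 5) + 1) * (3 + 1 / (1 - 2 powr (p - 2)))) * 205 powr (3 / Q)"
    have x1: "2 powr (p - 2) < (1 :: real)" using ex(4) by (simp add: p_def powr_less_one)
    have "0 < (2 * (2 / (1 - 2 / Q) + 5) + 1) * (3 + 1 / (1 - 2 powr (p - 2)))"
      using Q2 x1 by (intro mult_pos_pos add_pos_pos) auto
    then have A: "0 < A" by (simp add: A_def)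
    show ?thesis
    proof (intro exI[of _ "A * D"] conjI allI impI ballI)
      fix h :: real and K R :: nat and w :: "real ^ 'd \<Rightarrow> complex"
      assume hKR: "0 < h \<and> h \<le> 1 \<and> real K = pi / h \<and> h powr (-\<alpha>) / c\<^sub>0 \<le> real R \<and> real R \<le> c\<^sub>0 * h powr (-\<alpha>)"
        and w: "w \<in> dirichlet_space h R"
      interpret dirichlet_box h K R by (rule box[OF hKR])
      have "(\<Sum>j\<in>levels. (2 ^ j) powr (1 / Q - s) * (2 ^ j / real R + 1) powr (1 / Q)) \<le> D"
        using level[THEN spec, THEN spec, THEN spec, THEN mp, THEN mp, THEN mp, THEN mp, THEN mp, THEN mp,
            of h "real R" levels] hKR R finite_levels levels_le by simp
      from strichartz_box[OF w p_def ex(3,4)[folded p_def] ex(2) ex(5)[folded p_def] Q2 s ex(6) this]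
      show "unit_time_norm q (\<lambda>t. box_Lp_norm h R r (schroedinger_flow h R t w))
          \<le> ennreal (A * D * box_Lp_norm h R 2 (bessel_potential h R (s / 2) w))"
        unfolding Q A_def .
    qed (use A D in simp)
  qed
qed

end
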